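(* Let $P\subset\mathbb{H}^n$ be a finite-volume quasi-arithmetic Coxeter polytope with ground field $\mathbb{F}=\mathbb{F}(P)$, and let $P'$ be a $k$-dimensional face of $P$ with $2\le k\le n-1$. If $P'$ (regarded as a polytope in the $k$-dimensional hyperbolic space spanned by it) is itself a Coxeter polytope, then $P'$ is a quasi-arithmetic Coxeter polytope with ground field $\mathbb{F}(P')=\mathbb{F}$.
   Context: Use the hyperboloid model: $\mathbb{E}^{n,1}$ is $\mathbb{R}^{n+1}$ with a symmetric bilinear form $(\cdot,\cdot)$ of signature $(n,1)$, and $\mathbb{H}^n=\{v:(v,v)=-1\}$ intersected with one sheet of the cone $\{(v,v)<0\}$. For $e$ with $(e,e)=1$ let $H_e=\{x\in\mathbb{H}^n:(x,e)=0\}$ and $H_e^-=\{x:(x,e)\le 0\}$. A finite-volume convex polytope is written irredundantly as $P=\bigcap_{j=0}^N H_{e_j}^-$; its Gram matrix is $G(P)=(g_{ij})=((e_i,e_j))_{i,j=0}^N$. $P$ is acute-angled if all its dihedral angles are $\le\pi/2$; it is a Coxeter polytope if any two intersecting bounding hyperplanes meet at dihedral angle $\pi/m$ with $m\ge2$ an integer. A face of $P$ is itself a polytope in the lower-dimensional hyperbolic space it spans, bounded by its intersections with the adjacent facets of $P$, and has its own Gram matrix (computed from unit normals inside that subspace). Set $\widetilde{\mathbb{F}}(P)=\mathbb{Q}(\{g_{ij}\})$ and $\mathbb{F}(P)=\mathbb{Q}(\mathrm{Cyc}(G(P)))$, where $\mathrm{Cyc}(A)$ is the set of cyclic products $a_{i_1i_2}a_{i_2i_3}\cdots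 a_{i_ki_1}$ of entries of $A$; $\mathbb{F}(P)$ is the ground field of $P$. A finite-volume acute-angled polytope $P$ is quasi-arithmetic if (V1) $\widetilde{\mathbb{F}}(P)$ is a totally real algebraic number field, and (V2) for every embedding $\sigma:\widetilde{\mathbb{F}}(P)\to\mathbb{R}$ with $\sigma|_{\mathbb{F}(P)}\neq\mathrm{Id}$, the matrix $G(P)^\sigma$ (entrywise $\sigma$) is positive semi-definite. (For Coxeter polytopes this is equivalent, by Vinberg's criterion, to the reflection group of $P$ being quasi-arithmetic.) *)

theory Defs
  imports "HOL-Analysis.Analysis"
begin

text \<open>The ambient space is real^'n \<times> real (so n = CARD('n) and the ambient
  dimension is n+1), with the Lorentzian form of signature (n,1).\<close>

type_synonym 'n lvec = "(real^'n) \<times> real"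

definition lf :: "('n::finite) lvec \<Rightarrow> ('n::finite) lvec \<Rightarrow> real" where
  "lf x y = fst x \<bullet> fst y - snd x * snd y"

definition hyp :: "('n::finite) lvec set" where
  "hyp = {x. lf x x = -1 \<and> snd x > 0}"

text \<open>Everything below is relative to a linear subspace V of the ambient space;
  the hyperbolic space spanned by V is V \<inter> H^n.  For V = UNIV this is H^n itself,
  for V = span of a k-face this is the k-dimensional hyperbolic space spanned by it.\<close>

definition hypV :: "('n::finite) lvec set \<Rightarrow> ('n::finite) lvec set" where
  "hypV V = V \<inter> hyp"

definition hplane :: "('n::finite) lvec set \<Rightarrow> ('n::finite) lvec \<Rightarrow> ('n::finite) lvec set" where
  "hplane V e = {x \<in> hypV V. lf x e = 0}"

definition hspace :: "('n::finite) lvec set \<Rightarrow> ('n::finite) lvec \<Rightarrow> ('n::finite) lvec set" where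
  "hspace V e = {x \<in> hypV V. lf x e \<le> 0}"

definition poly :: "('n::finite) lvec set \<Rightarrow> ('n::finite) lvec set \<Rightarrow> ('n::finite) lvec set" where
  "poly V E = hypV V \<inter> (\<Inter>e\<in>E. hspace V e)"

definition convex_polytope :: "('n::finite) lvec set \<Rightarrow> ('n::finite) lvec set \<Rightarrow> bool" where
  "convex_polytope V E \<longleftrightarrow>
     subspace V \<and> finite E \<and> E \<subseteq> V \<and> (\<forall>e\<in>E. lf e e = 1) \<and>
     (\<forall>e\<in>E. poly V (E - {e}) \<noteq> poly V E) \<and>
     (\<exists>x\<in>hypV V. \<forall>e\<in>E. lf x e < 0)"

text \<open>Hyperbolic k-volume on V \<inter> H^n (dim V = k+1) via the chart
  x \<mapsto> \<Sum> x_i b_i + sqrt(1+|x|^2) b_0 given by a Lorentz-orthonormal basis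
  b_0 (future timelike), b_1..b_k of V; the Riemannian volume density in this chart
  is 1/sqrt(1+|x|^2) w.r.t. Lebesgue measure on R^k.  (The volume does not depend
  on the chosen basis, since bases differ by isometries.)\<close>

definition lorentz_basis :: "('n::finite) lvec set \<Rightarrow> nat \<Rightarrow> ('n::finite) lvec \<Rightarrow> (nat \<Rightarrow> ('n::finite) lvec) \<Rightarrow> bool" where
  "lorentz_basis V k b0 b \<longleftrightarrow>
     b0 \<in> V \<and> lf b0 b0 = -1 \<and> snd b0 > 0 \<and>
     (\<forall>i<k. b i \<in> V \<and> lf b0 (b i) = 0) \<and>
     (\<forall>i<k. \<forall>j<k. lf (b i) (b j) = (if i = j then 1 else 0))"

definition hchart :: "nat \<Rightarrow> ('n::finite) lvec \<Rightarrow> (nat \<Rightarrow> ('n::finite) lvec) \<Rightarrow> (nat \<Rightarrow> real) \<Rightarrow> ('n::finite) lvec" where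
  "hchart k b0 b x = (\<Sum>i<k. x i *\<^sub>R b i) + sqrt (1 + (\<Sum>i<k. (x i)\<^sup>2)) *\<^sub>R b0"

definition finite_hvolume :: "('n::finite) lvec set \<Rightarrow> ('n::finite) lvec set \<Rightarrow> bool" where
  "finite_hvolume V S \<longleftrightarrow>
     (let k = dim V - 1 in
      \<exists>b0 b. lorentz_basis V k b0 b \<and>
        (\<integral>\<^sup>+ x. indicator {x. hchart k b0 b x \<in> S} x *
                   ennreal (1 / sqrt (1 + (\<Sum>i<k. (x i)\<^sup>2)))
           \<partial>(PiM {..<k} (\<lambda>_. lborel))) < \<infinity>)"

definition dihedral :: "('n::finite) lvec \<Rightarrow> ('n::finite) lvec \<Rightarrow> real" where
  "dihedral e f = arccos (- lf e f)"

definition acute_angled :: "('n::finite) lvec set \<Rightarrow> ('n::finite) lvec set \<Rightarrow> bool" where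
  "acute_angled V E \<longleftrightarrow>
     (\<forall>e\<in>E. \<forall>f\<in>E. e \<noteq> f \<and> hplane V e \<inter> hplane V f \<noteq> {} \<longrightarrow> dihedral e f \<le> pi / 2)"

definition coxeter :: "('n::finite) lvec set \<Rightarrow> ('n::finite) lvec set \<Rightarrow> bool" where
  "coxeter V E \<longleftrightarrow>
     (\<forall>e\<in>E. \<forall>f\<in>E. e \<noteq> f \<and> hplane V e \<inter> hplane V f \<noteq> {} \<longrightarrow>
        (\<exists>m::nat. m \<ge> 2 \<and> dihedral e f = pi / real m))"

definition is_subfield :: "real set \<Rightarrow> bool" where
  "is_subfield K \<longleftrightarrow> 0 \<in> K \<and> 1 \<in> K \<and>
     (\<forall>x\<in>K. \<forall>y\<in>K. x + y \<in> K \<and> x * y \<in> K) \<and>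
     (\<forall>x\<in>K. - x \<in> K \<and> inverse x \<in> K)"

definition gen_field :: "real set \<Rightarrow> real set" where
  "gen_field S = \<Inter>{K. is_subfield K \<and> S \<subseteq> K}"

definition number_field :: "real set \<Rightarrow> bool" where
  "number_field K \<longleftrightarrow> is_subfield K \<and>
     (\<exists>B. finite B \<and> B \<subseteq> K \<and>
        (\<forall>x\<in>K. \<exists>c::real \<Rightarrow> rat. x = (\<Sum>b\<in>B. of_rat (c b) * b)))"

definition cembedding :: "real set \<Rightarrow> (real \<Rightarrow> complex) \<Rightarrow> bool" where
  "cembedding K \<sigma> \<longleftrightarrow> \<sigma> 1 = 1 \<and>
     (\<forall>x\<in>K. \<forall>y\<in>K. \<sigma> (x + y) = \<sigma> x + \<sigma> y \<and> \<sigma> (x * y) = \<sigma> x * \<sigma> y)"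

definition rembedding :: "real set \<Rightarrow> (real \<Rightarrow> real) \<Rightarrow> bool" where
  "rembedding K \<sigma> \<longleftrightarrow> \<sigma> 1 = 1 \<and>
     (\<forall>x\<in>K. \<forall>y\<in>K. \<sigma> (x + y) = \<sigma> x + \<sigma> y \<and> \<sigma> (x * y) = \<sigma> x * \<sigma> y)"

definition totally_real_number_field :: "real set \<Rightarrow> bool" where
  "totally_real_number_field K \<longleftrightarrow> number_field K \<and>
     (\<forall>\<sigma>. cembedding K \<sigma> \<longrightarrow> (\<forall>x\<in>K. \<sigma> x \<in> \<real>))"

definition gram_entries :: "('n::finite) lvec set \<Rightarrow> real set" where
  "gram_entries E = {lf e f | e f. e \<in> E \<and> f \<in> E}"

definition cyc :: "('n::finite) lvec set \<Rightarrow> real set" where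
  "cyc E = {(\<Prod>j<length xs. lf (xs ! j) (xs ! (Suc j mod length xs))) | xs.
              xs \<noteq> [] \<and> set xs \<subseteq> E}"

definition tilde_field :: "('n::finite) lvec set \<Rightarrow> real set" where
  "tilde_field E = gen_field (gram_entries E)"

definition ground_field :: "('n::finite) lvec set \<Rightarrow> real set" where
  "ground_field E = gen_field (cyc E)"

definition psd_sigma :: "('n::finite) lvec set \<Rightarrow> (real \<Rightarrow> real) \<Rightarrow> bool" where
  "psd_sigma E \<sigma> \<longleftrightarrow>
     (\<forall>c :: ('n::finite) lvec \<Rightarrow> real. (\<Sum>e\<in>E. \<Sum>f\<in>E. c e * c f * \<sigma> (lf e f)) \<ge> 0)"

definition quasi_arithmetic :: "('n::finite) lvec set \<Rightarrow> ('n::finite) lvec set \<Rightarrow> bool" where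
  "quasi_arithmetic V E \<longleftrightarrow>
     convex_polytope V E \<and> finite_hvolume V (poly V E) \<and> acute_angled V E \<and>
     totally_real_number_field (tilde_field E) \<and>
     (\<forall>\<sigma>. rembedding (tilde_field E) \<sigma> \<and> (\<exists>x\<in>ground_field E. \<sigma> x \<noteq> x)
            \<longrightarrow> psd_sigma E \<sigma>)"

text \<open>A k-dimensional face of P = poly UNIV E: a nonempty intersection of P
  with some of its bounding hyperplanes, whose linear span has dimension k+1
  (so it spans a k-dimensional hyperbolic subspace).\<close>
definition is_face :: "('n::finite) lvec set \<Rightarrow> ('n::finite) lvec set \<Rightarrow> nat \<Rightarrow> bool" where
  "is_face E F k \<longleftrightarrow>
     (\<exists>S\<subseteq>E. F = poly UNIV E \<inter> (\<Inter>e\<in>S. hplane UNIV e)) \<and> F \<noteq> {} \<and>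
     dim (span F) = k + 1"

definition lproj :: "('n::finite) lvec set \<Rightarrow> ('n::finite) lvec \<Rightarrow> ('n::finite) lvec" where
  "lproj V e = (THE v. v \<in> V \<and> (\<forall>w\<in>V. lf (e - v) w = 0))"

definition unitize :: "('n::finite) lvec \<Rightarrow> ('n::finite) lvec" where
  "unitize v = (1 / sqrt (lf v v)) *\<^sub>R v"

definition adjacent_facets :: "('n::finite) lvec set \<Rightarrow> ('n::finite) lvec set \<Rightarrow> ('n::finite) lvec set" where
  "adjacent_facets E F =
     {e \<in> E. \<not> F \<subseteq> hplane UNIV e \<and> dim (span (F \<inter> hplane UNIV e)) + 1 = dim (span F)}"

definition face_normals :: "('n::finite) lvec set \<Rightarrow> ('n::finite) lvec set \<Rightarrow> ('n::finite) lvec set" where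
  "face_normals E F = unitize ` lproj (span F) ` adjacent_facets E F"

end

theory Submission
  imports Defs "HOL-Computational_Algebra.Fundamental_Theorem_Algebra"
begin

text \<open>
  Let V be the span of the face and T the normals of P orthogonal to V. Gram--Schmidt over T expresses
  the projections pr e of the other normals to V with coefficients in the field of the Gram matrix. After
  rescaling the normals of P by weights of walks in the Gram graph, all scalar products lie in the ground
  field, and so do the scalar products of the rescaled projections; hence the ground field of the face is
  contained in that of P, and the normalising factors of the pr e are square roots of elements of the
  ground field. An embedding that moves the ground field of P makes the Gram matrix of P positive
  semidefinite, hence also the matrix of the pr e, and in particular maps the normalising factors to
  real numbers. Since embeddings extend to algebraic extensions, the face is quasi-arithmetic. If its
  ground field were smaller, some embedding would fix it and move the ground field of P; but then the
  Gram matrix of the face would be positive semidefinite, which is impossible because the face normals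
  span a Lorentzian space.

  In dimension at least two a polytope has finite volume iff its cone lies in the closed light cone, and
  this condition passes to faces.
\<close>

section \<open>Embeddings of real number fields\<close>

text \<open>The Gram entries of P and those of the face generate fields that are not comparable a
  priori: the unit normals of the face carry the factors \<open>1 / s u\<close>, where
  \<open>s u\<close> is the length of a projected normal. Both fields are compared inside
  \<open>L\<close>, which arises from \<open>tilde_field E\<close> by adjoining all
  \<open>s u\<close>. An embedding of \<open>tilde_field N\<close> is extended to \<open>L\<close>
  and then restricted to \<open>tilde_field E\<close>, where the hypothesis on P applies. Such an
  extension sends an element to some root of a conjugate polynomial, so it takes values in the
  complex numbers; that it is real is a conclusion, which is why embeddings are handled as complex
  ones almost everywhere. Finite volume has two roles. It is part of what has to be shown for the
  face, and it makes the face normals span the whole Lorentzian space of the face; without a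
  time-like vector in their span, semidefiniteness of a conjugate Gram matrix would contradict
  nothing. The light cone condition mediates because, unlike the defining integral, it is a
  statement about linear inequalities.\<close>

lemma subfield_0: "is_subfield K \<Longrightarrow> 0 \<in> K"
  and subfield_1: "is_subfield K \<Longrightarrow> 1 \<in> K"
  and subfield_add: "is_subfield K \<Longrightarrow> x \<in> K \<Longrightarrow> y \<in> K \<Longrightarrow> x + y \<in> K"
  and subfield_mult: "is_subfield K \<Longrightarrow> x \<in> K \<Longrightarrow> y \<in> K \<Longrightarrow> x * y \<in> K"
  and subfield_minus: "is_subfield K \<Longrightarrow> x \<in> K \<Longrightarrow> - x \<in> K"
  and subfield_inverse: "is_subfield K \<Longrightarrow> x \<in> K \<Longrightarrow> inverse x \<in> K"
  unfolding is_subfield_def by blast+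

lemma subfield_diff: "is_subfield K \<Longrightarrow> x \<in> K \<Longrightarrow> y \<in> K \<Longrightarrow> x - y \<in> K"
  by (metis diff_conv_add_uminus subfield_add subfield_minus)

lemma subfield_divide: "is_subfield K \<Longrightarrow> x \<in> K \<Longrightarrow> y \<in> K \<Longrightarrow> x / y \<in> K"
  by (metis divide_inverse subfield_inverse subfield_mult)

lemma subfield_sum: "is_subfield K \<Longrightarrow> (\<And>i. i \<in> I \<Longrightarrow> f i \<in> K) \<Longrightarrow> sum f I \<in> K"
  by (induction I rule: infinite_finite_induct) (auto simp: subfield_0 subfield_add)

lemma subfield_prod: "is_subfield K \<Longrightarrow> (\<And>i. i \<in> I \<Longrightarrow> f i \<in> K) \<Longrightarrow> prod f I \<in> K"
  by (induction I rule: infinite_finite_induct) (auto simp: subfield_1 subfield_mult)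

lemma subfield_of_nat: "is_subfield K \<Longrightarrow> of_nat n \<in> K"
  by (induction n) (auto simp: subfield_0 subfield_1 subfield_add)

lemma subfield_of_int: "is_subfield K \<Longrightarrow> of_int n \<in> K"
  by (cases n) (auto simp del: of_nat_Suc intro: subfield_of_nat subfield_minus)

lemma subfield_of_rat: "is_subfield K \<Longrightarrow> of_rat q \<in> K"
  by (cases q) (auto simp: of_rat_rat intro: subfield_of_int subfield_divide)

lemma subfield_power: "is_subfield K \<Longrightarrow> x \<in> K \<Longrightarrow> x ^ n \<in> K"
  by (induction n) (auto simp: subfield_1 subfield_mult)

lemma is_subfield_gen_field: "is_subfield (gen_field S)"
  unfolding gen_field_def is_subfield_def by auto

lemma gen_field_superset: "S \<subseteq> gen_field S"
  unfolding gen_field_def by auto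

lemma gen_field_least: "is_subfield K \<Longrightarrow> S \<subseteq> K \<Longrightarrow> gen_field S \<subseteq> K"
  unfolding gen_field_def by auto

section \<open>Arithmetic of embeddings\<close>

lemma cembedding_add: "cembedding K \<sigma> \<Longrightarrow> x \<in> K \<Longrightarrow> y \<in> K \<Longrightarrow> \<sigma> (x + y) = \<sigma> x + \<sigma> y"
  and cembedding_mult: "cembedding K \<sigma> \<Longrightarrow> x \<in> K \<Longrightarrow> y \<in> K \<Longrightarrow> \<sigma> (x * y) = \<sigma> x * \<sigma> y"
  and cembedding_1: "cembedding K \<sigma> \<Longrightarrow> \<sigma> 1 = 1"
  and cembedding_mono: "cembedding K \<sigma> \<Longrightarrow> K' \<subseteq> K \<Longrightarrow> cembedding K' \<sigma>"
  unfolding cembedding_def by blast+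

lemma cembedding_0:
  assumes "is_subfield K" "cembedding K \<sigma>" shows "\<sigma> 0 = 0"
  using cembedding_add[OF assms(2), of 0 0] subfield_0[OF assms(1)] by simp

lemma cembedding_minus:
  assumes "is_subfield K" "cembedding K \<sigma>" "x \<in> K" shows "\<sigma> (- x) = - \<sigma> x"
  using cembedding_add[OF assms(2,3) subfield_minus[OF assms(1,3)]] cembedding_0[OF assms(1,2)]
  by (simp add: eq_neg_iff_add_eq_0 add.commute)

lemma cembedding_inverse:
  assumes "is_subfield K" "cembedding K \<sigma>" "x \<in> K" shows "\<sigma> (inverse x) = inverse (\<sigma> x)"
proof (cases "x = 0")
  case True
  then show ?thesis using cembedding_0[OF assms(1,2)] by simp
next
  case False
  have "\<sigma> x * \<sigma> (inverse x) = 1"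
    using cembedding_mult[OF assms(2,3) subfield_inverse[OF assms(1,3)]] cembedding_1[OF assms(2)] False
    by simp
  then show ?thesis by (simp add: inverse_unique)
qed

lemma cembedding_divide:
  assumes "is_subfield K" "cembedding K \<sigma>" "x \<in> K" "y \<in> K" shows "\<sigma> (x / y) = \<sigma> x / \<sigma> y"
  using assms by (simp add: divide_inverse cembedding_mult cembedding_inverse subfield_inverse)

lemma cembedding_sum:
  assumes "is_subfield K" "cembedding K \<sigma>" "\<And>i. i \<in> I \<Longrightarrow> f i \<in> K"
  shows "\<sigma> (sum f I) = (\<Sum>i\<in>I. \<sigma> (f i))"
  using assms(3)
  by (induction I rule: infinite_finite_induct)
     (simp_all add: cembedding_0[OF assms(1,2)] cembedding_add[OF assms(2)] subfield_sum[OF assms(1)])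

section \<open>Number fields as finite-dimensional rational vector spaces\<close>

interpretation ratvec: vector_space "\<lambda>(q::rat) (x::real). of_rat q * x"
  by unfold_locales (auto simp: algebra_simps of_rat_add of_rat_mult)

text \<open>Turns finite degree into a span condition, so that the dimension bounds of linear
  algebra can replace degrees of field extensions.\<close>

lemma number_field_iff:
  "number_field K \<longleftrightarrow> is_subfield K \<and> (\<exists>B. finite B \<and> B \<subseteq> K \<and> K \<subseteq> ratvec.span B)"
proof -
  have "(\<forall>x\<in>K. \<exists>c::real \<Rightarrow> rat. x = (\<Sum>b\<in>B. of_rat (c b) * b)) \<longleftrightarrow> K \<subseteq> ratvec.span B"
    if "finite B" for B
    using that by (auto simp: ratvec.span_finite subset_iff image_iff)
  then show ?thesis unfolding number_field_def by blast
qed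

lemma number_field_is_subfield: "number_field K \<Longrightarrow> is_subfield K"
  by (simp add: number_field_def)

lemma subspace_subfield: "is_subfield K \<Longrightarrow> ratvec.subspace K"
  by (auto simp: ratvec.subspace_def subfield_0 subfield_add subfield_mult subfield_of_rat)

text \<open>The definition asks for generators inside K. A finite \<open>B\<close> outside K is
  enough: an independent subset of K that spans K has at most \<open>card B\<close>
  elements.\<close>

lemma number_field_finite_span:
  assumes "is_subfield K" "finite B" "K \<subseteq> ratvec.span B"
  shows "number_field K"
proof -
  obtain C where C: "C \<subseteq> K" "ratvec.independent C" "K \<subseteq> ratvec.span C"
    using ratvec.maximal_independent_subset by blast
  then have "finite C"
    using ratvec.independent_span_bound[OF assms(2) C(2)] assms(3) by blast
  then show ?thesis
    using C assms(1) unfolding number_field_iff by blast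
qed

lemma number_field_subfield:
  assumes "number_field L" "is_subfield K" "K \<subseteq> L" shows "number_field K"
  using assms number_field_finite_span unfolding number_field_iff by (meson order_trans)

text \<open>The generated field is contained in the explicit field \<open>M\<close> = L + L s, and
  if \<open>B\<close> spans L over the rationals, then B together with s B spans M.\<close>

lemma number_field_adjoin_sqrt:
  assumes L: "number_field L" and s: "s * s \<in> L"
  shows "number_field (gen_field (insert s L))"
proof (cases "s \<in> L")
  case True
  then have "gen_field (insert s L) = L"
    using gen_field_least[of L "insert s L"] gen_field_superset[of "insert s L"]
      number_field_is_subfield[OF L] by auto
  then show ?thesis using L by simp
next
  case False
  have sf: "is_subfield L" using L by (rule number_field_is_subfield)
  define M where "M = {a + b * s | a b. a \<in> L \<and> b \<in> L}"
  have inv: "inverse (a + b * s) \<in> M" if ab: "a \<in> L" "b \<in> L" for a b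
  proof (cases "a + b * s = 0")
    case True
    then show ?thesis
      unfolding M_def using subfield_0[OF sf] by (simp, metis add_0 mult_zero_left)
  next
    case nz: False
    \<comment> \<open>The conjugate by which the denominator is rationalised. If it vanished, then b
      = 0 because s is not in L, hence a = 0, against \<open>nz\<close>.\<close>
    have "a - b * s \<noteq> 0"
    proof
      assume *: "a - b * s = 0"
      have "b = 0"
      proof (rule ccontr)
        assume "b \<noteq> 0"
        then have "s = a / b" using * by (simp add: field_simps)
        then show False using False subfield_divide[OF sf ab] by simp
      qed
      then show False using * nz by simp
    qed
    then have eq: "inverse (a + b * s) = a / (a*a - b*b*(s * s)) + (- b / (a*a - b*b*(s * s))) * s"
    proof -
      assume h: "a - b * s \<noteq> 0"
      have e: "a*a - b*b*(s * s) = (a + b * s) * (a - b * s)" by (simp add: algebra_simps)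
      have "a / (a*a - b*b*(s * s)) + (- b / (a*a - b*b*(s * s))) * s = (a - b * s) / (a*a - b*b*(s * s))"
        by (simp add: diff_divide_distrib)
      also have "\<dots> = inverse (a + b * s)"
        unfolding e using h by (metis nonzero_divide_mult_cancel_right inverse_eq_divide)
      finally show ?thesis by simp
    qed
    have "a*a - b*b*(s * s) \<in> L"
      by (intro subfield_diff[OF sf] subfield_mult[OF sf] ab s)
    then show ?thesis
      unfolding M_def eq using ab by (blast intro: subfield_divide subfield_minus sf)
  qed
  have mult: "(a + b * s) * (c + d * s) \<in> M" if "a \<in> L" "b \<in> L" "c \<in> L" "d \<in> L" for a b c d
  proof -
    have "(a + b * s) * (c + d * s) = (a * c + b * d * (s * s)) + (a * d + b * c) * s"
      by (simp add: algebra_simps)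
    moreover have "a * c + b * d * (s * s) \<in> L" "a * d + b * c \<in> L"
      using that s by (auto intro!: subfield_add subfield_mult sf)
    ultimately show ?thesis unfolding M_def by blast
  qed
  have add: "(a + b * s) + (c + d * s) \<in> M" if "a \<in> L" "b \<in> L" "c \<in> L" "d \<in> L" for a b c d
  proof -
    have "(a + b * s) + (c + d * s) = (a + c) + (b + d) * s"
      by (simp add: algebra_simps)
    then show ?thesis unfolding M_def using that by (blast intro: subfield_add sf)
  qed
  have minus: "- (a + b * s) \<in> M" if "a \<in> L" "b \<in> L" for a b
  proof -
    have "- (a + b * s) = - a + (- b) * s" by simp
    then show ?thesis unfolding M_def using that by (blast intro: subfield_minus sf)
  qed
  have LM: "L \<subseteq> M"
    unfolding M_def using subfield_0[OF sf] by (auto, metis add.right_neutral mult_zero_left)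
  have sM: "s \<in> M"
    unfolding M_def using subfield_0[OF sf] subfield_1[OF sf] by (simp, metis add_0 mult_1)
  have M: "is_subfield M"
    unfolding is_subfield_def
  proof (intro conjI ballI)
    show "0 \<in> M" "1 \<in> M" using LM subfield_0[OF sf] subfield_1[OF sf] by auto
  next
    fix x y assume "x \<in> M" "y \<in> M"
    then obtain a b c d where "x = a + b * s" "y = c + d * s" "a \<in> L" "b \<in> L" "c \<in> L" "d \<in> L"
      unfolding M_def by blast
    then show "x + y \<in> M" "x * y \<in> M" using add mult by auto
  next
    fix x assume "x \<in> M"
    then obtain a b where "x = a + b * s" "a \<in> L" "b \<in> L"
      unfolding M_def by blast
    then show "- x \<in> M" "inverse x \<in> M" using minus inv by auto
  qed
  obtain B where B: "finite B" "L \<subseteq> ratvec.span B"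
    using L unfolding number_field_iff by blast
  let ?C = "B \<union> (\<lambda>b. s * b) ` B"
  have "s * b \<in> ratvec.span ?C" if "b \<in> ratvec.span B" for b
    using that
  proof (induction rule: ratvec.span_induct_alt)
    case base
    show ?case using ratvec.span_zero by simp
  next
    case (step c x y)
    have "s * (of_rat c * x + y) = of_rat c * (s * x) + s * y" by (simp add: algebra_simps)
    then show ?case
      using step ratvec.span_add ratvec.span_scale ratvec.span_base by (metis UnCI imageI)
  qed
  moreover have "ratvec.span B \<subseteq> ratvec.span ?C" by (intro ratvec.span_mono) auto
  ultimately have "M \<subseteq> ratvec.span ?C"
    unfolding M_def using B by (auto intro!: ratvec.span_add simp: mult.commute[of _ s])
  moreover have "gen_field (insert s L) \<subseteq> M"
    using gen_field_least[OF M] LM sM by auto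
  ultimately show ?thesis
    using number_field_finite_span[OF is_subfield_gen_field, of ?C] B by blast
qed

lemma number_field_adjoin_sqrts:
  assumes "finite S" "number_field L" "\<And>s. s \<in> S \<Longrightarrow> s * s \<in> L"
  shows "number_field (gen_field (S \<union> L))"
  using assms(1,3)
proof (induction S)
  case empty
  have "gen_field L = L"
    using gen_field_least[of L L] gen_field_superset[of L] number_field_is_subfield[OF assms(2)] by auto
  then show ?case using assms(2) by simp
next
  case (insert s S)
  let ?M = "gen_field (S \<union> L)"
  have "s * s \<in> ?M" using insert.prems gen_field_superset[of "S \<union> L"] by auto
  then have nf: "number_field (gen_field (insert s ?M))"
    using insert by (intro number_field_adjoin_sqrt) auto
  have "insert s S \<union> L \<subseteq> gen_field (insert s ?M)"
    using gen_field_superset[of "insert s ?M"] gen_field_superset[of "S \<union> L"] by blast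
  then show ?case
    by (intro number_field_subfield[OF nf] is_subfield_gen_field gen_field_least)
qed

text \<open>There are \<open>card B + 1\<close> exponents, so the powers of x are linearly dependent
  unless two of them coincide. The coincidence is a separate case because dependence of the set of
  powers does not see repetitions; it yields the polynomial X^i - X^j.\<close>

lemma number_field_algebraic:
  assumes "number_field L" "x \<in> L"
  obtains p where "p \<noteq> 0" "\<And>i. coeff p i \<in> \<rat>" "Polynomial.poly p x = 0"
proof -
  obtain B where B: "finite B" "L \<subseteq> ratvec.span B" and sf: "is_subfield L"
    using assms(1) unfolding number_field_iff by blast
  let ?S = "(\<lambda>i. x ^ i) ` {..card B}"
  have sub: "?S \<subseteq> ratvec.span B" using B subfield_power[OF sf assms(2)] by auto
  show thesis
  proof (cases "inj_on (\<lambda>i. x ^ i) {..card B}")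
    case True
    then have "card ?S = Suc (card B)" by (simp add: card_image)
    then have "ratvec.dependent ?S"
      using ratvec.independent_span_bound[OF B(1) _ sub] by auto
    then obtain u where u: "\<exists>v\<in>?S. u v \<noteq> 0" "(\<Sum>v\<in>?S. of_rat (u v) * v) = 0"
      using ratvec.dependent_finite[of ?S] by auto
    let ?p = "\<Sum>i\<le>card B. monom (of_rat (u (x ^ i))) i :: real poly"
    have co: "coeff ?p j = (if j \<le> card B then of_rat (u (x ^ j)) else 0)" for j
      by (simp add: coeff_sum)
    obtain j where "j \<le> card B" "u (x ^ j) \<noteq> 0" using u(1) by auto
    then have "coeff ?p j \<noteq> 0" unfolding co by simp
    then have "?p \<noteq> 0" by (metis coeff_0)
    moreover have "Polynomial.poly ?p x = 0"
      using u(2) by (simp add: poly_sum poly_monom sum.reindex[OF True])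
    ultimately show ?thesis using that[of ?p] co by simp
  next
    case False
    then obtain i j where ij: "i < j" "x ^ i = x ^ j"
      unfolding inj_on_def by (metis nat_neq_iff)
    let ?p = "monom 1 i - monom 1 j :: real poly"
    have "coeff ?p i \<noteq> 0" using ij by simp
    then have "?p \<noteq> 0" by (metis coeff_0)
    then show ?thesis using that[of ?p] ij by (simp add: poly_monom)
  qed
qed

section \<open>Polynomials over a subfield and minimal polynomials\<close>

definition poly_over :: "real set \<Rightarrow> real poly \<Rightarrow> bool" where
  "poly_over K p \<longleftrightarrow> (\<forall>i. coeff p i \<in> K)"

lemma poly_over_pCons: "poly_over K (pCons a p) \<longleftrightarrow> a \<in> K \<and> poly_over K p"
  unfolding poly_over_def by (metis coeff_pCons_0 coeff_pCons_Suc not0_implies_Suc)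

context
  fixes K :: "real set"
  assumes K: "is_subfield K"
begin

lemma poly_over_0: "poly_over K 0"
  by (simp add: poly_over_def subfield_0[OF K])

lemma poly_over_const: "c \<in> K \<Longrightarrow> poly_over K [:c:]"
  by (auto simp: poly_over_def coeff_pCons subfield_0[OF K] split: nat.splits)

lemma poly_over_X: "poly_over K [:0, 1:]"
  by (auto simp: poly_over_def coeff_pCons subfield_0[OF K] subfield_1[OF K] split: nat.splits)

lemma poly_over_monom: "c \<in> K \<Longrightarrow> poly_over K (monom c n)"
  by (auto simp: poly_over_def subfield_0[OF K])

lemma poly_over_add: "poly_over K p \<Longrightarrow> poly_over K q \<Longrightarrow> poly_over K (p + q)"
  by (simp add: poly_over_def subfield_add[OF K])

lemma poly_over_diff: "poly_over K p \<Longrightarrow> poly_over K q \<Longrightarrow> poly_over K (p - q)"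
  by (simp add: poly_over_def subfield_diff[OF K])

lemma poly_over_minus: "poly_over K p \<Longrightarrow> poly_over K (- p)"
  by (simp add: poly_over_def subfield_minus[OF K])

lemma poly_over_mult: "poly_over K p \<Longrightarrow> poly_over K q \<Longrightarrow> poly_over K (p * q)"
  by (simp add: poly_over_def coeff_mult subfield_sum[OF K] subfield_mult[OF K])

lemma poly_over_smult: "c \<in> K \<Longrightarrow> poly_over K q \<Longrightarrow> poly_over K (smult c q)"
  by (simp add: poly_over_def subfield_mult[OF K])

lemma poly_over_pderiv: "poly_over K p \<Longrightarrow> poly_over K (pderiv p)"
  by (simp add: poly_over_def coeff_pderiv subfield_mult[OF K] subfield_add[OF K] subfield_1[OF K] subfield_of_nat[OF K])

lemma poly_over_Rats: "(\<And>i. coeff p i \<in> \<rat>) \<Longrightarrow> poly_over K p"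
  unfolding poly_over_def using subfield_of_rat[OF K] by (metis Rats_cases)

text \<open>As m is monic, cancelling the leading term of q takes a multiple of m by a monomial over
  K, and the difference is again over K.\<close>

lemma poly_over_division:
  assumes m: "poly_over K m" "lead_coeff m = 1" and q: "poly_over K q"
  shows "\<exists>s r. poly_over K s \<and> poly_over K r \<and> q = s * m + r \<and> (r = 0 \<or> degree r < degree m)"
  using q
proof (induction "degree q" arbitrary: q rule: less_induct)
  case less
  show ?case
  proof (cases "q = 0 \<or> degree q < degree m")
    case True
    then show ?thesis using less.prems poly_over_0 by (intro exI[of _ 0] exI[of _ q]) auto
  next
    case False
    then have deg: "degree m \<le> degree q" and q0: "q \<noteq> 0" by auto
    have m0: "m \<noteq> 0" using m(2) by auto
    let ?t = "monom (lead_coeff q) (degree q - degree m)"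
    let ?q = "q - ?t * m"
    have t: "poly_over K ?t" using less.prems by (intro poly_over_monom) (simp add: poly_over_def)
    have q': "poly_over K ?q" using less.prems t m by (intro poly_over_diff poly_over_mult)
    have dt: "degree (?t * m) = degree q"
      using q0 m0 deg by (subst degree_mult_eq) (auto simp: degree_monom_eq monom_eq_0_iff)
    have co: "coeff ?q (degree q) = 0"
      using deg m(2) by (simp add: coeff_monom_mult)
    have "degree ?q \<le> degree q" by (rule degree_diff_le) (auto simp: dt)
    then have *: "?q = 0 \<or> degree ?q < degree q"
      using co by (metis le_neq_implies_less leading_coeff_0_iff)
    show ?thesis
    proof (cases "?q = 0")
      case True
      then show ?thesis using t poly_over_0 by (intro exI[of _ ?t] exI[of _ 0]) auto
    next
      case False
      with * obtain s r where sr: "poly_over K s" "poly_over K r" "?q = s * m + r"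
        "r = 0 \<or> degree r < degree m"
        using less.hyps[OF _ q'] by blast
      have "q = (?t + s) * m + r" using sr(3) by (simp add: algebra_simps)
      then show ?thesis using sr t poly_over_add by blast
    qed
  qed
qed

text \<open>L only provides algebraicity of \<alpha>: a rational polynomial is a polynomial over
  every subfield K. Least degree is recorded in place of irreducibility, since this is the form that
  division with remainder uses.\<close>

lemma minimal_polynomial_exists:
  assumes "number_field L" "\<alpha> \<in> L"
  obtains m where "poly_over K m" "lead_coeff m = 1" "Polynomial.poly m \<alpha> = 0" "degree m > 0"
    "\<And>q. poly_over K q \<Longrightarrow> Polynomial.poly q \<alpha> = 0 \<Longrightarrow> q \<noteq> 0 \<Longrightarrow> degree m \<le> degree q"
proof -
  let ?P = "\<lambda>q. poly_over K q \<and> Polynomial.poly q \<alpha> = 0 \<and> q \<noteq> 0"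
  obtain p where "?P p"
    using number_field_algebraic[OF assms] poly_over_Rats by metis
  then obtain q where q: "?P q" and min: "\<And>r. ?P r \<Longrightarrow> degree q \<le> degree r"
    using ex_has_least_nat[of ?P p degree] by blast
  let ?m = "smult (inverse (lead_coeff q)) q"
  have lc: "lead_coeff q \<noteq> 0" using q by simp
  have "degree q > 0"
  proof (rule ccontr)
    assume "\<not> degree q > 0"
    then obtain c where "q = [:c:]" using degree_eq_zeroE by blast
    then show False using q by auto
  qed
  moreover have "poly_over K ?m"
    using q by (intro poly_over_smult subfield_inverse K) (auto simp: poly_over_def)
  moreover have "lead_coeff ?m = 1" using lc by (simp add: degree_smult_eq)
  moreover have "degree ?m = degree q" using lc by (simp add: degree_smult_eq)
  ultimately show ?thesis using that[of ?m] q min by auto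
qed

text \<open>In a number field inverses are polynomial expressions with rational coefficients, so that
  K[\<alpha>] is already a field.\<close>
lemma inverse_eq_poly:
  assumes "number_field L" "x \<in> L" "x \<noteq> 0"
  obtains r where "poly_over K r" "inverse x = Polynomial.poly r x"
proof -
  obtain m where m: "poly_over K m" "Polynomial.poly m x = 0" "degree m > 0"
    "\<And>q. poly_over K q \<Longrightarrow> Polynomial.poly q x = 0 \<Longrightarrow> q \<noteq> 0 \<Longrightarrow> degree m \<le> degree q"
    using minimal_polynomial_exists[OF assms(1,2)] by metis
  obtain c m' where mc: "m = pCons c m'" using pCons_cases by blast
  have m': "poly_over K m'" and c: "c \<in> K"
    using m(1) by (simp_all add: mc poly_over_pCons)
  have "c \<noteq> 0"
  proof
    assume "c = 0"
    then have "Polynomial.poly m' x = 0" using m(2) assms(3) mc by simp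
    moreover have "m' \<noteq> 0" "degree m' < degree m" using m(3) mc by (auto split: if_splits)
    ultimately show False using m(4)[OF m'] by simp
  qed
  moreover have "c + x * Polynomial.poly m' x = 0" using m(2) mc by simp
  ultimately have "x * (- inverse c * Polynomial.poly m' x) = 1"
    by (simp add: field_simps)
  then have "inverse x = Polynomial.poly (smult (- inverse c) m') x"
    by (simp add: inverse_unique)
  then show ?thesis
    using that poly_over_smult[OF subfield_minus[OF K subfield_inverse[OF K c]] m'] by blast
qed

section \<open>Extension of embeddings\<close>

context
  fixes \<sigma> :: "real \<Rightarrow> complex"
  assumes \<sigma>: "cembedding K \<sigma>"
begin

lemma map_poly_cembedding_add:
  "poly_over K p \<Longrightarrow> poly_over K q \<Longrightarrow> map_poly \<sigma> (p + q) = map_poly \<sigma> p + map_poly \<sigma> q"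
  by (intro poly_eqI)
     (simp add: coeff_map_poly cembedding_0[OF K \<sigma>] poly_over_def cembedding_add[OF \<sigma>])

lemma map_poly_cembedding_diff:
  assumes "poly_over K p" "poly_over K q"
  shows "map_poly \<sigma> (p - q) = map_poly \<sigma> p - map_poly \<sigma> q"
  using map_poly_cembedding_add[OF poly_over_diff[OF assms] assms(2)] by (simp add: algebra_simps)

lemma map_poly_cembedding_mult:
  "poly_over K p \<Longrightarrow> poly_over K q \<Longrightarrow> map_poly \<sigma> (p * q) = map_poly \<sigma> p * map_poly \<sigma> q"
  by (intro poly_eqI)
     (simp add: coeff_map_poly cembedding_0[OF K \<sigma>] poly_over_def cembedding_mult[OF \<sigma>]
       coeff_mult cembedding_sum[OF K \<sigma>] subfield_mult[OF K])

lemma map_poly_cembedding_monic: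
  assumes "lead_coeff m = 1"
  shows "degree (map_poly \<sigma> m) = degree m"
proof (rule antisym)
  show "degree (map_poly \<sigma> m) \<le> degree m"
    by (rule degree_le) (simp add: coeff_map_poly cembedding_0[OF K \<sigma>] coeff_eq_0)
  show "degree m \<le> degree (map_poly \<sigma> m)"
    by (rule le_degree) (simp add: coeff_map_poly cembedding_0[OF K \<sigma>] assms cembedding_1[OF \<sigma>])
qed

text \<open>The extension sends q(\<alpha>) to the value at \<beta> of the conjugate of q. This is
  well defined because a polynomial over K that vanishes at \<alpha> is a multiple of m: its
  remainder modulo m vanishes at \<alpha> too and has too small a degree to be nonzero.\<close>

lemma cembedding_extend_root:
  assumes L: "number_field L" "K \<subseteq> L" and \<alpha>: "\<alpha> \<in> L"
    and m: "poly_over K m" "lead_coeff m = 1"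
    and min: "\<And>q. poly_over K q \<Longrightarrow> Polynomial.poly q \<alpha> = 0 \<Longrightarrow> q \<noteq> 0 \<Longrightarrow> degree m \<le> degree q"
    and ma: "Polynomial.poly m \<alpha> = 0" and mb: "Polynomial.poly (map_poly \<sigma> m) \<beta> = 0"
  shows "\<exists>K' \<tau>. is_subfield K' \<and> K \<subseteq> K' \<and> K' \<subseteq> L \<and> \<alpha> \<in> K' \<and> cembedding K' \<tau> \<and>
    (\<forall>x\<in>K. \<tau> x = \<sigma> x) \<and> \<tau> \<alpha> = \<beta>"
proof -
  define K' where "K' = {Polynomial.poly q \<alpha> | q. poly_over K q}"
  define \<tau> where "\<tau> x = Polynomial.poly (map_poly \<sigma> (SOME q. poly_over K q \<and> Polynomial.poly q \<alpha> = x)) \<beta>" for x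
  have vanish: "Polynomial.poly (map_poly \<sigma> q) \<beta> = 0" if q: "poly_over K q" "Polynomial.poly q \<alpha> = 0" for q
  proof -
    obtain s r where sr: "poly_over K s" "poly_over K r" "q = s * m + r" "r = 0 \<or> degree r < degree m"
      using poly_over_division[OF m q(1)] by blast
    have "Polynomial.poly r \<alpha> = 0" using q(2) sr(3) ma by simp
    then have "r = 0" using min[OF sr(2)] sr(4) by (meson leD)
    then show ?thesis using sr mb m by (simp add: map_poly_cembedding_mult)
  qed
  have ev: "\<tau> (Polynomial.poly q \<alpha>) = Polynomial.poly (map_poly \<sigma> q) \<beta>" if q: "poly_over K q" for q
  proof -
    let ?q = "SOME p. poly_over K p \<and> Polynomial.poly p \<alpha> = Polynomial.poly q \<alpha>"
    have s: "poly_over K ?q \<and> Polynomial.poly ?q \<alpha> = Polynomial.poly q \<alpha>"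
      by (rule someI[of _ q]) (simp add: q)
    then have "Polynomial.poly (map_poly \<sigma> (?q - q)) \<beta> = 0"
      using q by (intro vanish poly_over_diff) auto
    then show ?thesis using s q unfolding \<tau>_def by (simp add: map_poly_cembedding_diff)
  qed
  have mem: "Polynomial.poly q \<alpha> \<in> K'" if "poly_over K q" for q using that unfolding K'_def by blast
  have KK': "K \<subseteq> K'" using mem[OF poly_over_const] by auto
  have aK': "\<alpha> \<in> K'" using mem[OF poly_over_X] by simp
  have K'L: "K' \<subseteq> L"
  proof
    fix x assume "x \<in> K'"
    then obtain q where "poly_over K q" "x = Polynomial.poly q \<alpha>" unfolding K'_def by blast
    then show "x \<in> L" using L \<alpha> number_field_is_subfield[OF L(1)] unfolding poly_altdef poly_over_def
      by (auto intro!: subfield_sum subfield_mult subfield_power)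
  qed
  \<comment> \<open>For inverses: 1/x is a polynomial r in x, and x is itself a polynomial p in
    \<alpha>, so 1/x is the value of the composition at \<alpha>.\<close>
  have comp: "poly_over K (pcompose p q)" if "poly_over K p" "poly_over K q" for p q
    using that(1)
  proof (induction p)
    case (pCons a p)
    have "a \<in> K" "poly_over K p"
      using pCons.prems by (simp_all add: poly_over_pCons)
    then show ?case using pCons.IH that(2)
      by (simp add: pcompose_pCons poly_over_add poly_over_mult poly_over_const)
  qed (simp add: poly_over_0)
  have "is_subfield K'"
    unfolding is_subfield_def
  proof (intro conjI ballI)
    show "0 \<in> K'" "1 \<in> K'" using KK' subfield_0[OF K] subfield_1[OF K] by auto
  next
    fix x y assume "x \<in> K'" "y \<in> K'"
    then obtain p q where "x = Polynomial.poly p \<alpha>" "y = Polynomial.poly q \<alpha>" "poly_over K p" "poly_over K q"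
      unfolding K'_def by blast
    then show "x + y \<in> K'" "x * y \<in> K'"
      using mem[OF poly_over_add] mem[OF poly_over_mult] by auto
  next
    fix x assume x: "x \<in> K'"
    then obtain p where p: "x = Polynomial.poly p \<alpha>" "poly_over K p" unfolding K'_def by blast
    then show "- x \<in> K'" using mem[OF poly_over_minus] by auto
    show "inverse x \<in> K'"
    proof (cases "x = 0")
      case True
      then show ?thesis using x by simp
    next
      case False
      then obtain r where "poly_over K r" "inverse x = Polynomial.poly r x"
        using inverse_eq_poly[OF L(1)] x K'L by blast
      then show ?thesis using mem[OF comp, of r p] p by (simp add: poly_pcompose)
    qed
  qed
  moreover have \<tau>K: "\<tau> x = \<sigma> x" if "x \<in> K" for x
    using ev[OF poly_over_const[OF that]] by (simp add: map_poly_pCons cembedding_0[OF K \<sigma>])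
  moreover have "\<tau> \<alpha> = \<beta>"
    using ev[OF poly_over_X] by (simp add: map_poly_pCons cembedding_0[OF K \<sigma>] cembedding_1[OF \<sigma>])
  moreover have "cembedding K' \<tau>"
    unfolding cembedding_def
  proof (intro conjI ballI)
    show "\<tau> 1 = 1" using \<tau>K[OF subfield_1[OF K]] cembedding_1[OF \<sigma>] by simp
    fix x y assume "x \<in> K'" "y \<in> K'"
    then obtain p q where pq: "x = Polynomial.poly p \<alpha>" "y = Polynomial.poly q \<alpha>" "poly_over K p" "poly_over K q"
      unfolding K'_def by blast
    then show "\<tau> (x + y) = \<tau> x + \<tau> y"
      using ev[OF poly_over_add[OF pq(3,4)]] by (simp add: ev map_poly_cembedding_add)
    show "\<tau> (x * y) = \<tau> x * \<tau> y"
      using ev[OF poly_over_mult[OF pq(3,4)]] pq by (simp add: ev map_poly_cembedding_mult)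
  qed
  ultimately show ?thesis using KK' K'L aK' by blast
qed

end

end

lemma complex_root_exists:
  assumes "degree (p :: complex poly) > 0" shows "\<exists>z. Polynomial.poly p z = 0"
  using assms fundamental_theorem_of_algebra[of p] constant_degree[of p] by auto

text \<open>The elements of B are adjoined one by one. Each minimal polynomial is taken over the
  field reached so far, and its conjugate under the current embedding is nonconstant, so it has a
  complex root.\<close>

lemma cembedding_extend_finite:
  assumes L: "number_field L" and B: "finite B" "B \<subseteq> L"
    and K: "is_subfield K" "K \<subseteq> L" "cembedding K \<sigma>"
  shows "\<exists>K' \<tau>. is_subfield K' \<and> K \<subseteq> K' \<and> K' \<subseteq> L \<and> B \<subseteq> K' \<and> cembedding K' \<tau> \<and> (\<forall>x\<in>K. \<tau> x = \<sigma> x)"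
  using B
proof (induction B)
  case empty
  then show ?case using K by auto
next
  case (insert \<alpha> B)
  then obtain K' \<tau> where K': "is_subfield K'" "K \<subseteq> K'" "K' \<subseteq> L" "B \<subseteq> K'" "cembedding K' \<tau>"
    "\<forall>x\<in>K. \<tau> x = \<sigma> x" by auto
  have "\<alpha> \<in> L" using insert by simp
  then obtain m where m: "poly_over K' m" "lead_coeff m = 1" "Polynomial.poly m \<alpha> = 0" "degree m > 0"
    "\<And>q. poly_over K' q \<Longrightarrow> Polynomial.poly q \<alpha> = 0 \<Longrightarrow> q \<noteq> 0 \<Longrightarrow> degree m \<le> degree q"
    using minimal_polynomial_exists[OF K'(1) L] by metis
  obtain \<beta> where "Polynomial.poly (map_poly \<tau> m) \<beta> = 0"
    using complex_root_exists[of "map_poly \<tau> m"] map_poly_cembedding_monic[OF K'(1,5) m(2)] m(4) by auto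
  then obtain K'' \<tau>' where "is_subfield K''" "K' \<subseteq> K''" "K'' \<subseteq> L" "\<alpha> \<in> K''" "cembedding K'' \<tau>'"
    "\<forall>x\<in>K'. \<tau>' x = \<tau> x"
    using cembedding_extend_root[OF K'(1,5) L K'(3) \<open>\<alpha> \<in> L\<close> m(1,2,5,3)] by blast
  then show ?case using K' by (intro exI[of _ K''] exI[of _ \<tau>']) auto
qed

text \<open>A field containing rational generators of L contains L, so finitely many adjunctions
  suffice.\<close>

lemma cembedding_extend:
  assumes L: "number_field L" and K: "is_subfield K" "K \<subseteq> L" "cembedding K \<sigma>"
  obtains \<tau> where "cembedding L \<tau>" "\<And>x. x \<in> K \<Longrightarrow> \<tau> x = \<sigma> x"
proof -
  obtain B where B: "finite B" "B \<subseteq> L" "L \<subseteq> ratvec.span B"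
    using L unfolding number_field_iff by blast
  obtain K' \<tau> where K': "is_subfield K'" "B \<subseteq> K'" "cembedding K' \<tau>" "\<forall>x\<in>K. \<tau> x = \<sigma> x"
    using cembedding_extend_finite[OF L B(1,2) K] by blast
  have "L \<subseteq> K'" using B(3) ratvec.span_minimal[OF K'(2) subspace_subfield[OF K'(1)]] by blast
  then show ?thesis using that[of \<tau>] K' cembedding_mono by blast
qed

text \<open>The minimal polynomial m of \<alpha> over K is separable, since m' has smaller degree;
  hence it has a root different from \<alpha> unless \<alpha> lies in K.\<close>
lemma cembedding_moving_exists:
  assumes L: "number_field L" and K: "is_subfield K" "K \<subseteq> L" and \<alpha>: "\<alpha> \<in> L" "\<alpha> \<notin> K"
  obtains \<tau> where "cembedding L \<tau>" "\<And>x. x \<in> K \<Longrightarrow> \<tau> x = of_real x" "\<tau> \<alpha> \<noteq> of_real \<alpha>"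
proof -
  let ?c = "of_real :: real \<Rightarrow> complex"
  have \<sigma>: "cembedding K ?c" unfolding cembedding_def by simp
  obtain m where m: "poly_over K m" "lead_coeff m = 1" "Polynomial.poly m \<alpha> = 0" "degree m > 0"
    and min: "\<And>q. poly_over K q \<Longrightarrow> Polynomial.poly q \<alpha> = 0 \<Longrightarrow> q \<noteq> 0 \<Longrightarrow> degree m \<le> degree q"
    using minimal_polynomial_exists[OF K(1) L \<alpha>(1)] by metis
  obtain q where q: "m = [:-\<alpha>, 1:] * q" using m(3) by (auto simp: poly_eq_0_iff_dvd)
  have "m \<noteq> 0" using m(4) by auto
  then have "q \<noteq> 0" using q by auto
  have dq: "degree m = Suc (degree q)" unfolding q using \<open>q \<noteq> 0\<close> by (subst degree_mult_eq) auto
  \<comment> \<open>If q were constant, m would be X - \<alpha>, and its constant coefficient would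
    put \<alpha> into K.\<close>
  have "degree q > 0"
  proof (rule ccontr)
    assume "\<not> degree q > 0"
    then obtain c where "q = [:c:]" using degree_eq_zeroE by blast
    then have "m = [:-\<alpha> * c, c:]" using q by simp
    moreover from this have "c = 1" using m(2) m(4) by (auto split: if_splits)
    ultimately have "coeff m 0 = - \<alpha>" by simp
    then have "- \<alpha> \<in> K" using m(1) unfolding poly_over_def by metis
    then show False using \<alpha>(2) subfield_minus[OF K(1)] by fastforce
  qed
  have "pderiv m \<noteq> 0" using m(4) by (simp add: pderiv_eq_0_iff)
  moreover have "degree (pderiv m) < degree m" using m(4) by (simp add: degree_pderiv)
  ultimately have "Polynomial.poly (pderiv m) \<alpha> \<noteq> 0"
    using min[OF poly_over_pderiv[OF K(1) m(1)]] by force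
  \<comment> \<open>The derivative of (X - \<alpha>) q at \<alpha> is q(\<alpha>). Hence every
    complex root of q is a root of m different from \<alpha>.\<close>
  then have qa: "Polynomial.poly q \<alpha> \<noteq> 0" unfolding q pderiv_mult by (simp add: pderiv_pCons)
  let ?q = "map_poly ?c q"
  have ev: "Polynomial.poly (map_poly ?c p) (?c x) = ?c (Polynomial.poly p x)" for p x
    by (simp add: poly_altdef degree_map_poly coeff_map_poly)
  have mq: "map_poly ?c m = [:-?c \<alpha>, 1:] * ?q"
    unfolding q by (intro poly_eqI) (simp add: coeff_map_poly coeff_pCons split: nat.splits)
  obtain \<beta> where \<beta>: "Polynomial.poly ?q \<beta> = 0"
    using complex_root_exists[of ?q] \<open>degree q > 0\<close> by (auto simp: degree_map_poly)
  then have "\<beta> \<noteq> ?c \<alpha>" using ev[of q \<alpha>] qa by auto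
  moreover have "Polynomial.poly (map_poly ?c m) \<beta> = 0" unfolding mq using \<beta> by simp
  ultimately obtain K' \<tau> where K': "is_subfield K'" "K \<subseteq> K'" "K' \<subseteq> L" "\<alpha> \<in> K'" "cembedding K' \<tau>"
    "\<forall>x\<in>K. \<tau> x = ?c x" "\<tau> \<alpha> \<noteq> ?c \<alpha>"
    using cembedding_extend_root[OF K(1) \<sigma> L K(2) \<alpha>(1) m(1,2) min m(3), of \<beta>] by blast
  obtain \<tau>' where "cembedding L \<tau>'" "\<And>x. x \<in> K' \<Longrightarrow> \<tau>' x = \<tau> x"
    using cembedding_extend[OF L K'(1,3,5)] by blast
  then show ?thesis using that[of \<tau>'] K' by (metis subsetD)
qed

section \<open>The Lorentzian form\<close>

lemma lf_sym: "lf x y = lf y x"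
  by (simp add: lf_def inner_commute mult.commute)

lemma lf_add_left: "lf (x + y) z = lf x z + lf y z"
  and lf_add_right: "lf z (x + y) = lf z x + lf z y"
  and lf_diff_left: "lf (x - y) z = lf x z - lf y z"
  and lf_diff_right: "lf z (x - y) = lf z x - lf z y"
  and lf_scaleR_left: "lf (c *\<^sub>R x) z = c * lf x z"
  and lf_scaleR_right: "lf z (c *\<^sub>R x) = c * lf z x"
  and lf_minus_left: "lf (- x) z = - lf x z"
  and lf_minus_right: "lf z (- x) = - lf z x"
  and lf_zero_left: "lf 0 z = 0"
  and lf_zero_right: "lf z 0 = 0"
  by (simp_all add: lf_def inner_add_left inner_add_right inner_diff_left inner_diff_right algebra_simps)

lemmas lf_linear = lf_add_left lf_add_right lf_diff_left lf_diff_right lf_scaleR_left lf_scaleR_right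
  lf_minus_left lf_minus_right lf_zero_left lf_zero_right

lemma lf_sum_left: "lf (sum f I) z = (\<Sum>i\<in>I. lf (f i) z)"
  by (induction I rule: infinite_finite_induct) (auto simp: lf_linear)

lemma lf_sum_right: "lf z (sum f I) = (\<Sum>i\<in>I. lf z (f i))"
  by (induction I rule: infinite_finite_induct) (auto simp: lf_linear)

text \<open>Presents half-spaces of the Lorentzian form as Euclidean half-spaces, so that results on
  polyhedra apply to them.\<close>

lemma lf_eq_inner: "lf x y = (fst y, - snd y) \<bullet> x"
  by (simp add: lf_def inner_prod_def inner_commute)

lemma lf_self: "lf x x = (norm (fst x))\<^sup>2 - (snd x)\<^sup>2"
  by (simp add: lf_def dot_square_norm power2_eq_square)

lemma lf_self_nonpos_iff: "lf x x \<le> 0 \<longleftrightarrow> norm (fst x) \<le> \<bar>snd x\<bar>"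
  by (simp add: lf_self abs_le_square_iff[symmetric])

lemma lf_self_neg_iff: "lf x x < 0 \<longleftrightarrow> norm (fst x) < \<bar>snd x\<bar>"
  using abs_le_square_iff[of "snd x" "norm (fst x)"] by (auto simp: lf_self not_le[symmetric])

lemma tendsto_lf [tendsto_intros]:
  "(f \<longlongrightarrow> a) G \<Longrightarrow> (g \<longlongrightarrow> b) G \<Longrightarrow> ((\<lambda>x. lf (f x) (g x)) \<longlongrightarrow> lf a b) G"
  unfolding lf_def by (intro tendsto_intros)

text \<open>Reversed Cauchy-Schwarz: if v were in the closed light cone, its time part would
  strictly dominate in \<open>lf v p\<close>. This replaces nondegeneracy throughout: a vector with
  \<open>lf v v \<le> 0\<close> that is orthogonal to a time-like one is zero.\<close>

lemma lf_pos_of_orthogonal: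
  assumes "lf p p < 0" "lf v p = 0" "v \<noteq> 0"
  shows "lf v v > 0"
proof (rule ccontr)
  assume "\<not> lf v v > 0"
  then have v: "norm (fst v) \<le> \<bar>snd v\<bar>" using lf_self_nonpos_iff[of v] by simp
  have p: "norm (fst p) < \<bar>snd p\<bar>" using assms lf_self_neg_iff[of p] by simp
  have "snd v \<noteq> 0" using v assms(3) by (auto simp: prod_eq_iff)
  then have "\<bar>snd v\<bar> * norm (fst p) < \<bar>snd v\<bar> * \<bar>snd p\<bar>" using p by simp
  moreover have "\<bar>snd v * snd p\<bar> = \<bar>fst v \<bullet> fst p\<bar>" using assms(2) by (simp add: lf_def)
  moreover have "\<bar>fst v \<bullet> fst p\<bar> \<le> norm (fst v) * norm (fst p)" by (rule Cauchy_Schwarz_ineq2)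
  moreover have "norm (fst v) * norm (fst p) \<le> \<bar>snd v\<bar> * norm (fst p)"
    using v by (simp add: mult_right_mono)
  ultimately show False by (simp add: abs_mult)
qed

lemma lf_neg_of_future:
  assumes "lf x x \<le> 0" "snd x > 0" "lf y y < 0" "snd y > 0"
  shows "lf x y < 0"
proof -
  have "fst x \<bullet> fst y \<le> norm (fst x) * norm (fst y)" by (rule norm_cauchy_schwarz)
  also have "\<dots> \<le> snd x * norm (fst y)"
    using assms lf_self_nonpos_iff[of x] by (simp add: mult_right_mono)
  also have "\<dots> < snd x * snd y"
    using assms lf_self_neg_iff[of y] by simp
  finally show ?thesis by (simp add: lf_def)
qed

lemma future_of_lf_neg:
  assumes "lf x x \<le> 0" "lf y y < 0" "snd y > 0" "lf x y < 0"
  shows "snd x > 0"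
proof (rule ccontr)
  assume "\<not> snd x > 0"
  then consider "snd x < 0" | "snd x = 0" by linarith
  then show False
  proof cases
    case 1
    have "lf (- x) y < 0"
      by (rule lf_neg_of_future) (use assms 1 in \<open>auto simp: lf_linear\<close>)
    then show ?thesis using assms by (simp add: lf_linear)
  next
    case 2
    then have "x = 0" using assms(1) by (auto simp: lf_self_nonpos_iff prod_eq_iff)
    then show ?thesis using assms by (simp add: lf_linear)
  qed
qed

text \<open>For a future time-like y this is its radial projection to the hyperboloid. Signs of
  \<open>lf y e\<close> are unaffected, so arguments about convex sets in hyperbolic space can be
  made with unnormalised vectors of the cone.\<close>

definition hnormalize :: "('n::finite) lvec \<Rightarrow> 'n lvec" where
  "hnormalize y = (1 / sqrt (- lf y y)) *\<^sub>R y"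

lemma lf_hnormalize: "lf (hnormalize y) e = lf y e / sqrt (- lf y y)"
  by (simp add: hnormalize_def lf_linear)

lemma hnormalize_in_hyp:
  assumes "lf y y < 0" "snd y > 0" shows "hnormalize y \<in> hyp"
proof -
  have "lf (hnormalize y) (hnormalize y) = lf y y / (sqrt (- lf y y))\<^sup>2"
    by (simp add: hnormalize_def lf_linear power2_eq_square)
  then show ?thesis using assms by (auto simp: hyp_def hnormalize_def)
qed

lemma hypD: "x \<in> hyp \<Longrightarrow> lf x x = -1" "x \<in> hyp \<Longrightarrow> snd x > 0"
  by (auto simp: hyp_def)

lemma hyp_combination:
  assumes "x \<in> hyp" "y \<in> hyp" "a \<ge> 0" "b > 0"
  shows "lf (a *\<^sub>R x + b *\<^sub>R y) (a *\<^sub>R x + b *\<^sub>R y) < 0" "snd (a *\<^sub>R x + b *\<^sub>R y) > 0"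
proof -
  have "lf x y < 0" by (rule lf_neg_of_future) (use assms hypD[of x] hypD[of y] in auto)
  then have "a * b * lf x y \<le> 0" using assms by (simp add: mult_nonneg_nonpos)
  moreover have "lf (a *\<^sub>R x + b *\<^sub>R y) (a *\<^sub>R x + b *\<^sub>R y) = - a\<^sup>2 - b\<^sup>2 + 2 * (a * b * lf x y)"
    using assms by (simp add: lf_linear hypD lf_sym[of y x] power2_eq_square algebra_simps)
  moreover have "b\<^sup>2 > 0" using assms by simp
  moreover have "a\<^sup>2 \<ge> 0" by simp
  ultimately show "lf (a *\<^sub>R x + b *\<^sub>R y) (a *\<^sub>R x + b *\<^sub>R y) < 0" by linarith
  show "snd (a *\<^sub>R x + b *\<^sub>R y) > 0"
    using assms hypD(2)[of x] hypD(2)[of y] by (simp add: add_nonneg_pos)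
qed

lemma hnormalize_combination:
  assumes "x \<in> hyp" "y \<in> hyp" "a \<ge> 0" "b > 0"
  shows "hnormalize (a *\<^sub>R x + b *\<^sub>R y) \<in> hyp"
  using hyp_combination[OF assms] by (rule hnormalize_in_hyp)

lemma hnormalize_sign:
  assumes "lf y y < 0"
  shows "lf (hnormalize y) e \<le> 0 \<longleftrightarrow> lf y e \<le> 0" "lf (hnormalize y) e < 0 \<longleftrightarrow> lf y e < 0"
    "lf (hnormalize y) e = 0 \<longleftrightarrow> lf y e = 0"
  using assms by (auto simp: lf_hnormalize divide_le_0_iff divide_less_0_iff)

text \<open>Adding up witnesses makes all the inequalities strict at once.\<close>
lemma strict_point_exists:
  assumes "finite M" "X \<subseteq> hyp" "X \<noteq> {}"
    and conv: "\<And>x y. x \<in> X \<Longrightarrow> y \<in> X \<Longrightarrow> hnormalize (x + y) \<in> X"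
    and le: "\<And>x e. x \<in> X \<Longrightarrow> e \<in> M \<Longrightarrow> lf x e \<le> 0"
    and lt: "\<And>e. e \<in> M \<Longrightarrow> \<exists>x\<in>X. lf x e < 0"
  shows "\<exists>x\<in>X. \<forall>e\<in>M. lf x e < 0"
  using assms(1) le lt
proof (induction M)
  case empty
  then show ?case using assms(3) by auto
next
  case (insert e M)
  then obtain x where x: "x \<in> X" "\<forall>e\<in>M. lf x e < 0" by auto
  obtain y where y: "y \<in> X" "lf y e < 0" using insert.prems by blast
  have tl: "lf (x + y) (x + y) < 0" using hyp_combination(1)[of x y 1 1] x y assms(2) by auto
  have "lf (x + y) f < 0" if "f \<in> insert e M" for f
  proof (cases "f = e")
    case True
    then show ?thesis using y(2) insert.prems(1)[OF x(1), of e] by (simp add: lf_linear)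
  next
    case False
    then have "lf x f < 0" using that x(2) by simp
    then show ?thesis using insert.prems(1)[OF y(1) that] by (simp add: lf_linear)
  qed
  then show ?case using conv[OF x(1) y(1)] hnormalize_sign(2)[OF tl] by blast
qed

text \<open>For a small step from p in the direction x, strict inequalities survive by continuity,
  while an inequality that is an equality at p holds by linearity.\<close>

lemma perturb_in_cone:
  assumes E: "finite E" and p: "p \<in> hyp"
    and sgn: "\<And>e. e \<in> E \<Longrightarrow> lf p e < 0 \<or> lf p e = 0 \<and> lf x e \<le> 0"
  obtains \<epsilon> where "\<epsilon> > 0" "hnormalize (p + \<epsilon> *\<^sub>R x) \<in> hyp" "lf (p + \<epsilon> *\<^sub>R x) (p + \<epsilon> *\<^sub>R x) < 0"
    "\<And>e. e \<in> E \<Longrightarrow> lf (p + \<epsilon> *\<^sub>R x) e \<le> 0"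
proof -
  have lim: "((\<lambda>\<epsilon>. p + \<epsilon> *\<^sub>R x) \<longlongrightarrow> p + 0 *\<^sub>R x) (at_right 0)"
    by (intro tendsto_intros)
  have 1: "eventually (\<lambda>\<epsilon>. lf (p + \<epsilon> *\<^sub>R x) (p + \<epsilon> *\<^sub>R x) < 0) (at_right 0)"
    using tendsto_lf[OF lim lim] hypD(1)[OF p] by (intro order_tendstoD(2)) auto
  have 2: "eventually (\<lambda>\<epsilon>. snd (p + \<epsilon> *\<^sub>R x) > 0) (at_right 0)"
    using tendsto_snd[OF lim] hypD(2)[OF p] by (intro order_tendstoD(1)) auto
  have 3: "eventually (\<lambda>\<epsilon>. lf (p + \<epsilon> *\<^sub>R x) e \<le> 0) (at_right 0)" if "e \<in> E" for e
  proof (cases "lf p e < 0")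
    case True
    then have "eventually (\<lambda>\<epsilon>. lf (p + \<epsilon> *\<^sub>R x) e < 0) (at_right 0)"
      using tendsto_lf[OF lim tendsto_const[of e]] by (intro order_tendstoD(2)) auto
    then show ?thesis by (rule eventually_mono) simp
  next
    case False
    then have "lf p e = 0" "lf x e \<le> 0" using sgn[OF that] by auto
    then show ?thesis
      using eventually_at_right_less[of "0::real"]
      by (auto elim!: eventually_mono simp: lf_linear mult_nonneg_nonpos)
  qed
  have "eventually (\<lambda>\<epsilon>. \<forall>e\<in>E. lf (p + \<epsilon> *\<^sub>R x) e \<le> 0) (at_right 0)"
    using 3 E by (simp add: eventually_ball_finite_distrib)
  with 1 2 have "eventually (\<lambda>\<epsilon>. \<epsilon> > 0 \<and> lf (p + \<epsilon> *\<^sub>R x) (p + \<epsilon> *\<^sub>R x) < 0 \<and>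
      snd (p + \<epsilon> *\<^sub>R x) > 0 \<and> (\<forall>e\<in>E. lf (p + \<epsilon> *\<^sub>R x) e \<le> 0)) (at_right 0)"
    using eventually_at_right_less[of "0::real"] by eventually_elim auto
  then obtain \<epsilon> where "\<epsilon> > 0 \<and> lf (p + \<epsilon> *\<^sub>R x) (p + \<epsilon> *\<^sub>R x) < 0 \<and>
      snd (p + \<epsilon> *\<^sub>R x) > 0 \<and> (\<forall>e\<in>E. lf (p + \<epsilon> *\<^sub>R x) e \<le> 0)"
    using eventually_happens'[OF trivial_limit_at_right_real] by blast
  then show ?thesis using that[of \<epsilon>] hnormalize_in_hyp by blast
qed

text \<open>The difference of two candidates lies in V and is orthogonal to V, hence isotropic and
  orthogonal to the time-like p, hence zero.\<close>

lemma lproj_eqI: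
  assumes V: "subspace V" "p \<in> V" "lf p p < 0"
    and v: "v \<in> V" "\<And>w. w \<in> V \<Longrightarrow> lf (e - v) w = 0"
  shows "lproj V e = v"
  unfolding lproj_def
proof (rule the_equality)
  show "v \<in> V \<and> (\<forall>w\<in>V. lf (e - v) w = 0)" using v by auto
next
  fix u assume u: "u \<in> V \<and> (\<forall>w\<in>V. lf (e - u) w = 0)"
  have uv: "u - v \<in> V" using u v V by (auto intro: subspace_diff)
  have orth: "lf (u - v) w = 0" if "w \<in> V" for w
    using v(2)[OF that] u that by (auto simp: lf_linear)
  show "u = v"
    using lf_pos_of_orthogonal[OF V(3) orth[OF V(2)]] orth[OF uv] by force
qed

section \<open>Dimension counts and orthogonalisation\<close>

lemma dim_lf_hyperplane:
  fixes V :: "('n::finite) lvec set"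
  assumes V: "subspace V" and v: "v \<in> V" "lf v e \<noteq> 0"
  shows "dim {x \<in> V. lf x e = 0} + 1 = dim V"
proof -
  let ?W = "{x \<in> V. lf x e = 0}"
  have W: "subspace ?W"
    using V by (auto simp: subspace_def lf_linear)
  have "v \<notin> span ?W" using v W by (simp add: span_eq_iff[THEN iffD2])
  then have "dim (insert v ?W) = dim ?W + 1" by (simp add: dim_insert)
  moreover have "span (insert v ?W) = V"
  proof
    show "span (insert v ?W) \<subseteq> V" using V v by (intro span_minimal) auto
    show "V \<subseteq> span (insert v ?W)"
    proof
      fix x assume x: "x \<in> V"
      let ?y = "x - (lf x e / lf v e) *\<^sub>R v"
      have "?y \<in> ?W" using x v V by (auto simp: lf_linear subspace_diff subspace_scale)
      then have "?y + (lf x e / lf v e) *\<^sub>R v \<in> span (insert v ?W)"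
        by (intro span_add span_scale) (auto intro: span_base)
      then show "x \<in> span (insert v ?W)" by simp
    qed
  qed
  ultimately show ?thesis using dim_span[of "insert v ?W"] by simp
qed

lemma dim_lf_hyperplanes:
  fixes V :: "('n::finite) lvec set"
  assumes V: "subspace V" and N: "finite N"
  shows "dim V \<le> dim {x \<in> V. \<forall>u\<in>N. lf x u = 0} + card N"
  using N
proof (induction N)
  case (insert u N)
  let ?W = "{x \<in> V. \<forall>u\<in>N. lf x u = 0}"
  have eq: "{x \<in> V. \<forall>u\<in>insert u N. lf x u = 0} = {x \<in> ?W. lf x u = 0}" by auto
  have W: "subspace ?W" using V by (auto simp: subspace_def lf_linear)
  have "dim ?W \<le> dim {x \<in> ?W. lf x u = 0} + 1"
  proof (cases "\<exists>v\<in>?W. lf v u \<noteq> 0")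
    case True
    then obtain v where "v \<in> ?W" "lf v u \<noteq> 0" by blast
    then show ?thesis using dim_lf_hyperplane[OF W, of v u] by simp
  next
    case False
    then have "{x \<in> ?W. lf x u = 0} = ?W" by blast
    then show ?thesis by simp
  qed
  then show ?case using insert unfolding eq by simp
qed simp

text \<open>A basis of \<open>span N\<close> imposes \<open>dim N\<close> linear conditions on V. By
  hypothesis they have only the zero solution, so \<open>dim V\<close> is at most
  \<open>dim N\<close>.\<close>

lemma span_eq_of_nondegenerate:
  fixes V :: "('n::finite) lvec set"
  assumes V: "subspace V" and N: "N \<subseteq> V"
    and nd: "\<And>x. x \<in> V \<Longrightarrow> (\<And>u. u \<in> N \<Longrightarrow> lf x u = 0) \<Longrightarrow> x = 0"
  shows "span N = V"
proof -
  obtain B where B: "B \<subseteq> N" "independent B" "N \<subseteq> span B" "card B = dim N"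
    using basis_exists by blast
  have "x = 0" if x: "x \<in> V" "\<forall>u\<in>B. lf x u = 0" for x
  proof (rule nd[OF x(1)])
    fix u assume "u \<in> N"
    then have "u \<in> span B" using B by auto
    then show "lf x u = 0"
      by (induction rule: span_induct_alt) (use x in \<open>auto simp: lf_linear\<close>)
  qed
  then have "{x \<in> V. \<forall>u\<in>B. lf x u = 0} \<subseteq> {0}" by auto
  then have "dim {x \<in> V. \<forall>u\<in>B. lf x u = 0} = 0" by (simp only: dim_eq_0)
  then have "dim V \<le> dim (span N)"
    using dim_lf_hyperplanes[OF V independent_imp_finite[OF B(2)]] B(4)
    by (simp del: dim_eq_0 add: dim_span)
  moreover have "span N \<subseteq> V" using V N by (simp add: span_minimal)
  ultimately show ?thesis
    using V by (intro subspace_dim_equal) auto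
qed

text \<open>Positivity replaces linear independence of the family v.\<close>
lemma gram_schmidt_over_field:
  assumes K: "is_subfield K" and S: "finite S"
    and pos: "\<And>x. x \<in> span (v ` S) \<Longrightarrow> x \<noteq> 0 \<Longrightarrow> lf x x > 0"
    and SK: "\<And>s t. s \<in> S \<Longrightarrow> t \<in> S \<Longrightarrow> lf (v s) (v t) \<in> K"
    and eK: "\<And>s. s \<in> S \<Longrightarrow> lf e (v s) \<in> K"
  shows "\<exists>a. (\<forall>s\<in>S. a s \<in> K) \<and> (\<forall>t\<in>S. lf (e - (\<Sum>s\<in>S. a s *\<^sub>R v s)) (v t) = 0)"
  using S pos SK eK
proof (induction S arbitrary: e)
  case (insert r S)
  note Kop = subfield_diff[OF K] subfield_mult[OF K] subfield_divide[OF K] subfield_sum[OF K]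
  have spanS: "span (v ` S) \<subseteq> span (v ` insert r S)" by (intro span_mono) auto
  have IH: "\<exists>a. (\<forall>s\<in>S. a s \<in> K) \<and> (\<forall>t\<in>S. lf (e - (\<Sum>s\<in>S. a s *\<^sub>R v s)) (v t) = 0)"
    if "\<And>s. s \<in> S \<Longrightarrow> lf e (v s) \<in> K" for e
    using insert.IH[of e] insert.prems(1,2) spanS that by blast
  obtain b where b: "\<forall>s\<in>S. b s \<in> K" "\<forall>t\<in>S. lf (v r - (\<Sum>s\<in>S. b s *\<^sub>R v s)) (v t) = 0"
    using IH[of "v r"] insert.prems(2) by auto
  obtain a where a: "\<forall>s\<in>S. a s \<in> K" "\<forall>t\<in>S. lf (e - (\<Sum>s\<in>S. a s *\<^sub>R v s)) (v t) = 0"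
    using IH[of e] insert.prems(3) by auto
  define r' where "r' = v r - (\<Sum>s\<in>S. b s *\<^sub>R v s)"
  define e' where "e' = e - (\<Sum>s\<in>S. a s *\<^sub>R v s)"
  have r'_span: "r' \<in> span (v ` insert r S)"
    unfolding r'_def by (intro span_diff span_sum span_scale) (auto intro: span_base)
  have r_orth: "lf x (v r) = lf x r'" if "\<forall>t\<in>S. lf x (v t) = 0" for x
    using that by (simp add: r'_def lf_linear lf_sum_right)
  show ?case
  proof (cases "r' = 0")
    \<comment> \<open>Here v r depends on the earlier vectors, so orthogonality to it is automatic
      and it receives the coefficient 0.\<close>
    case True
    have orth: "\<forall>t\<in>insert r S. lf e' (v t) = 0"
      using a r_orth[of e'] True unfolding e'_def by (auto simp: lf_linear)
    let ?a = "a(r := 0)"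
    have "(\<Sum>s\<in>insert r S. ?a s *\<^sub>R v s) = (\<Sum>s\<in>S. a s *\<^sub>R v s)"
      using insert.hyps by (auto intro!: sum.cong)
    moreover have "\<forall>s\<in>insert r S. ?a s \<in> K" using a subfield_0[OF K] by auto
    ultimately show ?thesis using orth unfolding e'_def by (intro exI[of _ ?a]) simp
  next
    case False
    \<comment> \<open>Subtracting a multiple of r' preserves orthogonality to the earlier vectors,
      since r' is orthogonal to them; this multiple adds orthogonality to v r. Its denominator
      equals \<open>lf r' r'\<close>, which is positive.\<close>
    let ?c = "lf e' (v r) / lf r' (v r)"
    have r'r: "lf r' (v r) = lf r' r'" using r_orth[of r'] b unfolding r'_def by auto
    then have r'pos: "lf r' (v r) > 0" using insert.prems(1)[OF r'_span False] by simp
    let ?a = "\<lambda>s. if s = r then ?c else a s - ?c * b s"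
    have "(\<Sum>s\<in>S. ?a s *\<^sub>R v s) = (\<Sum>s\<in>S. a s *\<^sub>R v s - ?c *\<^sub>R (b s *\<^sub>R v s))"
      using insert.hyps by (intro sum.cong) (auto simp: algebra_simps)
    also have "\<dots> = (\<Sum>s\<in>S. a s *\<^sub>R v s) - ?c *\<^sub>R (\<Sum>s\<in>S. b s *\<^sub>R v s)"
      by (simp add: sum_subtractf scaleR_sum_right)
    finally have sum: "e - (\<Sum>s\<in>insert r S. ?a s *\<^sub>R v s) = e' - ?c *\<^sub>R r'"
      using insert.hyps by (simp add: e'_def r'_def algebra_simps)
    have "lf (e' - ?c *\<^sub>R r') (v r) = 0" using r'pos by (simp add: lf_linear)
    moreover have "lf (e' - ?c *\<^sub>R r') (v t) = 0" if "t \<in> S" for t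
      using that a b unfolding e'_def r'_def by (simp add: lf_linear)
    moreover have "?c \<in> K"
    proof (rule Kop(3))
      have "lf (v r) (v r) \<in> K" "lf e (v r) \<in> K" "\<And>s. s \<in> S \<Longrightarrow> lf (v s) (v r) \<in> K"
        using insert.prems by auto
      then show "lf e' (v r) \<in> K" "lf r' (v r) \<in> K"
        unfolding e'_def r'_def using a b by (auto simp: lf_linear lf_sum_left intro!: Kop)
    qed
    then have "\<forall>s\<in>insert r S. ?a s \<in> K"
      using a(1) b(1) by (simp del: times_divide_eq_left add: Kop(1,2))
    ultimately show ?thesis using sum by (intro exI[of _ ?a]) auto
  qed
qed simp

section \<open>Finite volume and the light cone\<close>

lemma independent_of_lf_orthogonal:
  assumes B: "finite B" and orth: "\<And>x y. x \<in> B \<Longrightarrow> y \<in> B \<Longrightarrow> x \<noteq> y \<Longrightarrow> lf x y = 0"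
    and nz: "\<And>x. x \<in> B \<Longrightarrow> lf x x \<noteq> 0"
  shows "independent B"
proof
  assume "dependent B"
  then obtain u v where u: "v \<in> B" "u v \<noteq> 0" "(\<Sum>w\<in>B. u w *\<^sub>R w) = 0"
    using dependent_finite[OF B] by auto
  have "0 = lf (\<Sum>w\<in>B. u w *\<^sub>R w) v" using u by (simp add: lf_linear)
  also have "\<dots> = (\<Sum>w\<in>B. if w = v then u v * lf v v else 0)"
    unfolding lf_sum_left using orth u(1) by (intro sum.cong) (auto simp: lf_linear)
  also have "\<dots> = u v * lf v v" using B u(1) by simp
  finally show False using u nz by simp
qed

lemma lorentz_basisD:
  assumes "lorentz_basis V k b0 b"
  shows "b0 \<in> V" "lf b0 b0 = -1" "snd b0 > 0" "\<And>i. i < k \<Longrightarrow> b i \<in> V" "\<And>i. i < k \<Longrightarrow> lf b0 (b i) = 0"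
    "\<And>i. i < k \<Longrightarrow> lf (b i) b0 = 0"
    "\<And>i j. i < k \<Longrightarrow> j < k \<Longrightarrow> lf (b i) (b j) = (if i = j then 1 else 0)"
proof -
  show "lf b0 (b i) = 0" "lf (b i) b0 = 0" if "i < k" for i
    using assms that lf_sym[of b0 "b i"] unfolding lorentz_basis_def by auto
qed (use assms in \<open>auto simp: lorentz_basis_def\<close>)

lemma lorentz_basis_independent:
  assumes lb: "lorentz_basis V k b0 b"
  shows "independent (insert b0 (b ` {..<k}))" "card (insert b0 (b ` {..<k})) = k + 1"
proof -
  note lbD = lorentz_basisD[OF lb]
  show "independent (insert b0 (b ` {..<k}))"
  proof (rule independent_of_lf_orthogonal)
    fix x y assume "x \<in> insert b0 (b ` {..<k})" "y \<in> insert b0 (b ` {..<k})" "x \<noteq> y"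
    then consider "x = b0" "\<exists>i<k. y = b i" | "y = b0" "\<exists>i<k. x = b i"
      | "\<exists>i<k. \<exists>j<k. i \<noteq> j \<and> x = b i \<and> y = b j" by blast
    then show "lf x y = 0" by cases (auto simp: lbD)
  next
    fix x assume "x \<in> insert b0 (b ` {..<k})"
    then consider "x = b0" | i where "i < k" "x = b i" by blast
    then show "lf x x \<noteq> 0" by cases (simp_all add: lbD)
  qed simp
  have "inj_on b {..<k}"
  proof (rule inj_onI)
    fix i j assume "i \<in> {..<k}" "j \<in> {..<k}" "b i = b j"
    then show "i = j" using lbD(7)[of i j] lbD(7)[of i i] by (auto split: if_splits)
  qed
  moreover have "b0 \<notin> b ` {..<k}"
  proof
    assume "b0 \<in> b ` {..<k}"
    then obtain i where "i < k" "b0 = b i" by blast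
    then show False using lbD(2) lbD(7)[of i i] by simp
  qed
  ultimately show "card (insert b0 (b ` {..<k})) = k + 1" by (simp add: card_image)
qed

text \<open>The minus sign compensates \<open>lf b0 b0 = -1\<close>. The error r lies in the span of
  the basis and is orthogonal to it, so it is isotropic and orthogonal to the time-like b0.\<close>

lemma lorentz_basis_expansion:
  assumes lb: "lorentz_basis V k b0 b" and V: "subspace V" "dim V = k + 1" and w: "w \<in> V"
  shows "w = (\<Sum>i<k. lf w (b i) *\<^sub>R b i) - lf w b0 *\<^sub>R b0"
proof -
  note lbD = lorentz_basisD[OF lb]
  let ?B = "insert b0 (b ` {..<k})"
  define r where "r = w - ((\<Sum>i<k. lf w (b i) *\<^sub>R b i) - lf w b0 *\<^sub>R b0)"
  have BV: "?B \<subseteq> V" using lbD by auto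
  have "V \<subseteq> span ?B"
    using card_eq_dim[OF BV] lorentz_basis_independent[OF lb] V by simp
  moreover have "r \<in> V" unfolding r_def using w V lbD
    by (intro subspace_diff subspace_sum subspace_scale) auto
  ultimately have r: "r \<in> span ?B" by blast
  have o0: "lf r b0 = 0" unfolding r_def by (simp add: lf_linear lf_sum_left lbD)
  have oi: "lf r (b j) = 0" if "j < k" for j
  proof -
    have "(\<Sum>i<k. lf w (b i) * lf (b i) (b j)) = (\<Sum>i<k. if i = j then lf w (b i) else 0)"
      using that by (intro sum.cong) (auto simp: lbD)
    then show ?thesis using that unfolding r_def by (simp add: lf_linear lf_sum_left lbD)
  qed
  have "lf r x = 0" if "x \<in> span ?B" for x
    using that
  proof (induction rule: span_induct_alt)
    case (step c x y)
    then show ?case using o0 oi by (auto simp: lf_linear)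
  qed (simp add: lf_linear)
  then have "lf r r = 0" using r by blast
  then have "r = 0" using lf_pos_of_orthogonal[of b0 r] o0 lbD(2) by fastforce
  then show ?thesis unfolding r_def by simp
qed

lemma lf_lorentz_combination:
  assumes lb: "lorentz_basis V k b0 b"
  defines "z \<equiv> \<lambda>x y. (\<Sum>i<k. x i *\<^sub>R b i) + y *\<^sub>R b0"
  shows "lf (z x y) b0 = - y" "\<And>j. j < k \<Longrightarrow> lf (z x y) (b j) = x j"
    "lf (z x y) (z x y) = (\<Sum>i<k. (x i)\<^sup>2) - y\<^sup>2"
proof -
  note lbD = lorentz_basisD[OF lb]
  show 1: "lf (z x y) b0 = - y" by (simp add: z_def lf_linear lf_sum_left lbD)
  show 2: "lf (z x y) (b j) = x j" if "j < k" for j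
  proof -
    have "(\<Sum>i<k. x i * lf (b i) (b j)) = (\<Sum>i<k. if i = j then x i else 0)"
      using that by (intro sum.cong) (auto simp: lbD)
    then show ?thesis using that by (simp add: z_def lf_linear lf_sum_left lbD)
  qed
  have "lf (z x y) (z x y) = (\<Sum>i<k. x i * lf (z x y) (b i)) + y * lf (z x y) b0"
    by (subst (2) z_def) (simp add: lf_linear lf_sum_right)
  then show "lf (z x y) (z x y) = (\<Sum>i<k. (x i)\<^sup>2) - y\<^sup>2"
    using 1 2 by (simp add: power2_eq_square)
qed

lemma hchart_props:
  assumes lb: "lorentz_basis V k b0 b" and V: "subspace V"
  shows "hchart k b0 b x \<in> hypV V" "lf (hchart k b0 b x) b0 = - sqrt (1 + (\<Sum>i<k. (x i)\<^sup>2))"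
    "\<And>j. j < k \<Longrightarrow> lf (hchart k b0 b x) (b j) = x j"
proof -
  note lbD = lorentz_basisD[OF lb]
  have nn: "(\<Sum>i<k. (x i)\<^sup>2) \<ge> 0" by (simp add: sum_nonneg)
  show 1: "lf (hchart k b0 b x) b0 = - sqrt (1 + (\<Sum>i<k. (x i)\<^sup>2))"
    unfolding hchart_def by (rule lf_lorentz_combination(1)[OF lb])
  show "lf (hchart k b0 b x) (b j) = x j" if "j < k" for j
    unfolding hchart_def using that by (rule lf_lorentz_combination(2)[OF lb])
  have 2: "lf (hchart k b0 b x) (hchart k b0 b x) = -1"
    unfolding hchart_def lf_lorentz_combination(3)[OF lb] using nn by simp
  have "snd (hchart k b0 b x) > 0"
    using future_of_lf_neg[of "hchart k b0 b x" b0] 1 2 lbD nn by simp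
  moreover have "hchart k b0 b x \<in> V"
    unfolding hchart_def using V lbD by (intro subspace_add subspace_sum subspace_scale) auto
  ultimately show "hchart k b0 b x \<in> hypV V" using 2 by (simp add: hypV_def hyp_def)
qed

text \<open>Gram-Schmidt starting from p: each remainder is orthogonal to p, so its square is
  positive and it can be normalised.\<close>

lemma lorentz_basis_exists:
  assumes V: "subspace V" "dim V = k + 1" and p: "p \<in> hypV V"
  shows "\<exists>b. lorentz_basis V k p b"
proof -
  have p': "p \<in> V" "lf p p = -1" "snd p > 0" using p by (auto simp: hypV_def hyp_def)
  have "\<exists>b. lorentz_basis V j p b" if "j \<le> k" for j
    using that
  proof (induction j)
    case 0
    then show ?case using p' by (auto simp: lorentz_basis_def)
  next
    case (Suc j)
    then obtain b where lb: "lorentz_basis V j p b" by auto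
    note lbD = lorentz_basisD[OF lb]
    let ?B = "insert p (b ` {..<j})"
    have "\<not> V \<subseteq> span ?B"
    proof
      assume "V \<subseteq> span ?B"
      then have "dim V \<le> card ?B" by (intro dim_le_card) auto
      then show False using lorentz_basis_independent(2)[OF lb] V(2) Suc.prems by simp
    qed
    then obtain v where v: "v \<in> V" "v \<notin> span ?B" by blast
    define q where "q = (\<Sum>i<j. lf v (b i) *\<^sub>R b i) + (- lf v p) *\<^sub>R p"
    define r where "r = v - q"
    have "q \<in> span ?B" unfolding q_def
      by (intro span_add span_sum span_scale) (auto intro: span_base)
    then have "r \<noteq> 0" using v by (auto simp: r_def)
    have qV: "q \<in> V" unfolding q_def using V p' lbD by (intro subspace_add subspace_sum subspace_scale) auto
    have rV: "r \<in> V" unfolding r_def using v V qV by (intro subspace_diff) auto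
    have rp: "lf r p = 0"
      unfolding r_def q_def lf_diff_left lf_lorentz_combination(1)[OF lb] by simp
    have rb: "lf r (b i) = 0" if "i < j" for i
      unfolding r_def q_def lf_diff_left lf_lorentz_combination(2)[OF lb that] by simp
    have br: "lf (b i) r = 0" if "i < j" for i using rb[OF that] by (simp add: lf_sym)
    have pr: "lf p r = 0" using rp by (simp add: lf_sym)
    have pos: "lf r r > 0" using lf_pos_of_orthogonal[OF _ rp \<open>r \<noteq> 0\<close>] p' by simp
    let ?r = "(1 / sqrt (lf r r)) *\<^sub>R r"
    have rr: "lf ?r ?r = 1" using pos by (simp add: lf_linear)
    have "lorentz_basis V (Suc j) p (b(j := ?r))"
      unfolding lorentz_basis_def
    proof (intro conjI allI impI)
      fix i assume "i < Suc j"
      then show "(b(j := ?r)) i \<in> V" "lf p ((b(j := ?r)) i) = 0"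
        using lbD rV V pr by (auto simp: lf_linear subspace_scale less_Suc_eq)
      fix l assume "l < Suc j"
      then show "lf ((b(j := ?r)) i) ((b(j := ?r)) l) = (if i = l then 1 else 0)"
        using \<open>i < Suc j\<close> lbD(7) rr rb br by (auto simp: less_Suc_eq lf_scaleR_left lf_scaleR_right)
    qed (use p' in auto)
    then show ?case by blast
  qed
  then show ?thesis by blast
qed

section \<open>Volume estimates\<close>

lemma emeasure_PiM_box:
  fixes c :: "nat \<Rightarrow> real"
  assumes "d \<ge> 0"
  shows "emeasure (PiM {..<k} (\<lambda>_. lborel)) (PiE {..<k} (\<lambda>i. {c i - d..c i + d})) = ennreal ((2 * d) ^ k)"
proof -
  interpret product_sigma_finite "\<lambda>_::nat. lborel :: real measure" by standard
  have "emeasure (PiM {..<k} (\<lambda>_. lborel)) (PiE {..<k} (\<lambda>i. {c i - d..c i + d}))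
      = (\<Prod>i<k. emeasure lborel {c i - d..c i + d})"
    by (intro emeasure_PiM) auto
  also have "\<dots> = (\<Prod>i<k. ennreal (2 * d))" using assms by simp
  also have "\<dots> = ennreal ((2 * d) ^ k)" using assms by (simp add: ennreal_power)
  finally show ?thesis .
qed

lemma sets_PiM_box:
  "PiE {..<k} (\<lambda>i. {c i - d..c i + d}) \<in> sets (PiM {..<k::nat} (\<lambda>_. lborel :: real measure))"
  by (intro sets_PiM_I_finite) auto

text \<open>A polyhedral cone leaving the closed light cone contains a light-like vector w in its interior.
  In the chart, the region over a neighbourhood of w contains the boxes t B for all large t, and
  these have volume of order at least t^k / t.\<close>
lemma finite_hvolume_imp_light_cone:
  fixes V :: "('n::finite) lvec set"
  assumes V: "subspace V" "dim V \<ge> 3" and E: "finite E"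
    and p: "p \<in> hypV V" "\<And>e. e \<in> E \<Longrightarrow> lf p e < 0"
    and fv: "finite_hvolume V (Defs.poly V E)"
    and x: "x \<in> V" "\<And>e. e \<in> E \<Longrightarrow> lf x e \<le> 0"
  shows "lf x x \<le> 0"
proof (rule ccontr)
  assume "\<not> lf x x \<le> 0"
  then have xpos: "lf x x > 0" by simp
  define k where "k = dim V - 1"
  have k: "dim V = k + 1" "k \<ge> 2" using V(2) by (auto simp: k_def)
  obtain b0 b where lb: "lorentz_basis V k b0 b"
    and int: "(\<integral>\<^sup>+ x. indicator {x. hchart k b0 b x \<in> Defs.poly V E} x *
                   ennreal (1 / sqrt (1 + (\<Sum>i<k. (x i)\<^sup>2))) \<partial>(PiM {..<k} (\<lambda>_. lborel))) < \<infinity>"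
    using fv unfolding finite_hvolume_def Let_def k_def by blast
  note lbD = lorentz_basisD[OF lb]
  have p': "p \<in> V" "lf p p = -1" "snd p > 0" using p by (auto simp: hypV_def hyp_def)
  \<comment> \<open>The segment from p to x starts inside the future cone and ends outside its
    closure. It meets the light cone at an inner point w, and the share of p in w makes all
    inequalities strict there.\<close>
  define u where "u t = (1 - t) *\<^sub>R p + t *\<^sub>R x" for t :: real
  define g where "g t = snd (u t) - norm (fst (u t))" for t
  have "continuous_on {0..1} g" unfolding g_def u_def by (intro continuous_intros)
  moreover have "g 1 \<le> 0" "g 1 \<noteq> 0"
    using xpos lf_self_nonpos_iff[of x] by (auto simp: g_def u_def)
  moreover have "g 0 > 0" using p' lf_self_neg_iff[of p] by (simp add: g_def u_def)
  ultimately obtain t where t: "0 \<le> t" "t \<le> 1" "g t = 0"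
    using IVT2'[of g 1 0 0] by auto
  moreover have "t \<noteq> 0" "t \<noteq> 1" using t(3) \<open>g 1 \<noteq> 0\<close> \<open>g 0 > 0\<close> by auto
  ultimately have t': "0 < t" "t < 1" by auto
  define w where "w = u t"
  have wV: "w \<in> V" unfolding w_def u_def using V p' x by (intro subspace_add subspace_scale)
  have sndw: "snd w = norm (fst w)" using t by (simp add: g_def w_def)
  then have ww: "lf w w = 0" by (simp add: lf_self)
  have we: "lf w e < 0" if "e \<in> E" for e
  proof -
    have "(1 - t) * lf p e < 0" using t' p(2)[OF that] by (simp add: mult_pos_neg)
    moreover have "t * lf x e \<le> 0" using t' x(2)[OF that] by (simp add: mult_nonneg_nonpos)
    ultimately show ?thesis by (simp add: w_def u_def lf_linear)
  qed
  have "w \<noteq> 0"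
  proof
    assume "w = 0"
    then have "t *\<^sub>R x = - (1 - t) *\<^sub>R p" by (simp add: w_def u_def algebra_simps eq_neg_iff_add_eq_0)
    then have "lf (t *\<^sub>R x) (t *\<^sub>R x) = lf (- (1 - t) *\<^sub>R p) (- (1 - t) *\<^sub>R p)" by simp
    then have "t * (t * lf x x) = - ((1 - t) * (1 - t))"
      using p' by (simp add: lf_linear algebra_simps)
    moreover have "t * (t * lf x x) > 0" using t' xpos by simp
    ultimately show False using zero_le_square[of "1 - t"] by linarith
  qed
  then have "snd w \<noteq> 0" using sndw by (auto simp: prod_eq_iff)
  then have wf: "snd w > 0" using sndw by (metis norm_ge_zero less_eq_real_def)
  define y where "y i = lf w (b i)" for i
  define y0 where "y0 = - lf w b0"
  have y0: "y0 > 0" unfolding y0_def using lf_neg_of_future[of w b0] ww wf lbD by simp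
  have wexp: "w = (\<Sum>i<k. y i *\<^sub>R b i) + y0 *\<^sub>R b0"
    using lorentz_basis_expansion[OF lb V(1) k(1) wV] by (simp add: y_def y0_def)
  have "(\<Sum>i<k. (y i)\<^sup>2) - y0\<^sup>2 = 0"
    using ww lf_lorentz_combination(3)[OF lb, of y y0] wexp by metis
  then have y0L: "y0 = L2_set y {..<k}" unfolding L2_set_def using y0 by (simp add: real_sqrt_unique)
  \<comment> \<open>\<open>\<delta> * A e\<close> bounds the change of \<open>lf w e\<close> when
    the coordinates of w along the \<open>b i\<close> move by at most \<delta> and the one along
    \<open>b0\<close> by at most (1 + k) \<delta>.\<close>
  define A where "A e = (\<Sum>i<k. \<bar>lf (b i) e\<bar>) + (1 + real k) * \<bar>lf b0 e\<bar>" for e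
  have "eventually (\<lambda>\<delta>. \<delta> * A e < - lf w e) (at_right 0)" if "e \<in> E" for e
  proof -
    have "((\<lambda>\<delta>. \<delta> * A e) \<longlongrightarrow> 0 * A e) (at_right 0)" by (intro tendsto_intros)
    then show ?thesis using we[OF that] by (intro order_tendstoD(2)) auto
  qed
  then have "eventually (\<lambda>\<delta>. \<forall>e\<in>E. \<delta> * A e < - lf w e) (at_right 0)"
    using E by (simp add: eventually_ball_finite_distrib)
  then have "eventually (\<lambda>\<delta>. \<delta> > 0 \<and> (\<forall>e\<in>E. \<delta> * A e < - lf w e)) (at_right 0)"
    using eventually_at_right_less[of "0::real"] by eventually_elim auto
  then obtain \<delta> where \<delta>: "\<delta> > 0" "\<And>e. e \<in> E \<Longrightarrow> \<delta> * A e < - lf w e"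
    using eventually_happens'[OF trivial_limit_at_right_real] by blast
  define Q where "Q = y0 + (1 + real k) * \<delta>"
  have Q: "Q > 0" using y0 \<delta> by (simp add: Q_def add_pos_nonneg)
  \<comment> \<open>The parameter s stands for 1/t. Dividing a chart point by t leaves coordinates
    x/t and a time coordinate with 1 replaced by (1/t)^2, so large boxes are compared with one
    neighbourhood of w. In the bound, k \<delta> comes from the sum norm and \<delta> from
    s.\<close>
  have near: "\<bar>sqrt (s\<^sup>2 + (\<Sum>i<k. (x i)\<^sup>2)) - y0\<bar> \<le> (1 + real k) * \<delta>"
    if s: "0 \<le> s" "s \<le> \<delta>" and xy: "\<And>i. i < k \<Longrightarrow> \<bar>x i - y i\<bar> \<le> \<delta>" for s x
  proof -
    define X where "X = L2_set x {..<k}"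
    define D where "D = L2_set (\<lambda>i. x i - y i) {..<k}"
    have X0: "X \<ge> 0" unfolding X_def by simp
    have D': "L2_set (\<lambda>i. y i - x i) {..<k} = D"
      unfolding D_def L2_set_def by (simp add: power2_commute)
    have "D \<le> (\<Sum>i<k. \<bar>x i - y i\<bar>)" unfolding D_def by (rule L2_set_le_sum_abs)
    also have "\<dots> \<le> (\<Sum>i<k. \<delta>)" using xy by (intro sum_mono) auto
    finally have D: "D \<le> real k * \<delta>" by simp
    have "X \<le> y0 + D"
      using L2_set_triangle_ineq[of y "\<lambda>i. x i - y i" "{..<k}"] by (simp add: X_def D_def y0L)
    moreover have "y0 \<le> X + D"
      using L2_set_triangle_ineq[of x "\<lambda>i. y i - x i" "{..<k}"] by (simp add: X_def D' y0L)
    moreover have "sqrt (s\<^sup>2 + X\<^sup>2) \<le> s + X"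
      using s X0 by (intro sqrt_sum_squares_le_sum) auto
    moreover have "X \<le> sqrt (s\<^sup>2 + X\<^sup>2)" using X0 by (intro real_le_rsqrt) simp
    moreover have "X\<^sup>2 = (\<Sum>i<k. (x i)\<^sup>2)" unfolding X_def L2_set_def by (simp add: sum_nonneg)
    ultimately show ?thesis using D s by (simp add: algebra_simps)
  qed
  have inC: "lf ((\<Sum>i<k. x i *\<^sub>R b i) + sqrt (s\<^sup>2 + (\<Sum>i<k. (x i)\<^sup>2)) *\<^sub>R b0) e < 0"
    if s: "0 \<le> s" "s \<le> \<delta>" and xy: "\<And>i. i < k \<Longrightarrow> \<bar>x i - y i\<bar> \<le> \<delta>" and e: "e \<in> E" for s x e
  proof -
    let ?S = "sqrt (s\<^sup>2 + (\<Sum>i<k. (x i)\<^sup>2))"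
    have "lf ((\<Sum>i<k. x i *\<^sub>R b i) + ?S *\<^sub>R b0) e - lf w e
        = (\<Sum>i<k. (x i - y i) * lf (b i) e) + (?S - y0) * lf b0 e"
      by (subst wexp) (simp add: lf_linear lf_sum_left sum_subtractf algebra_simps)
    also have "\<dots> \<le> (\<Sum>i<k. \<delta> * \<bar>lf (b i) e\<bar>) + (1 + real k) * \<delta> * \<bar>lf b0 e\<bar>"
    proof (intro add_mono sum_mono)
      fix i assume "i \<in> {..<k}"
      then have "\<bar>x i - y i\<bar> * \<bar>lf (b i) e\<bar> \<le> \<delta> * \<bar>lf (b i) e\<bar>"
        using xy by (intro mult_right_mono) auto
      then show "(x i - y i) * lf (b i) e \<le> \<delta> * \<bar>lf (b i) e\<bar>"
        by (simp add: abs_mult[symmetric])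
    next
      have "\<bar>?S - y0\<bar> * \<bar>lf b0 e\<bar> \<le> (1 + real k) * \<delta> * \<bar>lf b0 e\<bar>"
        using near[OF s xy] by (intro mult_right_mono) auto
      then show "(?S - y0) * lf b0 e \<le> (1 + real k) * \<delta> * \<bar>lf b0 e\<bar>"
        by (simp add: abs_mult[symmetric])
    qed
    also have "\<dots> = \<delta> * A e" by (simp add: A_def sum_distrib_left algebra_simps)
    finally show ?thesis using \<delta>(2)[OF e] by linarith
  qed
  let ?M = "PiM {..<k} (\<lambda>_. lborel :: real measure)"
  define I where "I = (\<integral>\<^sup>+ x. indicator {x. hchart k b0 b x \<in> Defs.poly V E} x *
                   ennreal (1 / sqrt (1 + (\<Sum>i<k. (x i)\<^sup>2))) \<partial>?M)"
  \<comment> \<open>On the box the density is at least 1 / (t Q), and the volume of the box is (2 t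
    \<delta>)^k. As 2 t \<delta> is at least 1 and k at least 2, the exponent may be lowered to 2,
    which leaves a bound growing linearly in t.\<close>
  have lower: "ennreal (4 * \<delta>\<^sup>2 / Q * t) \<le> I" if t: "t \<ge> 1 / \<delta>" for t
  proof -
    let ?Box = "PiE {..<k} (\<lambda>i. {t * y i - t * \<delta>..t * y i + t * \<delta>})"
    have "1 / \<delta> > 0" using \<delta> by simp
    then have t0: "t > 0" using t by linarith
    have td: "t * \<delta> \<ge> 1" using t \<delta> by (simp add: field_simps)
    have box: "hchart k b0 b x \<in> Defs.poly V E \<and> 1 / (t * Q) \<le> 1 / sqrt (1 + (\<Sum>i<k. (x i)\<^sup>2))"
      if "x \<in> ?Box" for x
    proof -
      have xy: "\<bar>x i / t - y i\<bar> \<le> \<delta>" if "i < k" for i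
      proof -
        have "t * y i - t * \<delta> \<le> x i" "x i \<le> t * y i + t * \<delta>" using \<open>x \<in> ?Box\<close> that by (auto simp: PiE_def Pi_def)
        then show ?thesis using t0 by (simp add: abs_le_iff field_simps)
      qed
      have s: "0 \<le> 1 / t" "1 / t \<le> \<delta>" using t0 td by (auto simp: field_simps)
      let ?S = "sqrt ((1 / t)\<^sup>2 + (\<Sum>i<k. (x i / t)\<^sup>2))"
      have "1 + (\<Sum>i<k. (x i)\<^sup>2) = t\<^sup>2 * ((1 / t)\<^sup>2 + (\<Sum>i<k. (x i / t)\<^sup>2))"
        using t0 by (simp add: distrib_left sum_distrib_left power_divide)
      then have S: "sqrt (1 + (\<Sum>i<k. (x i)\<^sup>2)) = t * ?S"
        using t0 by (simp add: real_sqrt_mult)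
      have chart: "hchart k b0 b x = t *\<^sub>R ((\<Sum>i<k. (x i / t) *\<^sub>R b i) + ?S *\<^sub>R b0)"
        unfolding hchart_def S using t0 by (simp add: scaleR_add_right scaleR_sum_right)
      have "lf (hchart k b0 b x) e \<le> 0" if "e \<in> E" for e
        unfolding chart lf_scaleR_left using inC[OF s xy that] t0
        by (simp add: mult_nonneg_nonpos less_imp_le)
      then have "hchart k b0 b x \<in> Defs.poly V E"
        using hchart_props(1)[OF lb V(1)] by (auto simp: poly_def hspace_def)
      moreover have "?S \<le> Q" using near[OF s xy] by (simp add: Q_def)
      then have "sqrt (1 + (\<Sum>i<k. (x i)\<^sup>2)) \<le> t * Q" unfolding S using t0 by simp
      moreover have "sqrt (1 + (\<Sum>i<k. (x i)\<^sup>2)) > 0" by (simp add: add_pos_nonneg sum_nonneg)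
      ultimately show ?thesis by (simp add: frac_le)
    qed
    have "4 * \<delta>\<^sup>2 / Q * t = 1 / (t * Q) * (2 * (t * \<delta>))\<^sup>2"
      using t0 Q by (simp add: field_simps power2_eq_square)
    also have "\<dots> \<le> 1 / (t * Q) * (2 * (t * \<delta>)) ^ k"
      using t0 Q td k(2) by (intro mult_left_mono power_increasing) auto
    finally have "ennreal (4 * \<delta>\<^sup>2 / Q * t) \<le> ennreal (1 / (t * Q) * (2 * (t * \<delta>)) ^ k)"
      by (rule ennreal_leI)
    also have "\<dots> = ennreal (1 / (t * Q)) * ennreal ((2 * (t * \<delta>)) ^ k)"
      using t0 Q \<delta> by (intro ennreal_mult) auto
    also have "\<dots> = ennreal (1 / (t * Q)) * emeasure ?M ?Box"
      using t0 \<delta> by (subst emeasure_PiM_box) auto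
    also have "\<dots> = (\<integral>\<^sup>+ x. ennreal (1 / (t * Q)) * indicator ?Box x \<partial>?M)"
      using sets_PiM_box by (subst nn_integral_cmult_indicator) auto
    also have "\<dots> \<le> I"
      unfolding I_def
    proof (rule nn_integral_mono)
      fix x
      show "ennreal (1 / (t * Q)) * indicator ?Box x
        \<le> indicator {x. hchart k b0 b x \<in> Defs.poly V E} x * ennreal (1 / sqrt (1 + (\<Sum>i<k. (x i)\<^sup>2)))"
        using box[of x] by (cases "x \<in> ?Box") (auto intro: ennreal_leI)
    qed
    finally show ?thesis .
  qed
  have "I < \<infinity>" unfolding I_def by (rule int)
  then obtain r where r: "I = ennreal r" "r \<ge> 0" by (cases I) auto
  define t where "t = max (1 / \<delta>) ((r + 1) * Q / (4 * \<delta>\<^sup>2))"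
  have "4 * \<delta>\<^sup>2 / Q * ((r + 1) * Q / (4 * \<delta>\<^sup>2)) \<le> 4 * \<delta>\<^sup>2 / Q * t"
    unfolding t_def using Q by (intro mult_left_mono) auto
  moreover have "4 * \<delta>\<^sup>2 / Q * ((r + 1) * Q / (4 * \<delta>\<^sup>2)) = r + 1" using Q \<delta>(1) by simp
  ultimately have "r + 1 \<le> 4 * \<delta>\<^sup>2 / Q * t" by linarith
  moreover have "4 * \<delta>\<^sup>2 / Q * t \<le> r" using lower[of t] r by (simp add: t_def)
  ultimately show False by simp
qed

lemma finite_positive_lower_bound:
  fixes f :: "'a \<Rightarrow> real"
  assumes "finite I" "\<And>i. i \<in> I \<Longrightarrow> 0 < f i"
  obtains c where "c > 0" "\<forall>i\<in>I. c \<le> f i"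
proof (rule that[of "Min (insert 1 (f ` I))"])
  show "Min (insert 1 (f ` I)) > 0" using assms by simp
  show "\<forall>i\<in>I. Min (insert 1 (f ` I)) \<le> f i" using assms(1) by (auto intro: Min_le)
qed

lemma finite_upper_bound:
  fixes f :: "'a \<Rightarrow> real"
  assumes "finite I"
  obtains c where "c \<ge> 0" "\<forall>i\<in>I. f i \<le> c"
proof (rule that[of "Max (insert 0 (f ` I))"])
  show "Max (insert 0 (f ` I)) \<ge> 0" using assms by simp
  show "\<forall>i\<in>I. f i \<le> Max (insert 0 (f ` I))" using assms by (auto intro: Max_ge)
qed

text \<open>z is a combination of the vertices of the slice; if v has the largest coefficient, then the
  single row of v in the Gram matrix of the vertices already bounds the other coefficients.\<close>
lemma light_cone_vertex_estimate:
  fixes E :: "('n::finite) lvec set" and b :: "nat \<Rightarrow> 'n lvec"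
  assumes E: "finite E" and cone: "\<And>x. (\<And>e. e \<in> E \<Longrightarrow> lf x e \<le> 0) \<Longrightarrow> lf x x \<le> 0"
    and b0: "lf b0 b0 = -1" "snd b0 > 0"
  obtains G C where "finite G" "C \<ge> 0"
    "\<And>z. z \<in> hyp \<Longrightarrow> (\<And>e. e \<in> E \<Longrightarrow> lf z e \<le> 0) \<Longrightarrow>
      \<exists>v\<in>G. \<forall>j<k. \<bar>lf z (b j) - (- lf z b0) * lf v (b j)\<bar> \<le> C / (- lf z b0)"
proof -
  \<comment> \<open>The slice of the cone at time 1. It is bounded because it lies in the closed
    light cone, so it is the convex hull of a finite set.\<close>
  define P where "P = {z. snd z = 1} \<inter> \<Inter> ((\<lambda>e. {z. lf z e \<le> 0}) ` E)"
  have "polyhedron {z :: 'n lvec. snd z = 1}"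
    using polyhedron_hyperplane[of "(0,1) :: 'n lvec" 1] by (simp add: inner_prod_def)
  moreover have "polyhedron (\<Inter> ((\<lambda>e. {z. lf z e \<le> 0}) ` E))"
    using E by (intro polyhedron_Inter) (auto simp: lf_eq_inner intro: polyhedron_halfspace_le)
  ultimately have "polyhedron P" unfolding P_def by (rule polyhedron_Int)
  moreover have "bounded P"
  proof (rule boundedI)
    fix z assume z: "z \<in> P"
    then have "lf z z \<le> 0" "snd z = 1" using cone[of z] by (auto simp: P_def)
    then have "norm (fst z) \<le> 1" using lf_self_nonpos_iff[of z] by simp
    moreover have "norm z \<le> norm (fst z) + norm (snd z)"
      using norm_Pair_le[of "fst z" "snd z"] by simp
    ultimately show "norm z \<le> 1 + 1" using \<open>snd z = 1\<close> by simp
  qed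
  ultimately obtain G where G: "finite G" "P = convex hull G"
    using polytope_eq_bounded_polyhedron[of P] unfolding polytope_def by auto
  have GP: "v \<in> P" if "v \<in> G" for v using hull_inc[OF that, of convex] G(2) by simp
  have Gnull: "lf v v \<le> 0" "snd v = 1" if "v \<in> G" for v
    using GP[OF that] cone[of v] by (auto simp: P_def)
  \<comment> \<open>Otherwise the space parts would have inner product at least 1 and norms at most
    1, which makes them equal.\<close>
  have Gneg: "lf v w < 0" if "v \<in> G" "w \<in> G" "v \<noteq> w" for v w
  proof (rule ccontr)
    assume "\<not> lf v w < 0"
    then have "fst v \<bullet> fst w \<ge> 1" using Gnull that by (simp add: lf_def)
    moreover have "norm (fst v) \<le> 1" "norm (fst w) \<le> 1"
      using Gnull that lf_self_nonpos_iff[of v] lf_self_nonpos_iff[of w] by auto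
    then have "(norm (fst v))\<^sup>2 \<le> 1" "(norm (fst w))\<^sup>2 \<le> 1" by (simp_all add: power_le_one)
    moreover have "(norm (fst v - fst w))\<^sup>2 = (norm (fst v))\<^sup>2 + (norm (fst w))\<^sup>2 - 2 * (fst v \<bullet> fst w)"
      by (simp add: power2_norm_eq_inner algebra_simps inner_commute)
    ultimately have "(norm (fst v - fst w))\<^sup>2 \<le> 0" by linarith
    then have "fst v = fst w" by simp
    then show False using that Gnull by (simp add: prod_eq_iff)
  qed
  define \<beta> where "\<beta> v = - lf v b0" for v
  have \<beta>: "\<beta> v > 0" if "v \<in> G" for v
    unfolding \<beta>_def using lf_neg_of_future[of v b0] Gnull[OF that] b0 by simp
  \<comment> \<open>With \<open>lf (g v) b0 = -1\<close>, the number r = \<open>- lf z b0\<close>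
    becomes the sum of the coefficients of z.\<close>
  define g where "g v = (1 / \<beta> v) *\<^sub>R v" for v
  have glf: "lf (g v) (g w) = lf v w / (\<beta> v * \<beta> w)" for v w by (simp add: g_def lf_linear)
  have fin: "finite {q \<in> G \<times> G. fst q \<noteq> snd q}" using G(1) by simp
  have pos: "0 < - lf (g (fst q)) (g (snd q))" if "q \<in> {q \<in> G \<times> G. fst q \<noteq> snd q}" for q
    using that Gneg[of "fst q" "snd q"] \<beta>[of "fst q"] \<beta>[of "snd q"]
    by (simp add: glf mem_Times_iff divide_neg_pos)
  obtain c where c_pos: "c > 0"
    and c: "\<forall>q\<in>{q \<in> G \<times> G. fst q \<noteq> snd q}. c \<le> - lf (g (fst q)) (g (snd q))"
    using finite_positive_lower_bound[OF fin pos] .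
  have c_le: "c \<le> - lf (g v) (g w)" if "v \<in> G" "w \<in> G" "v \<noteq> w" for v w
    using c[rule_format, of "(v, w)"] that by simp
  have "finite (G \<times> G \<times> {..<k})" using G(1) by simp
  then obtain D where D0: "D \<ge> 0"
    and D: "\<forall>q\<in>G \<times> G \<times> {..<k}. \<bar>lf (g (fst q) - g (fst (snd q))) (b (snd (snd q)))\<bar> \<le> D"
    by (rule finite_upper_bound)
  have D_ge: "\<bar>lf (g v - g w) (b j)\<bar> \<le> D" if "v \<in> G" "w \<in> G" "j < k" for v w j
    using D[rule_format, of "(v, w, j)"] that by simp
  \<comment> \<open>The total weight off the dominant vertex will be at most
    \<open>card G / (c * r)\<close>, since the largest coefficient is at least
    \<open>r / card G\<close>; D bounds the coordinate differences between vertices.\<close>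
  define C where "C = D * real (card G) / c"
  have est: "\<exists>v\<in>g ` G. \<forall>j<k. \<bar>lf z (b j) - (- lf z b0) * lf v (b j)\<bar> \<le> C / (- lf z b0)"
    if z: "z \<in> hyp" "\<And>e. e \<in> E \<Longrightarrow> lf z e \<le> 0" for z
  proof -
    have sz: "snd z > 0" using hypD z by blast
    define r where "r = - lf z b0"
    have r: "r > 0" unfolding r_def using lf_neg_of_future[of z b0] hypD[OF z(1)] b0 by simp
    have "(1 / snd z) *\<^sub>R z \<in> P"
      unfolding P_def using sz z(2) by (auto simp: lf_linear divide_le_0_iff)
    then obtain u where u: "\<forall>v\<in>G. 0 \<le> u v" "sum u G = 1" "(\<Sum>v\<in>G. u v *\<^sub>R v) = (1 / snd z) *\<^sub>R z"
      unfolding G(2) convex_hull_finite[OF G(1)] by auto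
    define \<tau> where "\<tau> v = snd z * u v * \<beta> v" for v
    have \<tau>0: "\<tau> v \<ge> 0" if "v \<in> G" for v
      unfolding \<tau>_def using u sz \<beta>[OF that] that by simp
    have "(\<Sum>v\<in>G. \<tau> v *\<^sub>R g v) = (\<Sum>v\<in>G. snd z *\<^sub>R (u v *\<^sub>R v))"
      using \<beta> by (intro sum.cong) (auto simp: \<tau>_def g_def less_imp_neq[symmetric])
    also have "\<dots> = snd z *\<^sub>R ((1 / snd z) *\<^sub>R z)" unfolding u(3)[symmetric] by (simp add: scaleR_sum_right)
    also have "\<dots> = z" using sz by simp
    finally have zsum: "z = (\<Sum>v\<in>G. \<tau> v *\<^sub>R g v)" by simp
    have "lf (g v) b0 = -1" if "v \<in> G" for v
      using \<beta>[OF that] by (simp add: g_def lf_linear \<beta>_def)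
    then have rsum: "r = (\<Sum>v\<in>G. \<tau> v)"
      unfolding r_def by (subst zsum) (simp add: lf_sum_left lf_linear sum_negf)
    have "G \<noteq> {}" using u(2) by auto
    then have "Max (\<tau> ` G) \<in> \<tau> ` G" using G(1) by (intro Max_in) auto
    then obtain i where "i \<in> G" "\<tau> i = Max (\<tau> ` G)" by (metis imageE)
    then have i: "i \<in> G" "\<And>v. v \<in> G \<Longrightarrow> \<tau> v \<le> \<tau> i" using G(1) by auto
    have ri: "r \<le> real (card G) * \<tau> i"
      unfolding rsum using sum_bounded_above[of G \<tau> "\<tau> i"] i by simp
    then have "real (card G) * \<tau> i > 0" using r by linarith
    then have \<tau>i: "\<tau> i > 0" using \<tau>0[OF i(1)] by (cases "\<tau> i = 0") auto
    have gz: "lf (g v) z = (\<Sum>w\<in>G. \<tau> w * lf (g v) (g w))" for v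
      by (subst zsum) (simp add: lf_sum_right lf_linear)
    have gg: "lf (g v) (g w) \<le> 0" if "v \<in> G" "w \<in> G" for v w
      using Gneg[OF that] Gnull[OF that(1)] \<beta>[OF that(1)] \<beta>[OF that(2)] unfolding glf
      by (cases "v = w") (auto simp: divide_le_0_iff less_imp_le)
    have gz0: "lf (g v) z \<le> 0" if "v \<in> G" for v
      unfolding gz using that \<tau>0 gg by (intro sum_nonpos) (simp add: mult_nonneg_nonpos)
    have rest: "(\<Sum>w\<in>G - {i}. \<tau> w) = r - \<tau> i"
      unfolding rsum using G(1) i by (simp add: sum_diff1)
    \<comment> \<open>All summands of the expansion of \<open>lf z z = -1\<close> are nonpositive,
      so the row of i alone is at least -1, while its off-diagonal entries are at most -c.\<close>
    have "\<tau> i * (c * (r - \<tau> i)) \<le> 1"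
    proof -
      have "-1 = lf z z" using hypD(1)[OF z(1)] by simp
      also have "\<dots> = (\<Sum>v\<in>G. \<tau> v * lf (g v) z)"
        by (subst (1) zsum) (simp add: lf_sum_left lf_linear)
      also have "\<dots> \<le> \<tau> i * lf (g i) z"
        using sum_nonpos[of "G - {i}" "\<lambda>v. \<tau> v * lf (g v) z"] gz0 \<tau>0 G(1) i
        by (subst sum.remove[of _ i]) (auto simp: mult_nonneg_nonpos)
      also have "\<dots> \<le> \<tau> i * (- (c * (r - \<tau> i)))"
      proof (rule mult_left_mono)
        have "lf (g i) z \<le> (\<Sum>w\<in>G - {i}. \<tau> w * lf (g i) (g w))"
          unfolding gz using G(1) i gg \<tau>0 by (subst sum.remove[of _ i]) (auto simp: mult_nonneg_nonpos)
        also have "\<dots> \<le> (\<Sum>w\<in>G - {i}. \<tau> w * (- c))"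
          using c_le[OF i(1)] \<tau>0 by (intro sum_mono mult_left_mono) force+
        also have "\<dots> = - (c * (r - \<tau> i))" unfolding sum_distrib_right[symmetric] rest by simp
        finally show "lf (g i) z \<le> - (c * (r - \<tau> i))" .
      qed (use \<tau>i in simp)
      finally show ?thesis by simp
    qed
    then have "c * \<tau> i * (r - \<tau> i) \<le> 1" by (simp add: algebra_simps)
    then have d1: "r - \<tau> i \<le> 1 / (c * \<tau> i)" using c_pos \<tau>i by (simp add: pos_le_divide_eq mult.commute)
    have "1 / (c * \<tau> i) \<le> real (card G) / (c * r)"
      using ri c_pos \<tau>i r by (simp add: frac_le_eq field_simps)
    with d1 have d: "r - \<tau> i \<le> real (card G) / (c * r)" by linarith
    have "\<bar>lf z (b j) - r * lf (g i) (b j)\<bar> \<le> C / r" if j: "j < k" for j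
    proof -
      have "lf z (b j) - r * lf (g i) (b j) = (\<Sum>w\<in>G. \<tau> w * lf (g w - g i) (b j))"
        unfolding rsum by (subst (1) zsum) (simp add: lf_sum_left lf_linear sum_distrib_right sum_subtractf algebra_simps)
      also have "\<dots> = (\<Sum>w\<in>G - {i}. \<tau> w * lf (g w - g i) (b j))"
        using G(1) i by (subst sum.remove[of _ i]) (auto simp: lf_linear)
      finally have "\<bar>lf z (b j) - r * lf (g i) (b j)\<bar> = \<bar>\<Sum>w\<in>G - {i}. \<tau> w * lf (g w - g i) (b j)\<bar>" by simp
      also have "\<dots> \<le> (\<Sum>w\<in>G - {i}. \<bar>\<tau> w * lf (g w - g i) (b j)\<bar>)" by (rule sum_abs)
      also have "\<dots> \<le> (\<Sum>w\<in>G - {i}. \<tau> w * D)"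
        using \<tau>0 D_ge[OF _ i(1) j] by (intro sum_mono) (auto simp: abs_mult intro!: mult_mono)
      also have "\<dots> = (r - \<tau> i) * D" unfolding sum_distrib_right[symmetric] rest by simp
      also have "\<dots> \<le> real (card G) / (c * r) * D" using d D0 by (rule mult_right_mono)
      also have "\<dots> = C / r" using r c_pos by (simp add: C_def field_simps)
      finally show ?thesis .
    qed
    then show ?thesis unfolding r_def[symmetric] using i by blast
  qed
  show ?thesis
    by (rule that[of "g ` G" C]) (use G(1) D0 c_pos est in \<open>auto simp: C_def\<close>)
qed

text \<open>With r = sqrt (1 + x^2) and m the integral part of r^2, a chart point x of the region lies in
  a box of side O(1 / sqrt m) around sqrt m times a vertex, and the sum of m^(-(k+1)/2) converges.\<close>
lemma finite_hvolume_of_light_cone: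
  fixes V :: "('n::finite) lvec set"
  assumes V: "subspace V" "dim V = k + 1" and k: "k \<ge> 2" and p: "p \<in> hypV V"
    and E: "finite E" and cone: "\<And>x. (\<And>e. e \<in> E \<Longrightarrow> lf x e \<le> 0) \<Longrightarrow> lf x x \<le> 0"
    and S: "\<And>z e. z \<in> S \<Longrightarrow> e \<in> E \<Longrightarrow> lf z e \<le> 0"
  shows "finite_hvolume V S"
proof -
  obtain b where lb: "lorentz_basis V k p b" using lorentz_basis_exists[OF V p] by blast
  note lbD = lorentz_basisD[OF lb]
  obtain G C where G: "finite G" "C \<ge> 0"
    and est: "\<And>z. z \<in> hyp \<Longrightarrow> (\<And>e. e \<in> E \<Longrightarrow> lf z e \<le> 0) \<Longrightarrow>
      \<exists>v\<in>G. \<forall>j<k. \<bar>lf z (b j) - (- lf z p) * lf v (b j)\<bar> \<le> C / (- lf z p)"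
    using light_cone_vertex_estimate[OF E cone lbD(2,3), of k b] by metis
  have "finite (G \<times> {..<k})" using G(1) by simp
  then obtain W where W0: "W \<ge> 0" and W: "\<forall>q\<in>G \<times> {..<k}. \<bar>lf (fst q) (b (snd q))\<bar> \<le> W"
    by (rule finite_upper_bound)
  have W_ge: "\<bar>lf v (b j)\<bar> \<le> W" if "v \<in> G" "j < k" for v j
    using W[rule_format, of "(v, j)"] that by simp
  \<comment> \<open>C accounts for the distance of x from r times a vertex, W for replacing r by q =
    sqrt m: from r^2 - q^2 \<le> 1 one gets r - q \<le> 1/q.\<close>
  define A where "A = C + W"
  have A0: "A \<ge> 0" using G W0 by (simp add: A_def)
  let ?M = "PiM {..<k} (\<lambda>_. lborel :: real measure)"
  \<comment> \<open>The index n stands for m = n + 1; the value m = 0 does not occur, because r is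
    at least 1.\<close>
  let ?q = "\<lambda>n. sqrt (real (Suc n))"
  define Box where "Box n v = PiE {..<k} (\<lambda>j. {?q n * lf v (b j) - A / ?q n..?q n * lf v (b j) + A / ?q n})" for n v
  have Box_sets: "Box n v \<in> sets ?M" for n v unfolding Box_def by (rule sets_PiM_box)
  have Box_vol: "emeasure ?M (Box n v) = ennreal ((2 * (A / ?q n)) ^ k)" for n v
    unfolding Box_def using A0 by (intro emeasure_PiM_box) simp
  have cover: "\<exists>n. \<exists>v\<in>G. x \<in> Box n v \<and> 1 / sqrt (1 + (\<Sum>i<k. (x i)\<^sup>2)) \<le> 1 / ?q n"
    if x: "x \<in> space ?M" "hchart k p b x \<in> S" for x
  proof -
    let ?z = "hchart k p b x"
    define r where "r = sqrt (1 + (\<Sum>i<k. (x i)\<^sup>2))"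
    have r2: "r\<^sup>2 = 1 + (\<Sum>i<k. (x i)\<^sup>2)" unfolding r_def by (simp add: add_nonneg_nonneg sum_nonneg)
    have r1: "r \<ge> 1" unfolding r_def by (simp add: sum_nonneg)
    have rz: "- lf ?z p = r" using hchart_props(2)[OF lb V(1)] by (simp add: r_def)
    have "?z \<in> hyp" using hchart_props(1)[OF lb V(1)] by (simp add: hypV_def)
    then obtain v where v: "v \<in> G" "\<And>j. j < k \<Longrightarrow> \<bar>lf ?z (b j) - r * lf v (b j)\<bar> \<le> C / r"
      using est[of ?z] S[OF x(2)] unfolding rz by auto
    define m where "m = nat \<lfloor>r\<^sup>2\<rfloor>"
    have "r\<^sup>2 \<ge> 1" using r1 by simp
    then have m: "real m \<le> r\<^sup>2" "r\<^sup>2 < real m + 1" "m \<ge> 1"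
      unfolding m_def by (auto simp: le_nat_floor)
    then obtain n where n: "m = Suc n" by (cases m) auto
    define q where "q = ?q n"
    have q: "q > 0" "q\<^sup>2 = real m" "q \<ge> 1" by (simp_all add: q_def n)
    have qr: "q \<le> r" using m(1) r1 unfolding q_def n by (intro real_le_lsqrt) auto
    have "(r - q) * q \<le> (r - q) * (r + q)" using qr r1 q by (intro mult_left_mono) auto
    also have "\<dots> = r\<^sup>2 - q\<^sup>2" by (simp add: power2_eq_square algebra_simps)
    also have "\<dots> \<le> 1" using m q by simp
    finally have rq: "r - q \<le> 1 / q" using q by (simp add: field_simps)
    have "\<bar>x j - q * lf v (b j)\<bar> \<le> A / q" if j: "j < k" for j
    proof -
      have "\<bar>x j - q * lf v (b j)\<bar> \<le> \<bar>x j - r * lf v (b j)\<bar> + \<bar>(r - q) * lf v (b j)\<bar>"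
        by (simp add: algebra_simps)
      also have "\<bar>x j - r * lf v (b j)\<bar> \<le> C / r"
        using v(2)[OF j] hchart_props(3)[OF lb V(1) j] by simp
      also have "C / r \<le> C / q" using G qr q by (intro divide_left_mono) auto
      also have "\<bar>(r - q) * lf v (b j)\<bar> \<le> 1 / q * W"
        unfolding abs_mult using rq qr W_ge[OF v(1) j] q by (intro mult_mono) auto
      finally show ?thesis by (simp add: A_def add_divide_distrib)
    qed
    then have "x \<in> Box n v"
      using x(1) unfolding Box_def q_def by (auto simp: space_PiM PiE_iff abs_le_iff algebra_simps)
    moreover have "1 / r \<le> 1 / q" using qr q by (simp add: frac_le)
    ultimately show ?thesis unfolding r_def q_def using v(1) by blast
  qed
  have "(\<integral>\<^sup>+ x. indicator {x. hchart k p b x \<in> S} x * ennreal (1 / sqrt (1 + (\<Sum>i<k. (x i)\<^sup>2))) \<partial>?M)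
      \<le> (\<integral>\<^sup>+ x. (\<Sum>n. \<Sum>v\<in>G. ennreal (1 / ?q n) * indicator (Box n v) x) \<partial>?M)"
  proof (rule nn_integral_mono)
    fix x assume x: "x \<in> space ?M"
    show "indicator {x. hchart k p b x \<in> S} x * ennreal (1 / sqrt (1 + (\<Sum>i<k. (x i)\<^sup>2)))
        \<le> (\<Sum>n. \<Sum>v\<in>G. ennreal (1 / ?q n) * indicator (Box n v) x)"
    proof (cases "hchart k p b x \<in> S")
      case True
      then obtain n v where nv: "v \<in> G" "x \<in> Box n v" "1 / sqrt (1 + (\<Sum>i<k. (x i)\<^sup>2)) \<le> 1 / ?q n"
        using cover[OF x] by blast
      have "ennreal (1 / sqrt (1 + (\<Sum>i<k. (x i)\<^sup>2))) \<le> ennreal (1 / ?q n) * indicator (Box n v) x"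
        using nv by (simp add: ennreal_leI)
      also have "\<dots> \<le> (\<Sum>v\<in>G. ennreal (1 / ?q n) * indicator (Box n v) x)"
        using nv G by (intro member_le_sum) auto
      also have "\<dots> \<le> (\<Sum>n. \<Sum>v\<in>G. ennreal (1 / ?q n) * indicator (Box n v) x)"
        using sum_le_suminf[of "\<lambda>n. \<Sum>v\<in>G. ennreal (1 / ?q n) * indicator (Box n v) x" "{n}"]
        by simp
      finally show ?thesis using True by simp
    qed simp
  qed
  also have "\<dots> = (\<Sum>n. \<integral>\<^sup>+ x. (\<Sum>v\<in>G. ennreal (1 / ?q n) * indicator (Box n v) x) \<partial>?M)"
    using Box_sets by (intro nn_integral_suminf) auto
  also have "\<dots> = (\<Sum>n. ennreal (real (card G) * (1 / ?q n * (2 * (A / ?q n)) ^ k)))"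
  proof (intro suminf_cong)
    fix n
    have "(\<integral>\<^sup>+ x. (\<Sum>v\<in>G. ennreal (1 / ?q n) * indicator (Box n v) x) \<partial>?M)
        = (\<Sum>v\<in>G. \<integral>\<^sup>+ x. ennreal (1 / ?q n) * indicator (Box n v) x \<partial>?M)"
      using Box_sets by (intro nn_integral_sum) auto
    also have "\<dots> = (\<Sum>v\<in>G. ennreal (1 / ?q n * (2 * (A / ?q n)) ^ k))"
      using Box_sets A0 by (intro sum.cong refl) (simp add: nn_integral_cmult_indicator Box_vol ennreal_mult'[symmetric])
    also have "\<dots> = ennreal (real (card G) * (1 / ?q n * (2 * (A / ?q n)) ^ k))"
      unfolding sum_constant ennreal_of_nat_eq_real_of_nat using A0
      by (intro ennreal_mult[symmetric]) auto
    finally show "(\<integral>\<^sup>+ x. (\<Sum>v\<in>G. ennreal (1 / ?q n) * indicator (Box n v) x) \<partial>?M)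
        = ennreal (real (card G) * (1 / ?q n * (2 * (A / ?q n)) ^ k))" .
  qed
  finally have le: "(\<integral>\<^sup>+ x. indicator {x. hchart k p b x \<in> S} x * ennreal (1 / sqrt (1 + (\<Sum>i<k. (x i)\<^sup>2))) \<partial>?M)
      \<le> (\<Sum>n. ennreal (real (card G) * (1 / ?q n * (2 * (A / ?q n)) ^ k)))" .
  have "(\<Sum>n. ennreal (real (card G) * (1 / ?q n * (2 * (A / ?q n)) ^ k))) \<noteq> top"
  proof (rule ennreal_suminf_neq_top)
    \<comment> \<open>The n-th term is a constant times \<open>(1 / ?q n) ^ (k + 1)\<close>, and k +
      1 is at least 3.\<close>
    have "summable (\<lambda>n. real (Suc n) powr (- 3 / 2))"
      using summable_real_powr_iff[of "- 3 / 2"] by (subst summable_Suc_iff) simp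
    then have "summable (\<lambda>n. real (card G) * (2 * A) ^ k * real (Suc n) powr (- 3 / 2))"
      by (rule summable_mult)
    then show "summable (\<lambda>n. real (card G) * (1 / ?q n * (2 * (A / ?q n)) ^ k))"
    proof (rule summable_comparison_test'[where N = 0])
      fix n :: nat
      have q1: "0 < ?q n" "1 / ?q n \<le> 1" "0 \<le> 1 / ?q n" by simp_all
      have "(1 / ?q n) ^ 3 = real (Suc n) powr (- 3 / 2)"
      proof -
        have "1 / ?q n = real (Suc n) powr (- 1 / 2)"
          by (simp add: powr_minus_divide powr_half_sqrt)
        then have "(1 / ?q n) ^ 3 = real (Suc n) powr (- 1 / 2 * 3)"
          by (simp add: powr_power del: of_nat_Suc)
        then show ?thesis by simp
      qed
      then have "(1 / ?q n) ^ (k + 1) \<le> real (Suc n) powr (- 3 / 2)"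
        using power_decreasing[of 3 "k + 1" "1 / ?q n"] q1 k by simp
      then have "real (card G) * (2 * A) ^ k * (1 / ?q n) ^ (k + 1)
          \<le> real (card G) * (2 * A) ^ k * real (Suc n) powr (- 3 / 2)"
        using A0 by (intro mult_left_mono) auto
      moreover have "real (card G) * (1 / ?q n * (2 * (A / ?q n)) ^ k)
          = real (card G) * (2 * A) ^ k * (1 / ?q n) ^ (k + 1)"
        by (simp add: power_mult_distrib power_divide)
      moreover have "real (card G) * (1 / ?q n * (2 * (A / ?q n)) ^ k) \<ge> 0" using A0 by simp
      ultimately show "norm (real (card G) * (1 / ?q n * (2 * (A / ?q n)) ^ k))
          \<le> real (card G) * (2 * A) ^ k * real (Suc n) powr (- 3 / 2)"
        by (metis abs_of_nonneg real_norm_def)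
    qed
  qed (use A0 in simp)
  with le have "(\<integral>\<^sup>+ x. indicator {x. hchart k p b x \<in> S} x * ennreal (1 / sqrt (1 + (\<Sum>i<k. (x i)\<^sup>2))) \<partial>?M) < \<infinity>"
    by (simp add: less_top[symmetric] neq_top_trans)
  then show ?thesis using lb unfolding finite_hvolume_def Let_def V(2) add_diff_cancel_right' by blast
qed

section \<open>Faces of hyperbolic polytopes\<close>

locale polytope_face =
  fixes E :: "('n::finite) lvec set" and F :: "'n lvec set" and k :: nat
  assumes polytope: "convex_polytope UNIV E" and face: "is_face E F k" and k: "2 \<le> k"
begin

text \<open>The set S that cuts out F in \<open>is_face\<close> is not determined by F. T is the
  largest possible choice, and it cuts out the same F.\<close>

definition T where "T = {e \<in> E. F \<subseteq> hplane UNIV e}"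

abbreviation V where "V \<equiv> span F"
abbreviation A where "A \<equiv> adjacent_facets E F"
abbreviation N where "N \<equiv> face_normals E F"
abbreviation pr where "pr \<equiv> lproj V"

lemma finite_E: "finite E" and unit_E: "e \<in> E \<Longrightarrow> lf e e = 1"
  using polytope by (auto simp: convex_polytope_def)

lemma T_subset: "T \<subseteq> E"
  by (auto simp: T_def)

lemma F_nonempty: "F \<noteq> {}" and dim_V: "dim V = k + 1"
  using face by (auto simp: is_face_def)

lemma mem_F_iff: "x \<in> F \<longleftrightarrow> x \<in> hyp \<and> (\<forall>e\<in>E. lf x e \<le> 0) \<and> (\<forall>t\<in>T. lf x t = 0)"
proof -
  obtain S where S: "S \<subseteq> E" "F = Defs.poly UNIV E \<inter> (\<Inter>e\<in>S. hplane UNIV e)"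
    using face by (auto simp: is_face_def)
  have ST: "S \<subseteq> T" unfolding T_def using S(1) by (subst S(2)) auto
  have "x \<in> F \<longleftrightarrow> x \<in> hyp \<and> (\<forall>e\<in>E. lf x e \<le> 0) \<and> (\<forall>e\<in>S. lf x e = 0)"
    by (subst S(2)) (auto simp: poly_def hspace_def hypV_def hplane_def)
  moreover have "lf x t = 0" if "x \<in> F" "t \<in> T" for t using that by (auto simp: T_def hplane_def)
  ultimately show ?thesis using ST by blast
qed

lemma F_subset_hyp: "F \<subseteq> hyp"
  using mem_F_iff by blast

lemma hnormalize_add_F:
  assumes "x \<in> F" "y \<in> F" shows "hnormalize (x + y) \<in> F"
proof -
  have xy: "x \<in> hyp" "y \<in> hyp" using assms F_subset_hyp by auto
  have "lf (x + y) (x + y) < 0" "hnormalize (x + y) \<in> hyp"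
    using hyp_combination(1)[OF xy, of 1 1] hnormalize_combination[OF xy, of 1 1] by simp_all
  then show ?thesis
    using assms by (simp add: mem_F_iff hnormalize_sign) (simp add: lf_linear add_nonpos_nonpos)
qed

text \<open>Each e outside T is negative at some point of F, and normalised sums of points of F stay
  in F.\<close>

lemma relative_interior_point:
  obtains p where "p \<in> F" "\<And>e. e \<in> E - T \<Longrightarrow> lf p e < 0"
proof -
  have "\<exists>x\<in>F. \<forall>e\<in>E - T. lf x e < 0"
  proof (rule strict_point_exists)
    fix e assume e: "e \<in> E - T"
    then obtain x where "x \<in> F" "x \<notin> hplane UNIV e" by (auto simp: T_def)
    moreover from this have "lf x e \<noteq> 0" "lf x e \<le> 0"
      using e mem_F_iff[of x] by (simp_all add: hplane_def hypV_def)
    ultimately show "\<exists>x\<in>F. lf x e < 0" by (intro bexI[of _ x]) auto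
  qed (use finite_E F_subset_hyp F_nonempty hnormalize_add_F mem_F_iff in auto)
  then show ?thesis using that by blast
qed

text \<open>From a relative interior point p one can take a small step in any direction x orthogonal
  to T and stay, up to normalisation, in F. Thus x is a multiple of a difference of two vectors of
  V.\<close>

lemma V_eq: "V = {x. \<forall>t\<in>T. lf x t = 0}"
proof
  have "subspace {x. \<forall>t\<in>T. lf x t = 0}" by (auto simp: subspace_def lf_linear)
  then show "V \<subseteq> {x. \<forall>t\<in>T. lf x t = 0}" using mem_F_iff by (intro span_minimal) auto
next
  obtain p where p: "p \<in> F" "\<And>e. e \<in> E - T \<Longrightarrow> lf p e < 0" using relative_interior_point by blast
  show "{x. \<forall>t\<in>T. lf x t = 0} \<subseteq> V"
  proof
    fix x assume x: "x \<in> {x. \<forall>t\<in>T. lf x t = 0}"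
    have sgn: "lf p e < 0 \<or> lf p e = 0 \<and> lf x e \<le> 0" if "e \<in> E" for e
      using p x that mem_F_iff by (cases "e \<in> T") auto
    have ph: "p \<in> hyp" using p F_subset_hyp by blast
    obtain \<epsilon> where \<epsilon>: "\<epsilon> > 0" "hnormalize (p + \<epsilon> *\<^sub>R x) \<in> hyp" "lf (p + \<epsilon> *\<^sub>R x) (p + \<epsilon> *\<^sub>R x) < 0"
      "\<And>e. e \<in> E \<Longrightarrow> lf (p + \<epsilon> *\<^sub>R x) e \<le> 0"
      using perturb_in_cone[OF finite_E ph sgn] by blast
    have "lf (p + \<epsilon> *\<^sub>R x) t = 0" if "t \<in> T" for t
      using that p x mem_F_iff by (simp add: lf_linear)
    then have "hnormalize (p + \<epsilon> *\<^sub>R x) \<in> F"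
      using \<epsilon> by (simp add: mem_F_iff hnormalize_sign)
    then have "sqrt (- lf (p + \<epsilon> *\<^sub>R x) (p + \<epsilon> *\<^sub>R x)) *\<^sub>R hnormalize (p + \<epsilon> *\<^sub>R x) \<in> V"
      by (intro span_scale span_base)
    then have "p + \<epsilon> *\<^sub>R x \<in> V" using \<epsilon>(3) by (simp add: hnormalize_def)
    then have "(1 / \<epsilon>) *\<^sub>R (p + \<epsilon> *\<^sub>R x - p) \<in> V"
      using p by (intro span_scale span_diff) (auto intro: span_base)
    then show "x \<in> V" using \<epsilon>(1) by simp
  qed
qed

lemma mem_F_iff_E: "x \<in> F \<longleftrightarrow> x \<in> hypV V \<and> (\<forall>e\<in>E - T. lf x e \<le> 0)"
proof -
  have "x \<in> V \<longleftrightarrow> (\<forall>t\<in>T. lf x t = 0)" using V_eq by blast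
  then show ?thesis unfolding mem_F_iff hypV_def using T_subset by force
qed

lemma A_subset: "A \<subseteq> E - T"
  by (auto simp: adjacent_facets_def T_def)

text \<open>In a minimal system M of inequalities describing F, every e in M is adjacent: a point
  violating only e is joined to a relative interior point by a segment crossing the hyperplane of e
  at a point where all other inequalities are strict.\<close>
lemma mem_F_iff_A: "x \<in> F \<longleftrightarrow> x \<in> hypV V \<and> (\<forall>e\<in>A. lf x e \<le> 0)"
proof -
  define region where "region M = {x \<in> hypV V. \<forall>e\<in>M. lf x e \<le> 0}" for M
  let ?P = "\<lambda>M. M \<subseteq> E - T \<and> region M = F"
  have "?P (E - T)" using mem_F_iff_E unfolding region_def by blast
  then obtain M where M: "M \<subseteq> E - T" "region M = F"
    and min: "\<And>M'. ?P M' \<Longrightarrow> card M \<le> card M'"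
    using ex_has_least_nat[of ?P "E - T" card] by blast
  have memM: "x \<in> F \<longleftrightarrow> x \<in> hypV V \<and> (\<forall>e\<in>M. lf x e \<le> 0)" for x
    using M(2) unfolding region_def by blast
  have finM: "finite M" using M finite_E by (meson finite_Diff finite_subset)
  obtain p where p: "p \<in> F" "\<And>e. e \<in> E - T \<Longrightarrow> lf p e < 0" using relative_interior_point by blast
  have pV: "p \<in> V" and ph: "p \<in> hyp" using p F_subset_hyp by (auto intro: span_base)
  have "M \<subseteq> A"
  proof
    fix e assume e: "e \<in> M"
    have "card (M - {e}) < card M" by (rule card_Diff1_less[OF finM e])
    then have "region (M - {e}) \<noteq> F" using min[of "M - {e}"] M by fastforce
    moreover have "F \<subseteq> region (M - {e})" using M(2) unfolding region_def by blast
    ultimately obtain x where x: "x \<in> region (M - {e})" "x \<notin> F" by blast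
    have xh: "x \<in> hyp" and xV: "x \<in> V" using x by (auto simp: region_def hypV_def)
    have xe: "lf x e > 0"
    proof (rule ccontr)
      assume "\<not> lf x e > 0"
      then have "x \<in> region M" using x(1) by (auto simp: region_def)
      then show False using x M by simp
    qed
    have pe: "lf p e < 0" using p e M by blast
    define t where "t = - lf p e / lf x e"
    have t: "t > 0" using xe pe by (simp add: t_def divide_neg_pos)
    define q0 where "q0 = t *\<^sub>R x + 1 *\<^sub>R p"
    define q where "q = hnormalize q0"
    have q0: "lf q0 q0 < 0" unfolding q0_def using xh ph t by (intro hyp_combination) auto
    have qh: "q \<in> hyp" unfolding q_def q0_def using xh ph t by (intro hnormalize_combination) auto
    have qV: "q \<in> V" unfolding q_def q0_def hnormalize_def using xV pV by (intro span_scale span_add)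
    have "lf q0 e = 0" using xe by (simp add: q0_def t_def lf_linear)
    then have qe: "lf q e = 0" using q0 by (simp add: q_def hnormalize_sign)
    have qf: "lf q f < 0" if f: "f \<in> M" "f \<noteq> e" for f
    proof -
      have "lf x f \<le> 0" using x f by (auto simp: region_def)
      then have "t * lf x f \<le> 0" using t by (simp add: mult_nonneg_nonpos)
      moreover have "lf p f < 0" using p f M by blast
      ultimately have "lf q0 f < 0" by (simp add: q0_def lf_linear)
      then show ?thesis using q0 by (simp add: q_def hnormalize_sign)
    qed
    have qF: "q \<in> F"
      unfolding memM using qh qV qe qf by (simp add: hypV_def) (metis less_eq_real_def)
    let ?W = "{x \<in> V. lf x e = 0}"
    have sp: "span (F \<inter> hplane UNIV e) = ?W"
    proof
      have "subspace ?W" using subspace_span[of F] by (auto simp: subspace_def lf_linear)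
      moreover have "F \<inter> hplane UNIV e \<subseteq> ?W" by (auto simp: hplane_def intro: span_base)
      ultimately show "span (F \<inter> hplane UNIV e) \<subseteq> ?W" by (simp add: span_minimal)
    next
      show "?W \<subseteq> span (F \<inter> hplane UNIV e)"
      proof
        fix y assume y: "y \<in> ?W"
        have sgn: "lf q f < 0 \<or> lf q f = 0 \<and> lf y f \<le> 0" if "f \<in> M" for f
          using qe qf[OF that] y by (cases "f = e") auto
        obtain \<epsilon> where \<epsilon>: "\<epsilon> > 0" "hnormalize (q + \<epsilon> *\<^sub>R y) \<in> hyp" "lf (q + \<epsilon> *\<^sub>R y) (q + \<epsilon> *\<^sub>R y) < 0"
          "\<And>e. e \<in> M \<Longrightarrow> lf (q + \<epsilon> *\<^sub>R y) e \<le> 0"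
          using perturb_in_cone[OF finM qh sgn] by blast
        let ?z = "hnormalize (q + \<epsilon> *\<^sub>R y)"
        have "?z \<in> V" unfolding hnormalize_def using qV y by (intro span_scale span_add) auto
        then have "?z \<in> F"
          unfolding memM using \<epsilon> by (simp add: hypV_def hnormalize_sign)
        moreover have "lf ?z e = 0" using \<epsilon>(3) qe y by (simp add: hnormalize_sign) (simp add: lf_linear)
        ultimately have "?z \<in> F \<inter> hplane UNIV e" using \<epsilon> by (auto simp: hplane_def hypV_def)
        then have "sqrt (- lf (q + \<epsilon> *\<^sub>R y) (q + \<epsilon> *\<^sub>R y)) *\<^sub>R ?z \<in> span (F \<inter> hplane UNIV e)"
          by (intro span_scale span_base)
        then have "q + \<epsilon> *\<^sub>R y \<in> span (F \<inter> hplane UNIV e)" using \<epsilon>(3) by (simp add: hnormalize_def)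
        moreover have "q \<in> span (F \<inter> hplane UNIV e)"
          using qF qh qe by (intro span_base) (auto simp: hplane_def hypV_def)
        ultimately have "(1 / \<epsilon>) *\<^sub>R (q + \<epsilon> *\<^sub>R y - q) \<in> span (F \<inter> hplane UNIV e)"
          by (intro span_scale span_diff)
        then show "y \<in> span (F \<inter> hplane UNIV e)" using \<epsilon>(1) by simp
      qed
    qed
    have "dim (span (F \<inter> hplane UNIV e)) + 1 = dim V"
      unfolding sp using pe by (intro dim_lf_hyperplane[of V p]) (auto simp: pV)
    moreover have "\<not> F \<subseteq> hplane UNIV e" using p(1) pe by (auto simp: hplane_def)
    ultimately show "e \<in> A" using e M(1) unfolding adjacent_facets_def by blast
  qed
  then show ?thesis using M(2) mem_F_iff_E A_subset unfolding region_def by blast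
qed

lemma span_facet:
  assumes "e \<in> A"
  shows "span (F \<inter> hplane UNIV e) = {x \<in> V. lf x e = 0}"
proof -
  obtain p where p: "p \<in> F" "\<And>e. e \<in> E - T \<Longrightarrow> lf p e < 0" using relative_interior_point by blast
  let ?W = "{x \<in> V. lf x e = 0}"
  have W: "subspace ?W" using subspace_span[of F] by (auto simp: subspace_def lf_linear)
  have "F \<inter> hplane UNIV e \<subseteq> ?W" by (auto simp: hplane_def intro: span_base)
  then have "span (F \<inter> hplane UNIV e) \<subseteq> ?W" using W by (simp add: span_minimal)
  moreover have "lf p e \<noteq> 0" using p(2)[of e] assms A_subset by auto
  then have "dim ?W + 1 = dim V"
    by (intro dim_lf_hyperplane[of V p]) (auto simp: p(1) intro: span_base)
  then have "dim ?W \<le> dim (span (F \<inter> hplane UNIV e))"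
    using assms by (simp add: adjacent_facets_def)
  ultimately show ?thesis using W by (intro subspace_dim_equal) auto
qed

text \<open>The empty set spans dimension 0, so an adjacent facet without points would force
  \<open>dim V = 1\<close>, whereas \<open>dim V\<close> is at least 3.\<close>

lemma facet_nonempty:
  assumes "e \<in> A" shows "\<exists>q\<in>F. lf q e = 0"
proof (rule ccontr)
  assume "\<not> ?thesis"
  then have empty: "F \<inter> hplane UNIV e = {}" by (auto simp: hplane_def)
  have "dim (span (F \<inter> hplane UNIV e)) + 1 = dim V"
    using assms unfolding adjacent_facets_def by blast
  then show False using dim_V k unfolding empty by (simp del: dim_eq_0)
qed

text \<open>T is orthogonal to the time-like points of F. Positivity on its span is what
  Gram-Schmidt over T requires.\<close>

lemma span_T_positive:
  assumes "x \<in> span T" "x \<noteq> 0" shows "lf x x > 0"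
proof -
  obtain p where p: "p \<in> F" using F_nonempty by blast
  have "lf y p = 0" if "y \<in> span T" for y
    using that
  proof (induction rule: span_induct_alt)
    case (step c x y)
    then have "lf x p = 0" using p mem_F_iff lf_sym[of x p] by auto
    then show ?case using step by (simp add: lf_linear)
  qed (simp add: lf_linear)
  then show ?thesis using assms lf_pos_of_orthogonal[of p x] p F_subset_hyp hypD(1)[of p] by auto
qed

text \<open>The scaling c allows coefficient fields smaller than the one generated by the Gram matrix.\<close>
lemma lproj_expansion:
  assumes K: "is_subfield K" and nz: "\<And>t. t \<in> T \<Longrightarrow> c t \<noteq> 0"
    and KT: "\<And>s t. s \<in> T \<Longrightarrow> t \<in> T \<Longrightarrow> c s * c t * lf s t \<in> K"
    and Ke: "\<And>t. t \<in> T \<Longrightarrow> c t * lf e t \<in> K"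
  obtains a where "\<And>t. t \<in> T \<Longrightarrow> a t \<in> K" "pr e = e - (\<Sum>t\<in>T. (a t * c t) *\<^sub>R t)"
proof -
  have finT: "finite T" using T_subset finite_E finite_subset by blast
  let ?v = "\<lambda>t. c t *\<^sub>R t"
  have sp: "span (?v ` T) \<subseteq> span T"
    by (intro span_minimal image_subsetI span_scale span_base subspace_span)
  have "\<exists>a. (\<forall>s\<in>T. a s \<in> K) \<and> (\<forall>t\<in>T. lf (e - (\<Sum>s\<in>T. a s *\<^sub>R ?v s)) (?v t) = 0)"
    using sp span_T_positive KT Ke
    by (intro gram_schmidt_over_field[OF K finT]) (auto simp: lf_linear mult_ac)
  then obtain a where a: "\<forall>t\<in>T. a t \<in> K" "\<forall>t\<in>T. lf (e - (\<Sum>s\<in>T. a s *\<^sub>R ?v s)) (?v t) = 0"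
    by blast
  let ?w = "\<Sum>t\<in>T. (a t * c t) *\<^sub>R t"
  have orth: "\<forall>t\<in>T. lf (e - ?w) t = 0" using a(2) nz by (auto simp: lf_scaleR_right)
  obtain p where p: "p \<in> F" using F_nonempty by blast
  have "pr e = e - ?w"
  proof (rule lproj_eqI[of V p])
    show "lf p p < 0" using p F_subset_hyp hypD(1)[of p] by auto
    show "e - ?w \<in> V" using orth V_eq by auto
    fix w assume "w \<in> V"
    then have "lf t w = 0" if "t \<in> T" for t using that V_eq lf_sym[of t w] by auto
    then show "lf (e - (e - ?w)) w = 0" by (simp add: lf_sum_left lf_linear)
  qed (use p in \<open>auto intro: span_base\<close>)
  then show ?thesis using that a by blast
qed

text \<open>The description operator in \<open>lproj\<close> says something only once a projection
  exists; Gram-Schmidt over the field of all reals supplies it.\<close>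

lemma lproj_in_V: "pr e \<in> V" and lf_lproj: "w \<in> V \<Longrightarrow> lf (pr e) w = lf e w"
proof -
  have T0: "lf t w = 0" if "t \<in> T" "w \<in> V" for t w
    using that V_eq lf_sym[of t w] by auto
  have sf: "is_subfield (UNIV :: real set)" by (simp add: is_subfield_def)
  have "\<exists>b. (\<forall>s\<in>T. b s \<in> (UNIV :: real set)) \<and> (\<forall>t\<in>T. lf (e - (\<Sum>s\<in>T. b s *\<^sub>R s)) t = 0)"
    using gram_schmidt_over_field[OF sf, of T "\<lambda>x. x" e] span_T_positive T_subset finite_E finite_subset[of T E]
    by simp
  then obtain b where "\<forall>t\<in>T. lf (e - (\<Sum>s\<in>T. b s *\<^sub>R s)) t = 0" by blast
  then have bV: "e - (\<Sum>s\<in>T. b s *\<^sub>R s) \<in> V" using V_eq by auto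
  obtain p where p: "p \<in> F" using F_nonempty by blast
  have "pr e = e - (\<Sum>s\<in>T. b s *\<^sub>R s)"
  proof (rule lproj_eqI[OF subspace_span span_base[OF p] _ bV])
    show "lf p p < 0" using p F_subset_hyp hypD(1)[of p] by auto
    show "lf (e - (e - (\<Sum>s\<in>T. b s *\<^sub>R s))) w = 0" if "w \<in> V" for w
      using T0[OF _ that] by (simp add: lf_sum_left lf_linear)
  qed
  then show "pr e \<in> V" "w \<in> V \<Longrightarrow> lf (pr e) w = lf e w"
    using bV T0 by (simp_all add: lf_linear lf_sum_left)
qed

text \<open>The facet has a point q in hyperbolic space, and \<open>pr e\<close> is orthogonal to
  this time-like vector; it is nonzero because it is negative at a relative interior point. This
  makes \<open>unitize\<close> meaningful.\<close>

lemma lf_lproj_lproj_pos: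
  assumes "e \<in> A" shows "lf (pr e) (pr e) > 0"
proof -
  obtain q where q: "q \<in> F" "lf q e = 0" using facet_nonempty[OF assms] by blast
  obtain p where p: "p \<in> F" "\<And>e. e \<in> E - T \<Longrightarrow> lf p e < 0" using relative_interior_point by blast
  have "lf (pr e) p < 0"
    using lf_lproj[OF span_base[OF p(1)], of e] lf_sym[of e p] p(2)[of e] assms A_subset by auto
  then have "pr e \<noteq> 0" by (auto simp: lf_linear)
  moreover have "lf (pr e) q = 0" using lf_lproj[OF span_base[OF q(1)], of e] lf_sym[of e q] q by simp
  moreover have "lf q q < 0" using q F_subset_hyp hypD(1)[of q] by auto
  ultimately show ?thesis using lf_pos_of_orthogonal by blast
qed

lemma face_normal_props:
  assumes "e \<in> A"
  shows "unitize (pr e) \<in> V" "lf (unitize (pr e)) (unitize (pr e)) = 1"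
    "\<And>w. w \<in> V \<Longrightarrow> lf w (unitize (pr e)) = lf w e / sqrt (lf (pr e) (pr e))"
proof -
  show "unitize (pr e) \<in> V" unfolding unitize_def using lproj_in_V by (rule span_scale)
  show "lf (unitize (pr e)) (unitize (pr e)) = 1"
    using lf_lproj_lproj_pos[OF assms] by (simp add: unitize_def lf_linear)
  show "lf w (unitize (pr e)) = lf w e / sqrt (lf (pr e) (pr e))" if "w \<in> V" for w
    using lf_lproj[OF that, of e] lf_sym[of w "pr e"] lf_sym[of w e] by (simp add: unitize_def lf_linear)
qed

lemma face_normalE:
  assumes "u \<in> N" obtains e where "e \<in> A" "u = unitize (pr e)"
  using assms unfolding face_normals_def by blast

lemma lf_face_normal_sign:
  assumes "e \<in> A" "w \<in> V"
  shows "lf w (unitize (pr e)) \<le> 0 \<longleftrightarrow> lf w e \<le> 0" "lf w (unitize (pr e)) < 0 \<longleftrightarrow> lf w e < 0"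
    "lf w (unitize (pr e)) = 0 \<longleftrightarrow> lf w e = 0"
  using lf_lproj_lproj_pos[OF assms(1)]
  by (auto simp: face_normal_props(3)[OF assms] divide_le_0_iff divide_less_0_iff)

lemma poly_face_normals: "Defs.poly V N = F"
proof -
  have "x \<in> Defs.poly V N \<longleftrightarrow> x \<in> F" for x
  proof -
    have "x \<in> Defs.poly V N \<longleftrightarrow> x \<in> hypV V \<and> (\<forall>e\<in>A. lf x (unitize (pr e)) \<le> 0)"
      by (auto simp: poly_def hspace_def face_normals_def)
    also have "\<dots> \<longleftrightarrow> x \<in> hypV V \<and> (\<forall>e\<in>A. lf x e \<le> 0)"
      by (simp add: hypV_def lf_face_normal_sign(1) cong: conj_cong)
    also have "\<dots> \<longleftrightarrow> x \<in> F" by (rule mem_F_iff_A[symmetric])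
    finally show ?thesis .
  qed
  then show ?thesis by blast
qed

lemma finite_N: "finite N"
  unfolding face_normals_def using A_subset finite_E by (meson finite_Diff finite_imageI finite_subset)

lemma face_relative_interior_point:
  obtains p where "p \<in> hypV V" "p \<in> F" "\<And>u. u \<in> N \<Longrightarrow> lf p u < 0"
proof -
  obtain p where p: "p \<in> F" "\<And>e. e \<in> E - T \<Longrightarrow> lf p e < 0" using relative_interior_point by blast
  have pV: "p \<in> V" using p by (auto intro: span_base)
  have "lf p u < 0" if u: "u \<in> N" for u
  proof -
    obtain e where e: "e \<in> A" "u = unitize (pr e)" using face_normalE[OF u] .
    then show ?thesis using p(2)[of e] A_subset lf_face_normal_sign(2)[OF e(1) pV] by auto
  qed
  then show ?thesis using that[of p] p(1) pV F_subset_hyp unfolding hypV_def by blast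
qed

text \<open>A point of the facet of u at which all other inequalities are strict can be pushed
  across along u. It exists unless some other v vanishes on the whole facet; then v would be
  proportional to u, hence v = -u, although both are negative at p.\<close>

lemma face_normals_irredundant:
  assumes u: "u \<in> N" shows "Defs.poly V (N - {u}) \<noteq> Defs.poly V N"
proof -
  obtain e where e: "e \<in> A" "u = unitize (pr e)" using face_normalE[OF u] .
  have uV: "u \<in> V" and uu: "lf u u = 1" using face_normal_props[OF e(1)] e(2) by auto
  obtain p where p: "p \<in> hypV V" "p \<in> F" "\<And>u. u \<in> N \<Longrightarrow> lf p u < 0"
    using face_relative_interior_point by blast
  let ?X = "{x \<in> F. lf x u = 0}"
  have XX: "x \<in> ?X \<longleftrightarrow> x \<in> F \<inter> hplane UNIV e" for x
    using lf_face_normal_sign(3)[OF e(1), of x] e(2) F_subset_hyp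
    by (auto simp: hplane_def hypV_def intro: span_base)
  have XF: "lf x v \<le> 0" if "x \<in> ?X" "v \<in> N" for x v
    using that poly_face_normals by (auto simp: poly_def hspace_def)
  have ne: "?X \<noteq> {}" using facet_nonempty[OF e(1)] XX F_subset_hyp by (fastforce simp: hplane_def hypV_def)
  have "\<exists>x\<in>?X. \<forall>v\<in>N - {u}. lf x v < 0"
  proof (rule strict_point_exists)
    show "finite (N - {u})" using finite_N by simp
    show "?X \<subseteq> hyp" using F_subset_hyp by auto
    show "?X \<noteq> {}" by (rule ne)
    show "hnormalize (x + y) \<in> ?X" if "x \<in> ?X" "y \<in> ?X" for x y
      using that hnormalize_add_F by (auto simp: lf_hnormalize lf_linear)
    show "lf x v \<le> 0" if "x \<in> ?X" "v \<in> N - {u}" for x v using XF that by blast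
    show "\<exists>x\<in>?X. lf x v < 0" if v: "v \<in> N - {u}" for v
    proof (rule ccontr)
      assume "\<not> ?thesis"
      then have nlt: "\<not> lf x v < 0" if "x \<in> ?X" for x using that by blast
      have X0: "lf x v = 0" if "x \<in> ?X" for x
        using XF[OF that, of v] nlt[OF that] v by simp
      obtain f where f: "f \<in> A" "v = unitize (pr f)" using face_normalE v by blast
      have vV: "v \<in> V" and vv: "lf v v = 1" using face_normal_props[OF f(1)] f(2) by auto
      have W0: "lf y v = 0" if "y \<in> V" "lf y u = 0" for y
      proof -
        have "lf y e = 0" using lf_face_normal_sign(3)[OF e(1) that(1)] e(2) that(2) by simp
        then have "y \<in> span (F \<inter> hplane UNIV e)" using span_facet[OF e(1)] that by auto
        then show ?thesis
        proof (induction rule: span_induct_alt)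
          case (step c x y)
          then show ?case using X0[of x] XX[of x] by (simp add: lf_linear)
        qed (simp add: lf_linear)
      qed
      \<comment> \<open>The part of v orthogonal to u. It lies in the span of the facet, where v
        vanishes, so \<open>lf y y = lf y v = 0\<close>; as it is also orthogonal to the time-like
        q, it is zero.\<close>
      define y where "y = v - lf v u *\<^sub>R u"
      have yV: "y \<in> V" unfolding y_def using vV uV by (intro span_diff span_scale)
      have yu: "lf y u = 0" using uu by (simp add: y_def lf_linear)
      have yv: "lf y v = 0" using W0[OF yV yu] .
      have yy: "lf y y = 0"
        using yu yv by (subst (2) y_def) (simp add: lf_linear)
      obtain q where q: "q \<in> ?X" using ne by blast
      have "lf q y = 0" using X0[OF q] q by (simp add: y_def lf_linear)
      then have "y = 0"
        using lf_pos_of_orthogonal[of q y] yy lf_sym[of q y] q F_subset_hyp hypD(1)[of q] by fastforce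
      then have vu: "v = lf v u *\<^sub>R u" by (simp add: y_def)
      have "lf v v = lf v u * (lf v u)" using yv vv by (simp add: y_def lf_linear lf_sym[of u v])
      then have "lf v u = 1 \<or> lf v u = -1" using vv square_eq_1_iff[of "lf v u"] by auto
      then have "v = u \<or> v = - u" using vu by (metis scaleR_minus1_left scaleR_one)
      then have "v = - u" using v by auto
      then show False using p(3)[OF u] p(3)[of v] v by (simp add: lf_linear)
    qed
  qed
  then obtain q where q: "q \<in> F" "lf q u = 0" "\<And>v. v \<in> N - {u} \<Longrightarrow> lf q v < 0" by blast
  have qh: "q \<in> hyp" and qV: "q \<in> V" using q F_subset_hyp by (auto intro: span_base)
  obtain \<epsilon> where \<epsilon>: "\<epsilon> > 0" "hnormalize (q + \<epsilon> *\<^sub>R u) \<in> hyp" "lf (q + \<epsilon> *\<^sub>R u) (q + \<epsilon> *\<^sub>R u) < 0"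
    "\<And>v. v \<in> N - {u} \<Longrightarrow> lf (q + \<epsilon> *\<^sub>R u) v \<le> 0"
    using perturb_in_cone[of "N - {u}" q u] finite_N qh q(3) by (metis finite_Diff)
  let ?z = "hnormalize (q + \<epsilon> *\<^sub>R u)"
  have "?z \<in> V" unfolding hnormalize_def using qV uV by (intro span_scale span_add)
  then have "?z \<in> Defs.poly V (N - {u})"
    using \<epsilon> by (auto simp: poly_def hspace_def hypV_def hnormalize_sign)
  moreover have "lf (q + \<epsilon> *\<^sub>R u) u > 0" using q(2) uu \<epsilon>(1) by (simp add: lf_linear)
  then have "\<not> lf ?z u \<le> 0" using \<epsilon>(3) by (simp add: hnormalize_sign)
  then have "?z \<notin> Defs.poly V N" using u by (auto simp: poly_def hspace_def)
  ultimately show ?thesis by blast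
qed

lemma convex_polytope_face: "convex_polytope V N"
proof -
  obtain p where p: "p \<in> hypV V" "p \<in> F" "\<And>u. u \<in> N \<Longrightarrow> lf p u < 0"
    using face_relative_interior_point by blast
  have "u \<in> V \<and> lf u u = 1" if "u \<in> N" for u
    using face_normalE[OF that] face_normal_props by metis
  moreover have "\<exists>x\<in>hypV V. \<forall>u\<in>N. lf x u < 0" using p by blast
  ultimately show ?thesis
    unfolding convex_polytope_def using finite_N face_normals_irredundant subspace_span by blast
qed

end

section \<open>Consequences of finite volume for a face\<close>

locale finite_volume_face = polytope_face E F k for E :: "('n::finite) lvec set" and F k +
  assumes vol: "finite_hvolume UNIV (Defs.poly UNIV E)" and dim_ge: "2 \<le> CARD('n)"
begin

lemma light_cone_E:
  assumes "\<And>e. e \<in> E \<Longrightarrow> lf x e \<le> 0" shows "lf x x \<le> 0"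
proof -
  obtain p where "p \<in> hypV UNIV" "\<forall>e\<in>E. lf p e < 0"
    using polytope by (auto simp: convex_polytope_def)
  moreover have "dim (UNIV :: 'n lvec set) \<ge> 3" using dim_ge by (simp add: dim_UNIV)
  ultimately show ?thesis
    using finite_hvolume_imp_light_cone[OF subspace_UNIV _ finite_E _ _ vol, of p x] assms by auto
qed

text \<open>The estimate is applied with the inequalities of E, not with those of N: they confine
  the whole ambient cone to the light cone, and the points of F satisfy them.\<close>

lemma finite_hvolume_face: "finite_hvolume V (Defs.poly V N)"
proof -
  obtain p where p: "p \<in> hypV V" using face_relative_interior_point by blast
  show ?thesis
    using finite_hvolume_of_light_cone[OF subspace_span dim_V k p finite_E light_cone_E, of F]
      mem_F_iff poly_face_normals by auto
qed

text \<open>A vector x of V orthogonal to N can be added to p without affecting any inequality. If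
  \<open>lf x p\<close> were nonzero, a multiple of x would move p to a vector y orthogonal to p but
  still in the cone, hence in the light cone; so y = 0, although y is strictly negative on N. Thus x
  is orthogonal to p and in the light cone itself, and vanishes.\<close>

lemma span_face_normals: "span N = V"
proof (rule span_eq_of_nondegenerate)
  show "subspace V" by (rule subspace_span)
  show NV: "N \<subseteq> V" using face_normalE face_normal_props(1) by (metis subsetI)
  obtain p where p: "p \<in> hypV V" "p \<in> F" "\<And>u. u \<in> N \<Longrightarrow> lf p u < 0"
    using face_relative_interior_point by blast
  have pV: "p \<in> V" and pp: "lf p p = -1" using p by (auto simp: hypV_def hyp_def)
  have cone: "lf y y \<le> 0" if "y \<in> V" "\<And>u. u \<in> N \<Longrightarrow> lf y u \<le> 0" for y
    using finite_hvolume_imp_light_cone[OF subspace_span _ finite_N p(1,3) finite_hvolume_face that] dim_V k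
    by simp
  \<comment> \<open>With no inequalities, all of V would lie in the light cone, including the
    nonzero vectors orthogonal to p.\<close>
  have Nne: "N \<noteq> {}"
  proof
    assume N0: "N = {}"
    have "dim {x \<in> V. lf x p = 0} + 1 = dim V" using pV pp by (intro dim_lf_hyperplane) auto
    then have "dim {x \<in> V. lf x p = 0} \<noteq> 0" using dim_V k by simp
    then have "\<not> {x \<in> V. lf x p = 0} \<subseteq> {0}" by (simp only: dim_eq_0) simp
    then obtain y where "y \<in> V" "lf y p = 0" "y \<noteq> 0" by blast
    then show False using lf_pos_of_orthogonal[of p y] pp cone[of y] N0 by simp
  qed
  fix x assume x: "x \<in> V" "\<And>u. u \<in> N \<Longrightarrow> lf x u = 0"
  have "lf x p = 0"
  proof (rule ccontr)
    assume xp: "lf x p \<noteq> 0"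
    define y where "y = p + (1 / lf x p) *\<^sub>R x"
    have yV: "y \<in> V" unfolding y_def using pV x by (intro span_add span_scale)
    have yu: "lf y u < 0" if "u \<in> N" for u using p(3)[OF that] x(2)[OF that] by (simp add: y_def lf_linear)
    have "lf y p = 0" using xp pp by (simp add: y_def lf_linear)
    then have "y = 0"
      using lf_pos_of_orthogonal[of p y] pp cone[OF yV] yu by (force intro: less_imp_le)
    then show False using Nne yu by (auto simp: lf_linear)
  qed
  then show "x = 0"
    using lf_pos_of_orthogonal[of p x] pp cone[OF x(1)] x(2) by force
qed

end

section \<open>Ground fields\<close>

lemma lf_combinations:
  "lf (\<Sum>i\<in>I. a i *\<^sub>R f i) (\<Sum>j\<in>J. b j *\<^sub>R g j) = (\<Sum>i\<in>I. \<Sum>j\<in>J. a i * b j * lf (f i) (g j))"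
proof -
  have "lf (\<Sum>i\<in>I. a i *\<^sub>R f i) (\<Sum>j\<in>J. b j *\<^sub>R g j) = (\<Sum>i\<in>I. a i * lf (f i) (\<Sum>j\<in>J. b j *\<^sub>R g j))"
    by (simp only: lf_sum_left lf_scaleR_left)
  then show ?thesis by (simp add: lf_sum_right lf_scaleR_right sum_distrib_left mult.assoc)
qed

text \<open>The open counterpart of the products in \<open>cyc\<close>: the last vertex is not
  joined to the first, so that walks can be concatenated and reversed.\<close>

fun walk_weight :: "('n::finite) lvec list \<Rightarrow> real" where
  "walk_weight (x # y # xs) = lf x y * walk_weight (y # xs)"
| "walk_weight _ = 1"

lemma walk_weight_Cons: "xs \<noteq> [] \<Longrightarrow> walk_weight (x # xs) = lf x (hd xs) * walk_weight xs"
  by (cases xs) auto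

lemma walk_weight_append:
  "xs \<noteq> [] \<Longrightarrow> ys \<noteq> [] \<Longrightarrow> walk_weight (xs @ ys) = walk_weight xs * lf (last xs) (hd ys) * walk_weight ys"
  by (induction xs rule: walk_weight.induct) (auto simp: walk_weight_Cons)

lemma walk_weight_rev: "walk_weight (rev xs) = walk_weight xs"
proof (induction xs)
  case (Cons x xs)
  then show ?case
    by (cases "xs = []") (auto simp: walk_weight_append walk_weight_Cons last_rev lf_sym[of "hd xs" x])
qed simp

lemma walk_weight_eq_prod: "walk_weight xs = (\<Prod>j<length xs - 1. lf (xs ! j) (xs ! Suc j))"
  by (induction xs rule: walk_weight.induct) (simp_all add: prod.lessThan_Suc_shift del: prod.lessThan_Suc)

lemma walk_weight_closed_in_cyc:
  assumes "xs \<noteq> []" "set xs \<subseteq> E" shows "walk_weight (xs @ [hd xs]) \<in> cyc E"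
proof -
  have "walk_weight (xs @ [hd xs]) = (\<Prod>j<length xs. lf (xs ! j) (xs ! (Suc j mod length xs)))"
    unfolding walk_weight_eq_prod
  proof (rule prod.cong)
    fix j assume "j \<in> {..<length xs}"
    then have j: "j < length xs" by simp
    show "lf ((xs @ [hd xs]) ! j) ((xs @ [hd xs]) ! Suc j) = lf (xs ! j) (xs ! (Suc j mod length xs))"
    proof (cases "Suc j = length xs")
      case True
      then show ?thesis using assms(1) by (simp add: nth_append hd_conv_nth)
    next
      case False
      then show ?thesis using j by (simp add: nth_append)
    qed
  qed simp
  then show ?thesis using assms unfolding cyc_def by blast
qed

lemma walk_weight_closed_in_ground_field:
  assumes "length zs \<ge> 2" "set zs \<subseteq> E" "hd zs = last zs"
  shows "walk_weight zs \<in> ground_field E"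
proof -
  obtain xs z where zs: "zs = xs @ [z]" using assms(1) by (cases zs rule: rev_cases) auto
  have ne: "xs \<noteq> []" using assms(1) zs by auto
  have z: "z = hd xs" using assms(3) zs ne by simp
  have "walk_weight (xs @ [hd xs]) \<in> cyc E"
    using assms(2) zs by (intro walk_weight_closed_in_cyc[OF ne]) auto
  then show ?thesis
    unfolding zs z ground_field_def using gen_field_superset by blast
qed

lemma gram_in_tilde_field: "e \<in> E \<Longrightarrow> f \<in> E \<Longrightarrow> lf e f \<in> tilde_field E"
  unfolding tilde_field_def
  by (rule subsetD[OF gen_field_superset], unfold gram_entries_def, blast)

lemma is_subfield_tilde_field: "is_subfield (tilde_field E)"
  and is_subfield_ground_field: "is_subfield (ground_field E)"
  unfolding tilde_field_def ground_field_def by (rule is_subfield_gen_field)+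

lemma ground_field_subset_tilde_field: "ground_field E \<subseteq> tilde_field E"
  unfolding ground_field_def
proof (rule gen_field_least[OF is_subfield_tilde_field])
  show "cyc E \<subseteq> tilde_field E"
  proof
    fix y assume "y \<in> cyc E"
    then obtain xs where xs: "xs \<noteq> []" "set xs \<subseteq> E"
      and y: "y = (\<Prod>j<length xs. lf (xs ! j) (xs ! (Suc j mod length xs)))"
      unfolding cyc_def by blast
    have "xs ! j \<in> E" if "j < length xs" for j using that xs(2) nth_mem by blast
    then show "y \<in> tilde_field E"
      unfolding y using xs(1) by (intro subfield_prod[OF is_subfield_tilde_field] gram_in_tilde_field) auto
  qed
qed

lemma walk_weight_in_tilde_field: "set xs \<subseteq> E \<Longrightarrow> walk_weight xs \<in> tilde_field E"
  by (induction xs rule: walk_weight.induct)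
     (auto intro!: subfield_mult is_subfield_tilde_field gram_in_tilde_field subfield_1)

text \<open>Rescaling each normal by the weight of a walk from a base point of its component turns all
  Gram entries into weights of closed walks.\<close>
lemma cyclic_gauge:
  fixes E :: "('n::finite) lvec set"
  obtains c where "\<And>a. a \<in> E \<Longrightarrow> c a \<noteq> 0" "\<And>a. a \<in> E \<Longrightarrow> c a \<in> tilde_field E"
    "\<And>a b. a \<in> E \<Longrightarrow> b \<in> E \<Longrightarrow> c a * c b * lf a b \<in> ground_field E"
proof -
  define W where "W a b xs \<longleftrightarrow> set xs \<subseteq> E \<and> xs \<noteq> [] \<and> hd xs = a \<and> last xs = b \<and> walk_weight xs \<noteq> 0" for a b xs
  define conn where "conn a b \<longleftrightarrow> (\<exists>xs. W a b xs)" for a b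
  have step: "conn r b" if ra: "conn r a" and b: "b \<in> E" "lf a b \<noteq> 0" for r a b
  proof -
    obtain xs where "W r a xs" using ra unfolding conn_def by blast
    then have "W r b (xs @ [b])" using b unfolding W_def by (auto simp: walk_weight_append)
    then show ?thesis unfolding conn_def by blast
  qed
  \<comment> \<open>\<open>SOME\<close> sees only the predicate, and \<open>conn r a\<close> is the
    same condition on r for all a of one component, so adjacent vertices receive the same base
    point.\<close>
  define root where "root a = (SOME r. conn r a)" for a
  define path where "path a = (SOME xs. W (root a) a xs)" for a
  have path: "W (root a) a (path a)" if "a \<in> E" for a
  proof -
    have "W a a [a]" using that by (simp add: W_def)
    then have "conn a a" unfolding conn_def by blast
    then have "conn (root a) a" unfolding root_def by (rule someI[of "\<lambda>r. conn r a"])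
    then show ?thesis unfolding path_def conn_def by (rule someI_ex)
  qed
  define c where "c a = walk_weight (path a)" for a
  have nz: "c a \<noteq> 0" if "a \<in> E" for a using path[OF that] by (simp add: c_def W_def)
  have tilde: "c a \<in> tilde_field E" if "a \<in> E" for a
    unfolding c_def using path[OF that] by (intro walk_weight_in_tilde_field) (simp add: W_def)
  have "c a * c b * lf a b \<in> ground_field E" if ab: "a \<in> E" "b \<in> E" for a b
  proof (cases "lf a b = 0")
    case True
    then show ?thesis using subfield_0[OF is_subfield_ground_field] by simp
  next
    case False
    then have "conn r a \<longleftrightarrow> conn r b" for r using step ab lf_sym[of a b] by metis
    then have root: "root a = root b" unfolding root_def by simp
    \<comment> \<open>From the base point to a, along the edge to b, and back along the path of b: a
      closed walk of weight \<open>c a * c b * lf a b\<close>.\<close>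
    let ?zs = "path a @ rev (path b)"
    have W: "set (path a) \<subseteq> E" "path a \<noteq> []" "hd (path a) = root a" "last (path a) = a"
      "set (path b) \<subseteq> E" "path b \<noteq> []" "hd (path b) = root a" "last (path b) = b"
      using path[OF ab(1)] path[OF ab(2)] root by (auto simp: W_def)
    have "length (path a) \<ge> 1" "length (path b) \<ge> 1" using W by (simp_all add: Suc_le_eq)
    then have "length ?zs \<ge> 2" by simp
    moreover have "hd ?zs = last ?zs" using W by (simp add: last_rev)
    ultimately have "walk_weight ?zs \<in> ground_field E"
      using W by (intro walk_weight_closed_in_ground_field) auto
    moreover have "walk_weight ?zs = c a * c b * lf a b"
      using W by (simp add: walk_weight_append walk_weight_rev hd_rev c_def)
    ultimately show ?thesis by simp
  qed
  then show ?thesis using that nz tilde by blast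
qed

text \<open>Every vertex of a cyclic product occurs once as a first and once as a second index, so
  rescaling multiplies the product by the squares of the factors c. These squares lie in K because
  the normals are unit vectors.\<close>

lemma ground_field_subset_of_gauge:
  assumes K: "is_subfield K" and nz: "\<And>a. a \<in> E \<Longrightarrow> c a \<noteq> 0" and unit: "\<And>a. a \<in> E \<Longrightarrow> lf a a = 1"
    and cK: "\<And>a b. a \<in> E \<Longrightarrow> b \<in> E \<Longrightarrow> c a * c b * lf a b \<in> K"
  shows "ground_field E \<subseteq> K"
  unfolding ground_field_def
proof (rule gen_field_least[OF K])
  show "cyc E \<subseteq> K"
  proof
    fix y assume "y \<in> cyc E"
    then obtain xs where xs: "xs \<noteq> []" "set xs \<subseteq> E"
      and y: "y = (\<Prod>j<length xs. lf (xs ! j) (xs ! (Suc j mod length xs)))"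
      unfolding cyc_def by blast
    let ?n = "length xs"
    have mem: "xs ! j \<in> E" if "j < ?n" for j using that xs(2) nth_mem by blast
    obtain m where m: "?n = Suc m" using xs(1) by (cases xs) auto
    have "(\<Prod>j<m. c (xs ! (Suc j mod Suc m))) = (\<Prod>j<m. c (xs ! Suc j))"
      by (intro prod.cong) auto
    then have "(\<Prod>j<?n. c (xs ! (Suc j mod ?n))) = (\<Prod>j<m. c (xs ! Suc j)) * c (xs ! 0)"
      unfolding m by simp
    also have "\<dots> = (\<Prod>j<?n. c (xs ! j))" unfolding m by (simp only: prod.lessThan_Suc_shift mult.commute)
    finally have shift: "(\<Prod>j<?n. c (xs ! (Suc j mod ?n))) = (\<Prod>j<?n. c (xs ! j))" .
    have "(\<Prod>j<?n. c (xs ! j) * c (xs ! (Suc j mod ?n)) * lf (xs ! j) (xs ! (Suc j mod ?n)))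
        = (\<Prod>j<?n. c (xs ! j) * c (xs ! j)) * y"
      unfolding y by (simp add: prod.distrib shift)
    moreover have "(\<Prod>j<?n. c (xs ! j) * c (xs ! j)) \<noteq> 0" using nz mem by simp
    ultimately have "y = (\<Prod>j<?n. c (xs ! j) * c (xs ! (Suc j mod ?n)) * lf (xs ! j) (xs ! (Suc j mod ?n)))
        / (\<Prod>j<?n. c (xs ! j) * c (xs ! j))" by simp
    also have "\<dots> \<in> K"
    proof (intro subfield_divide[OF K] subfield_prod[OF K])
      fix j assume j: "j \<in> {..<?n}"
      then show "c (xs ! j) * c (xs ! (Suc j mod ?n)) * lf (xs ! j) (xs ! (Suc j mod ?n)) \<in> K"
        using mem m by (intro cK) auto
      show "c (xs ! j) * c (xs ! j) \<in> K"
        using cK[OF mem mem, of j j] unit[OF mem, of j] j by simp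
    qed
    finally show "y \<in> K" .
  qed
qed

lemma rembedding_iff_cembedding: "rembedding K \<sigma> \<longleftrightarrow> cembedding K (\<lambda>x. of_real (\<sigma> x))"
  unfolding rembedding_def cembedding_def
  by (simp add: of_real_add[symmetric] of_real_mult[symmetric] of_real_eq_1_iff del: of_real_add of_real_mult)

lemma complex_sqrt_real:
  assumes "z * z = complex_of_real a" "a \<ge> 0" shows "z \<in> \<real>"
proof -
  have "z * z = of_real (sqrt a) * of_real (sqrt a)" using assms by (simp flip: of_real_mult)
  then have "z = of_real (sqrt a) \<or> z = - of_real (sqrt a)" by (simp add: square_eq_iff)
  then show ?thesis by auto
qed

section \<open>Faces of quasi-arithmetic polytopes\<close>

locale quasi_arithmetic_face = finite_volume_face E F k for E :: "('n::finite) lvec set" and F k +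
  assumes tot_real: "totally_real_number_field (tilde_field E)"
    and psd: "\<And>\<sigma> x. rembedding (tilde_field E) \<sigma> \<Longrightarrow> x \<in> ground_field E \<Longrightarrow> \<sigma> x \<noteq> x \<Longrightarrow> psd_sigma E \<sigma>"
begin

text \<open>\<open>N\<close> is defined as an image, and injectivity is not established; a fixed
  representative lets sums over N be written in terms of normals of P.\<close>

definition rep where "rep u = (SOME e. e \<in> A \<and> u = unitize (pr e))"
definition s where "s u = sqrt (lf (pr (rep u)) (pr (rep u)))"
definition L where "L = gen_field (s ` N \<union> tilde_field E)"

lemma rep: assumes "u \<in> N" shows "rep u \<in> A" "u = unitize (pr (rep u))" "rep u \<in> E"
proof -
  have "rep u \<in> A \<and> u = unitize (pr (rep u))"
    unfolding rep_def by (rule someI_ex) (use face_normalE[OF assms] in blast)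
  then show "rep u \<in> A" "u = unitize (pr (rep u))" "rep u \<in> E" using A_subset by blast+
qed

lemma
  assumes "u \<in> N"
  shows s_pos: "s u > 0" and s_square: "s u * s u = lf (pr (rep u)) (pr (rep u))"
  using lf_lproj_lproj_pos[OF rep(1)[OF assms]] by (simp_all add: s_def)

lemma lf_normals:
  assumes "u \<in> N" "v \<in> N"
  shows "lf u v = lf (pr (rep u)) (pr (rep v)) / (s u * s v)"
proof -
  have "lf u v = lf (unitize (pr (rep u))) (unitize (pr (rep v)))"
    using rep(2)[OF assms(1)] rep(2)[OF assms(2)] by simp
  then show ?thesis by (simp add: unitize_def lf_linear s_def)
qed

lemma lf_lproj_right: "lf (pr x) (pr y) = lf (pr x) y"
  using lf_lproj[OF lproj_in_V[of x], of y] lf_sym by metis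

lemma lproj_scaleR: "pr (a *\<^sub>R x) = a *\<^sub>R pr x"
proof -
  obtain p where p: "p \<in> F" using F_nonempty by blast
  show ?thesis
  proof (rule lproj_eqI[OF subspace_span span_base[OF p]])
    show "lf p p < 0" using p F_subset_hyp hypD(1)[of p] by auto
    show "a *\<^sub>R pr x \<in> V" using lproj_in_V by (rule span_scale)
    show "lf (a *\<^sub>R x - a *\<^sub>R pr x) w = 0" if "w \<in> V" for w
      using lf_lproj[OF that, of x] by (simp add: lf_linear)
  qed
qed

text \<open>The projection of the rescaled normal has coefficients in the ground field with respect
  to the rescaled T, so pairing it with the rescaled f involves only rescaled Gram entries.\<close>

lemma lf_lproj_in_ground_field:
  assumes nz: "\<And>a. a \<in> E \<Longrightarrow> c a \<noteq> 0"
    and c: "\<And>a b. a \<in> E \<Longrightarrow> b \<in> E \<Longrightarrow> c a * c b * lf a b \<in> ground_field E"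
    and ef: "e \<in> E" "f \<in> E"
  shows "c e * c f * lf (pr e) (pr f) \<in> ground_field E"
proof -
  note K = is_subfield_ground_field[of E]
  obtain a where a: "\<And>t. t \<in> T \<Longrightarrow> a t \<in> ground_field E"
    "pr (c e *\<^sub>R e) = c e *\<^sub>R e - (\<Sum>t\<in>T. (a t * c t) *\<^sub>R t)"
  proof (rule lproj_expansion[OF K, of c "c e *\<^sub>R e"])
    show "c t \<noteq> 0" if "t \<in> T" for t using nz that T_subset by blast
    show "c s * c t * lf s t \<in> ground_field E" if "s \<in> T" "t \<in> T" for s t using c that T_subset by blast
    show "c t * lf (c e *\<^sub>R e) t \<in> ground_field E" if "t \<in> T" for t
      using c[OF ef(1), of t] that T_subset by (auto simp: lf_linear mult_ac)
  qed blast
  have "c e * c f * lf (pr e) (pr f) = c f * lf (pr (c e *\<^sub>R e)) f"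
    by (simp add: lf_lproj_right lproj_scaleR lf_linear)
  also have "\<dots> = c e * c f * lf e f - (\<Sum>t\<in>T. a t * (c t * c f * lf t f))"
    unfolding a(2) by (simp add: lf_linear lf_sum_left sum_distrib_left algebra_simps)
  also have "\<dots> \<in> ground_field E"
  proof (intro subfield_diff[OF K] subfield_sum[OF K] c ef)
    show "a t * (c t * c f * lf t f) \<in> ground_field E" if "t \<in> T" for t
      using a(1) c ef that T_subset by (intro subfield_mult[OF K _ c]) auto
  qed
  finally show ?thesis .
qed

text \<open>For e = f the factor \<open>c e * c e\<close> is itself a rescaled Gram entry, since
  \<open>lf e e = 1\<close>, and can be divided out.\<close>

lemma s_square_in_ground_field:
  assumes "u \<in> N" shows "s u * s u \<in> ground_field E"
proof -
  obtain c where c: "\<And>a. a \<in> E \<Longrightarrow> c a \<noteq> 0"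
    "\<And>a b. a \<in> E \<Longrightarrow> b \<in> E \<Longrightarrow> c a * c b * lf a b \<in> ground_field E"
    using cyclic_gauge[of E] by metis
  let ?e = "rep u"
  have e: "?e \<in> E" using rep(3)[OF assms] .
  have "c ?e * c ?e \<in> ground_field E" using c(2)[OF e e] unit_E[OF e] by simp
  moreover have "c ?e * c ?e * (s u * s u) \<in> ground_field E"
    unfolding s_square[OF assms] using lf_lproj_in_ground_field[of c, OF c e e] .
  ultimately have "c ?e * c ?e * (s u * s u) / (c ?e * c ?e) \<in> ground_field E"
    by (intro subfield_divide[OF is_subfield_ground_field])
  then show ?thesis using c(1)[OF e] by simp
qed

text \<open>The factor \<open>s u\<close> in the gauge undoes the normalisation of u. The gauge
  itself may lie outside the ground field; only the rescaled Gram entries have to lie in it.\<close>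

lemma ground_field_face_subset: "ground_field N \<subseteq> ground_field E"
proof -
  obtain c where c: "\<And>a. a \<in> E \<Longrightarrow> c a \<noteq> 0"
    "\<And>a b. a \<in> E \<Longrightarrow> b \<in> E \<Longrightarrow> c a * c b * lf a b \<in> ground_field E"
    using cyclic_gauge[of E] by metis
  show ?thesis
  proof (rule ground_field_subset_of_gauge[OF is_subfield_ground_field, where c = "\<lambda>u. c (rep u) * s u"])
    show "c (rep u) * s u \<noteq> 0" if "u \<in> N" for u using c(1)[OF rep(3)[OF that]] s_pos[OF that] by simp
    show "lf u u = 1" if "u \<in> N" for u using convex_polytope_face that by (simp add: convex_polytope_def)
    fix u v assume uv: "u \<in> N" "v \<in> N"
    have eq: "c (rep u) * s u * (c (rep v) * s v) * lf u v = c (rep u) * c (rep v) * lf (pr (rep u)) (pr (rep v))"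
      using s_pos[OF uv(1)] s_pos[OF uv(2)] by (simp add: lf_normals[OF uv])
    show "c (rep u) * s u * (c (rep v) * s v) * lf u v \<in> ground_field E"
      unfolding eq by (rule lf_lproj_in_ground_field[of c, OF c rep(3)[OF uv(1)] rep(3)[OF uv(2)]])
  qed
qed

text \<open>An unscaled expansion, now over the field on which embeddings are given; summing over
  all of E gives it the shape of \<open>psd_sigma\<close>.\<close>

lemma lproj_combination:
  assumes "e \<in> E"
  shows "\<exists>b. (\<forall>f\<in>E. b f \<in> tilde_field E) \<and> pr e = (\<Sum>f\<in>E. b f *\<^sub>R f)"
proof -
  note K = is_subfield_tilde_field[of E]
  obtain a where a: "\<And>t. t \<in> T \<Longrightarrow> a t \<in> tilde_field E" "pr e = e - (\<Sum>t\<in>T. (a t * 1) *\<^sub>R t)"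
    by (rule lproj_expansion[OF K, of "\<lambda>_. 1" e]) (auto intro!: gram_in_tilde_field assms subsetD[OF T_subset])
  define b where "b f = (if f = e then 1 else 0) - (if f \<in> T then a f else 0)" for f
  have "(\<Sum>f\<in>E. b f *\<^sub>R f) = (\<Sum>f\<in>E. if f = e then f else 0) - (\<Sum>f\<in>E. if f \<in> T then a f *\<^sub>R f else 0)"
    unfolding b_def sum_subtractf[symmetric] by (intro sum.cong) (auto simp: algebra_simps)
  also have "(\<Sum>f\<in>E. if f = e then f else 0) = e" using finite_E assms by simp
  also have "(\<Sum>f\<in>E. if f \<in> T then a f *\<^sub>R f else 0) = (\<Sum>t\<in>T. a t *\<^sub>R t)"
    using finite_E T_subset by (simp add: sum.inter_restrict[symmetric] Int_absorb1)
  finally have "pr e = (\<Sum>f\<in>E. b f *\<^sub>R f)" using a(2) by simp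
  moreover have "b f \<in> tilde_field E" for f
    unfolding b_def using a(1) by (intro subfield_diff[OF K]) (auto intro: subfield_0[OF K] subfield_1[OF K])
  ultimately show ?thesis by (intro exI[of _ b]) simp
qed

lemma lf_lproj_in_tilde_field:
  assumes "e \<in> E" "f \<in> E" shows "lf (pr e) (pr f) \<in> tilde_field E"
proof -
  obtain b where b: "\<forall>f\<in>E. b f \<in> tilde_field E" "pr e = (\<Sum>f\<in>E. b f *\<^sub>R f)"
    using lproj_combination[OF assms(1)] by blast
  have "lf (pr e) (pr f) = lf (pr e) f" by (rule lf_lproj_right)
  also have "\<dots> = (\<Sum>g\<in>E. b g * lf g f)" unfolding b(2) by (simp add: lf_sum_left lf_linear)
  also have "\<dots> \<in> tilde_field E"
    using b(1)
    by (intro subfield_sum[OF is_subfield_tilde_field] subfield_mult[OF is_subfield_tilde_field]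
        gram_in_tilde_field assms(2)) auto
  finally show ?thesis .
qed

lemma is_subfield_L: "is_subfield L" and tilde_field_subset_L: "tilde_field E \<subseteq> L"
  and s_in_L: "u \<in> N \<Longrightarrow> s u \<in> L"
  using is_subfield_gen_field gen_field_superset[of "s ` N \<union> tilde_field E"] by (auto simp: L_def)

lemma number_field_L: "number_field L"
  unfolding L_def
proof (rule number_field_adjoin_sqrts)
  show "finite (s ` N)" using finite_N by simp
  show "number_field (tilde_field E)" using tot_real by (simp add: totally_real_number_field_def)
  show "x * x \<in> tilde_field E" if "x \<in> s ` N" for x
    using that s_square_in_ground_field ground_field_subset_tilde_field by blast
qed

lemma tilde_field_face_subset_L: "tilde_field N \<subseteq> L"
  unfolding tilde_field_def[of N]
proof (rule gen_field_least[OF is_subfield_L])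
  have "lf u v \<in> L" if "u \<in> N" "v \<in> N" for u v
    unfolding lf_normals[OF that]
    using lf_lproj_in_tilde_field[OF rep(3)[OF that(1)] rep(3)[OF that(2)]] tilde_field_subset_L s_in_L that
    by (intro subfield_divide[OF is_subfield_L] subfield_mult[OF is_subfield_L]) auto
  then show "gram_entries N \<subseteq> L" unfolding gram_entries_def by blast
qed

text \<open>If B is the matrix of coefficients of the projections and G the Gram matrix of P, the
  projections have Gram matrix B G B^T. Applying \<sigma> entrywise conjugates all three factors,
  and a congruence preserves semidefiniteness.\<close>

lemma psd_lproj:
  assumes \<tau>: "cembedding (tilde_field E) (\<lambda>x. complex_of_real (\<sigma> x))" and psd: "psd_sigma E \<sigma>"
    and g: "\<And>i. i \<in> I \<Longrightarrow> g i \<in> E"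
  shows "(\<Sum>i\<in>I. \<Sum>j\<in>I. c i * c j * \<sigma> (lf (pr (g i)) (pr (g j)))) \<ge> 0"
proof -
  note K = is_subfield_tilde_field[of E]
  have mult: "\<sigma> (x * y) = \<sigma> x * \<sigma> y" if "x \<in> tilde_field E" "y \<in> tilde_field E" for x y
    using cembedding_mult[OF \<tau> that] by (simp flip: of_real_mult)
  have sum: "\<sigma> (sum f J) = (\<Sum>i\<in>J. \<sigma> (f i))" if "\<And>i. i \<in> J \<Longrightarrow> f i \<in> tilde_field E"
    for f and J :: "'n lvec set"
    using cembedding_sum[OF K \<tau> that] by (simp flip: of_real_sum)
  define b where "b i = (SOME b. (\<forall>f\<in>E. b f \<in> tilde_field E) \<and> pr (g i) = (\<Sum>f\<in>E. b f *\<^sub>R f))" for i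
  have "(\<forall>f\<in>E. b i f \<in> tilde_field E) \<and> pr (g i) = (\<Sum>f\<in>E. b i f *\<^sub>R f)" if "i \<in> I" for i
    unfolding b_def by (rule someI_ex[OF lproj_combination[OF g[OF that]]])
  then have b: "\<And>i f. i \<in> I \<Longrightarrow> f \<in> E \<Longrightarrow> b i f \<in> tilde_field E"
    "\<And>i. i \<in> I \<Longrightarrow> pr (g i) = (\<Sum>f\<in>E. b i f *\<^sub>R f)" by blast+
  have exp: "\<sigma> (lf (pr (g i)) (pr (g j))) = (\<Sum>e\<in>E. \<Sum>f\<in>E. \<sigma> (b i e) * \<sigma> (b j f) * \<sigma> (lf e f))"
    if ij: "i \<in> I" "j \<in> I" for i j
  proof -
    have mem: "b i e \<in> tilde_field E" "b j f \<in> tilde_field E" "b i e * b j f \<in> tilde_field E"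
      "lf e f \<in> tilde_field E" "b i e * b j f * lf e f \<in> tilde_field E" if "e \<in> E" "f \<in> E" for e f
      using b(1)[OF ij(1) that(1)] b(1)[OF ij(2) that(2)] gram_in_tilde_field[OF that]
      by (auto intro: subfield_mult[OF K])
    have "lf (pr (g i)) (pr (g j)) = (\<Sum>e\<in>E. \<Sum>f\<in>E. b i e * b j f * lf e f)"
      unfolding b(2)[OF ij(1)] b(2)[OF ij(2)] by (rule lf_combinations)
    then have "\<sigma> (lf (pr (g i)) (pr (g j))) = \<sigma> (\<Sum>e\<in>E. \<Sum>f\<in>E. b i e * b j f * lf e f)"
      by simp
    also have "\<dots> = (\<Sum>e\<in>E. \<sigma> (\<Sum>f\<in>E. b i e * b j f * lf e f))"
      by (intro sum subfield_sum[OF K] mem(5))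
    also have "\<dots> = (\<Sum>e\<in>E. \<Sum>f\<in>E. \<sigma> (b i e * b j f * lf e f))"
      by (intro sum.cong refl sum mem(5))
    also have "\<dots> = (\<Sum>e\<in>E. \<Sum>f\<in>E. \<sigma> (b i e) * \<sigma> (b j f) * \<sigma> (lf e f))"
      by (intro sum.cong refl) (simp add: mult mem)
    finally show ?thesis .
  qed
  define y where "y e = (\<Sum>i\<in>I. c i * \<sigma> (b i e))" for e
  have "(\<Sum>i\<in>I. \<Sum>j\<in>I. c i * c j * \<sigma> (lf (pr (g i)) (pr (g j))))
      = (\<Sum>i\<in>I. \<Sum>j\<in>I. \<Sum>e\<in>E. \<Sum>f\<in>E. (c i * \<sigma> (b i e)) * (c j * \<sigma> (b j f)) * \<sigma> (lf e f))"
    by (intro sum.cong refl) (simp add: exp sum_distrib_left mult_ac)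
  also have "\<dots> = (\<Sum>e\<in>E. \<Sum>f\<in>E. \<Sum>i\<in>I. \<Sum>j\<in>I. (c i * \<sigma> (b i e)) * (c j * \<sigma> (b j f)) * \<sigma> (lf e f))"
    by (simp only: sum.swap[of _ E I])
  also have "\<dots> = (\<Sum>e\<in>E. \<Sum>f\<in>E. y e * y f * \<sigma> (lf e f))"
    unfolding y_def sum_product by (simp only: sum_distrib_right)
  also have "\<dots> \<ge> 0" using psd unfolding psd_sigma_def by blast
  finally show ?thesis .
qed

section \<open>Embeddings of the common field L\<close>

context
  fixes \<tau> assumes \<tau>: "cembedding L \<tau>"
begin

lemma embedding_real_on_tilde_field: "x \<in> tilde_field E \<Longrightarrow> \<tau> x = of_real (Re (\<tau> x))"
  using tot_real cembedding_mono[OF \<tau> tilde_field_subset_L] unfolding totally_real_number_field_def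
  by (metis of_real_Re)

lemma embedding_tilde_field: "cembedding (tilde_field E) (\<lambda>x. complex_of_real (Re (\<tau> x)))"
  using cembedding_mono[OF \<tau> tilde_field_subset_L] embedding_real_on_tilde_field
  unfolding cembedding_def
  by (metis is_subfield_tilde_field subfield_1 subfield_add subfield_mult)

lemma embedding_psd:
  assumes "x \<in> ground_field E" "\<tau> x \<noteq> of_real x"
  shows "psd_sigma E (\<lambda>x. Re (\<tau> x))"
proof (rule psd)
  show "rembedding (tilde_field E) (\<lambda>x. Re (\<tau> x))"
    unfolding rembedding_iff_cembedding by (rule embedding_tilde_field)
  show "x \<in> ground_field E" by fact
  show "Re (\<tau> x) \<noteq> x"
    using assms embedding_real_on_tilde_field[of x] ground_field_subset_tilde_field[of E] by auto
qed

text \<open>Here quasi-arithmeticity of P enters: a conjugate of (pr e, pr e) is either unchanged or a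
  value of the positive semidefinite conjugate form.\<close>
lemma embedding_real_on_s:
  assumes u: "u \<in> N" shows "\<tau> (s u) \<in> \<real>"
proof -
  let ?d = "lf (pr (rep u)) (pr (rep u))"
  have d: "?d \<in> ground_field E" using s_square_in_ground_field[OF u] s_square[OF u] by simp
  have "\<tau> (s u) * \<tau> (s u) = \<tau> ?d"
    using cembedding_mult[OF \<tau> s_in_L[OF u] s_in_L[OF u]] s_square[OF u] by simp
  also have "\<dots> = of_real (Re (\<tau> ?d))"
    using embedding_real_on_tilde_field d ground_field_subset_tilde_field by blast
  finally have sq: "\<tau> (s u) * \<tau> (s u) = of_real (Re (\<tau> ?d))" .
  have "Re (\<tau> ?d) \<ge> 0"
  proof (cases "\<tau> ?d = of_real ?d")
    case True
    then show ?thesis using s_square[OF u] by (metis Re_complex_of_real zero_le_square)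
  next
    case False
    show ?thesis
      using psd_lproj[OF embedding_tilde_field embedding_psd[OF d False], of "{u}" rep "\<lambda>_. 1"]
        rep(3)[OF u] by simp
  qed
  then show ?thesis using sq complex_sqrt_real by blast
qed

text \<open>The elements of L with real image form a subfield, and it contains the generators of
  L.\<close>

lemma embedding_real:
  assumes "x \<in> L" shows "\<tau> x \<in> \<real>"
proof -
  have "is_subfield {x \<in> L. \<tau> x \<in> \<real>}"
    unfolding is_subfield_def
    using is_subfield_L \<tau>
    by (auto simp: subfield_0 subfield_1 subfield_add subfield_mult subfield_minus subfield_inverse
        cembedding_0 cembedding_1 cembedding_add cembedding_mult cembedding_minus cembedding_inverse)
  moreover have "\<tau> x \<in> \<real>" if "x \<in> tilde_field E" for x
    using embedding_real_on_tilde_field[OF that] by (metis Reals_of_real)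
  then have "s ` N \<union> tilde_field E \<subseteq> {x \<in> L. \<tau> x \<in> \<real>}"
    using embedding_real_on_s s_in_L tilde_field_subset_L by blast
  ultimately have "L \<subseteq> {x \<in> L. \<tau> x \<in> \<real>}" using gen_field_least unfolding L_def by blast
  then show ?thesis using assms by blast
qed

text \<open>Since the conjugates of the \<open>s u\<close> are real, normalising the projections is
  a real diagonal congruence and keeps the form semidefinite; imaginary factors could reverse
  signs.\<close>

lemma embedding_psd_face:
  assumes x: "x \<in> ground_field E" "\<tau> x \<noteq> of_real x"
  shows "(\<Sum>u\<in>N. \<Sum>v\<in>N. c u * c v * Re (\<tau> (lf u v))) \<ge> 0"
proof -
  have lfL: "lf (pr (rep u)) (pr (rep v)) \<in> L" if "u \<in> N" "v \<in> N" for u v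
    using lf_lproj_in_tilde_field[OF rep(3)[OF that(1)] rep(3)[OF that(2)]] tilde_field_subset_L by blast
  have re: "\<tau> x = of_real (Re (\<tau> x))" if "x \<in> L" for x using embedding_real[OF that] by simp
  have "Re (\<tau> (lf u v)) = Re (\<tau> (lf (pr (rep u)) (pr (rep v)))) / (Re (\<tau> (s u)) * Re (\<tau> (s v)))"
    if uv: "u \<in> N" "v \<in> N" for u v
  proof -
    have "\<tau> (lf u v) = \<tau> (lf (pr (rep u)) (pr (rep v))) / (\<tau> (s u) * \<tau> (s v))"
      unfolding lf_normals[OF uv] using lfL[OF uv] s_in_L uv
      by (simp add: cembedding_divide[OF is_subfield_L \<tau>] cembedding_mult[OF \<tau>] subfield_mult[OF is_subfield_L])
    also have "\<dots> = of_real (Re (\<tau> (lf (pr (rep u)) (pr (rep v)))) / (Re (\<tau> (s u)) * Re (\<tau> (s v))))"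
      using re[OF lfL[OF uv]] re[OF s_in_L[OF uv(1)]] re[OF s_in_L[OF uv(2)]] by (metis of_real_divide of_real_mult)
    finally show ?thesis by simp
  qed
  then have "(\<Sum>u\<in>N. \<Sum>v\<in>N. c u * c v * Re (\<tau> (lf u v)))
      = (\<Sum>u\<in>N. \<Sum>v\<in>N. (c u / Re (\<tau> (s u))) * (c v / Re (\<tau> (s v))) * Re (\<tau> (lf (pr (rep u)) (pr (rep v)))))"
    by (intro sum.cong refl) (simp add: field_simps)
  also have "\<dots> \<ge> 0" 
    using psd_lproj[OF embedding_tilde_field embedding_psd[OF x], of N rep "\<lambda>u. c u / Re (\<tau> (s u))", OF rep(3)]
    by simp
  finally show ?thesis .
qed

end

lemma totally_real_face: "totally_real_number_field (tilde_field N)"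
  unfolding totally_real_number_field_def
proof (intro conjI allI impI ballI)
  show "number_field (tilde_field N)"
    using number_field_subfield[OF number_field_L is_subfield_tilde_field tilde_field_face_subset_L] .
  fix \<tau> x assume \<tau>: "cembedding (tilde_field N) \<tau>" and x: "x \<in> tilde_field N"
  obtain \<tau>' where \<tau>': "cembedding L \<tau>'" "\<And>x. x \<in> tilde_field N \<Longrightarrow> \<tau>' x = \<tau> x"
    using cembedding_extend[OF number_field_L is_subfield_tilde_field tilde_field_face_subset_L \<tau>] by blast
  then show "\<tau> x \<in> \<real>" using embedding_real[OF \<tau>'(1)] x tilde_field_face_subset_L by (metis subsetD)
qed

lemma psd_face:
  assumes \<sigma>: "rembedding (tilde_field N) \<sigma>" and x: "x \<in> ground_field N" "\<sigma> x \<noteq> x"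
  shows "psd_sigma N \<sigma>"
proof -
  obtain \<tau> where \<tau>: "cembedding L \<tau>" "\<And>x. x \<in> tilde_field N \<Longrightarrow> \<tau> x = complex_of_real (\<sigma> x)"
    using cembedding_extend[OF number_field_L is_subfield_tilde_field tilde_field_face_subset_L]
      \<sigma> unfolding rembedding_iff_cembedding by blast
  have "\<tau> x \<noteq> of_real x" using \<tau>(2)[of x] x ground_field_subset_tilde_field[of N] by auto
  moreover have "x \<in> ground_field E" using x ground_field_face_subset by blast
  ultimately have "(\<Sum>u\<in>N. \<Sum>v\<in>N. c u * c v * Re (\<tau> (lf u v))) \<ge> 0" for c
    using embedding_psd_face[OF \<tau>(1)] by blast
  moreover have "(\<Sum>u\<in>N. \<Sum>v\<in>N. c u * c v * Re (\<tau> (lf u v))) = (\<Sum>u\<in>N. \<Sum>v\<in>N. c u * c v * \<sigma> (lf u v))" for c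
    by (intro sum.cong refl) (simp add: \<tau>(2) gram_in_tilde_field)
  ultimately show ?thesis unfolding psd_sigma_def by simp
qed

text \<open>Otherwise some embedding fixes the ground field of the face but moves the one of P. It fixes the
  rescaled Gram matrix of the face and makes it positive semidefinite, although the face normals
  span a time-like vector.\<close>
lemma ground_field_subset_face: "ground_field E \<subseteq> ground_field N"
proof (rule ccontr)
  assume "\<not> ?thesis"
  then obtain \<alpha> where \<alpha>: "\<alpha> \<in> ground_field E" "\<alpha> \<notin> ground_field N" by blast
  have sub: "ground_field N \<subseteq> L" using ground_field_subset_tilde_field tilde_field_face_subset_L by blast
  have "\<alpha> \<in> L" using \<alpha> ground_field_subset_tilde_field tilde_field_subset_L by blast
  then obtain \<tau> where \<tau>: "cembedding L \<tau>" "\<And>x. x \<in> ground_field N \<Longrightarrow> \<tau> x = of_real x" "\<tau> \<alpha> \<noteq> of_real \<alpha>"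
    using cembedding_moving_exists[OF number_field_L is_subfield_ground_field sub _ \<alpha>(2)] by blast
  obtain c where c: "\<And>a. a \<in> N \<Longrightarrow> c a \<noteq> 0" "\<And>a. a \<in> N \<Longrightarrow> c a \<in> tilde_field N"
    "\<And>a b. a \<in> N \<Longrightarrow> b \<in> N \<Longrightarrow> c a * c b * lf a b \<in> ground_field N"
    using cyclic_gauge[of N] by metis
  define \<sigma> where "\<sigma> x = Re (\<tau> x)" for x
  have re: "\<tau> x = of_real (\<sigma> x)" if "x \<in> L" for x
    using embedding_real[OF \<tau>(1) that] by (simp add: \<sigma>_def)
  \<comment> \<open>The left side lies in the ground field of the face, which \<tau> fixes, and
    \<tau> is multiplicative on L.\<close>
  have fixed: "c u * c v * lf u v = \<sigma> (c u) * \<sigma> (c v) * \<sigma> (lf u v)" if uv: "u \<in> N" "v \<in> N" for u v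
  proof -
    have L: "c u \<in> L" "c v \<in> L" "lf u v \<in> L"
      using c(2)[OF uv(1)] c(2)[OF uv(2)] gram_in_tilde_field[OF uv] tilde_field_face_subset_L by auto
    have "complex_of_real (c u * c v * lf u v) = \<tau> (c u * c v * lf u v)" using \<tau>(2)[OF c(3)[OF uv]] by simp
    also have "\<dots> = \<tau> (c u) * \<tau> (c v) * \<tau> (lf u v)"
      using L by (simp add: cembedding_mult[OF \<tau>(1)] subfield_mult[OF is_subfield_L])
    also have "\<dots> = of_real (\<sigma> (c u) * \<sigma> (c v) * \<sigma> (lf u v))" using re L by simp
    finally show ?thesis by (simp only: of_real_eq_iff)
  qed
  obtain p where p: "p \<in> hypV V" using face_relative_interior_point by blast
  then have "p \<in> span N" using span_face_normals by (simp add: hypV_def)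
  then obtain y where y: "p = (\<Sum>u\<in>N. y u *\<^sub>R u)" unfolding span_finite[OF finite_N] by blast
  have "-1 = lf p p" using p by (simp add: hypV_def hyp_def)
  also have "\<dots> = (\<Sum>u\<in>N. \<Sum>v\<in>N. y u * y v * lf u v)"
    unfolding y by (rule lf_combinations)
  \<comment> \<open>Passing to the fixed rescaled entries and back with conjugated factors exhibits
    -1 as a value of the conjugate form.\<close>
  also have "\<dots> = (\<Sum>u\<in>N. \<Sum>v\<in>N. (y u / c u) * (y v / c v) * (c u * c v * lf u v))"
    using c(1) by (intro sum.cong refl) simp
  also have "\<dots> = (\<Sum>u\<in>N. \<Sum>v\<in>N. (y u / c u * \<sigma> (c u)) * (y v / c v * \<sigma> (c v)) * Re (\<tau> (lf u v)))"
    by (intro sum.cong refl) (simp only: fixed, simp only: \<sigma>_def mult_ac)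
  also have "\<dots> \<ge> 0" using embedding_psd_face[OF \<tau>(1) \<alpha>(1) \<tau>(3)] .
  finally show False by simp
qed

end

lemma coxeter_imp_acute_angled: "coxeter V E \<Longrightarrow> acute_angled V E"
  unfolding coxeter_def acute_angled_def
proof (intro ballI impI)
  fix e f
  assume cox: "\<forall>e\<in>E. \<forall>f\<in>E. e \<noteq> f \<and> hplane V e \<inter> hplane V f \<noteq> {} \<longrightarrow>
      (\<exists>m::nat. m \<ge> 2 \<and> dihedral e f = pi / real m)"
    and "e \<in> E" "f \<in> E" "e \<noteq> f \<and> hplane V e \<inter> hplane V f \<noteq> {}"
  then obtain m :: nat where "m \<ge> 2" "dihedral e f = pi / real m" by blast
  moreover from this have "pi / real m \<le> pi / 2" by (intro divide_left_mono) auto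
  ultimately show "dihedral e f \<le> pi / 2" by simp
qed

theorem theorem1p1:
  fixes E :: "('n::finite) lvec set" and F :: "'n lvec set" and k :: nat
  assumes "quasi_arithmetic UNIV E"
    and "coxeter UNIV E"
    and "is_face E F k"
    and "2 \<le> k" and "k \<le> CARD('n) - 1"
    and "coxeter (span F) (face_normals E F)"
  shows "quasi_arithmetic (span F) (face_normals E F) \<and>
         coxeter (span F) (face_normals E F) \<and>
         ground_field (face_normals E F) = ground_field E"
proof -
  \<comment> \<open>The locale condition \<open>2 \<le> CARD('n)\<close> comes from the two bounds
    on k.\<close>
  interpret quasi_arithmetic_face E F k
    using assms by unfold_locales (auto simp: quasi_arithmetic_def)
  show ?thesis
    using convex_polytope_face finite_hvolume_face coxeter_imp_acute_angled[OF assms(6)]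
      totally_real_face psd_face assms(6) ground_field_face_subset ground_field_subset_face
    unfolding quasi_arithmetic_def by blast
qed

end
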